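(* Every contact sub-Riemannian metric $(D,h)$ on a manifold $M$ is $(4,1)$-sub-rigid. That is, for every $x \in M$, any $4$-isometry of $(D,h)$ at $x$ whose $1$-jet at $x$ is trivial has trivial $2$-jet at $x$.
   Context: All objects are smooth. A sub-Riemannian structure (metric) $(D,h)$ on a manifold $M$ consists of a hyperplane field $D \subset TM$ (a sub-bundle of codimension one) together with a Riemannian metric $h$ on the vector bundle $D$. It is called contact if $\dim M = 2d+1$ and $D$ is locally the kernel of a $1$-form $\omega$ such that $\omega \wedge (d\omega)^d$ is a volume form. A sub-Riemannian structure is a section $\sigma$ of the bundle over $M$ whose fiber at $y$ is the set of pairs (hyperplane of $T_yM$, Euclidean scalar product on this hyperplane). Equivalently, it is an $H$-structure, where $H \subset \mathrm{GL}_n(\mathbb{R})$, $n=\dim M$, is the subgroup preserving $\mathbb{R}^{n-1}$ and the standard Euclidean product on it. For $x\in M$ and an integer $m \ge 1$, an $m$-isometry of $\sigma$ at $x$ is (the $m$-jet at $x$ of) a local diffeomorphism $f$ of $M$ fixing $x$ such that $f^*\sigma$ and $\sigma$ have the same $(m-1)$-jet at $x$. The set of such $m$-jets is denoted $\mathrm{Iso}^m_x$. A jet at $x$ is trivial if it equals the jet of the identity map at $x$. The structure $\sigma$ is $(k+s,k)$-sub-rigid if, for every $x$, any $(k+s)$-isometry at $x$ whose $k$-jet is trivial has trivial $(k+1)$-jet; i.e., denoting by $\mathrm{Im}^{k+s,k+1}_x$ the image of $\mathrm{Iso}^{k+s}_x \to \mathrm{Iso}^{k+1}_x$, the map $\mathrm{Im}^{k+s,k+1}_x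 \to \mathrm{Iso}^k_x$ is injective for every $x$.
   Formalization: The formal statement assumes d ≥ 1 (dim M = 2d+1 ≥ 3); for dim M = 1 the plane field D is zero, every local diffeomorphism fixing x is a 4-isometry, and x ↦ x + x² at 0 violates the claim. *)

theory Defs
  imports "HOL-Analysis.Analysis"
begin

section \<open>Smooth functions and jets on Euclidean spaces\<close>

text \<open>\<open>Ck_on k f S\<close> is only meant for open \<open>S\<close>. In finite dimension, \<open>f\<close> is of class
  \<open>C\<^sup>k\<^sup>+\<^sup>1\<close> on \<open>S\<close> iff it is differentiable there and all its directional derivatives are of
  class \<open>C\<^sup>k\<close>.\<close>

primrec Ck_on ::
  "nat \<Rightarrow> ('e::euclidean_space \<Rightarrow> 'f::real_normed_vector) \<Rightarrow> 'e set \<Rightarrow> bool" where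
  "Ck_on 0 f S \<longleftrightarrow> continuous_on S f"
| "Ck_on (Suc k) f S \<longleftrightarrow>
     f differentiable_on S \<and> (\<forall>v. Ck_on k (\<lambda>x. frechet_derivative f (at x) v) S)"

definition smooth_on ::
  "'e::euclidean_space set \<Rightarrow> ('e \<Rightarrow> 'f::real_normed_vector) \<Rightarrow> bool" where
  "smooth_on S f \<longleftrightarrow> (\<forall>k. Ck_on k f S)"

primrec iter_deriv ::
  "'e list \<Rightarrow> ('e::euclidean_space \<Rightarrow> 'f::real_normed_vector) \<Rightarrow> 'e \<Rightarrow> 'f" where
  "iter_deriv [] f = f"
| "iter_deriv (v # vs) f = iter_deriv vs (\<lambda>x. frechet_derivative f (at x) v)"

text \<open>Equality of the \<open>m\<close>-jets at \<open>p\<close> of two functions that are smooth near \<open>p\<close>.\<close>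

definition same_jet ::
  "nat \<Rightarrow> ('e::euclidean_space \<Rightarrow> 'f::real_normed_vector) \<Rightarrow> ('e \<Rightarrow> 'f) \<Rightarrow> 'e \<Rightarrow> bool" where
  "same_jet m f g p \<longleftrightarrow> (\<forall>vs. length vs \<le> m \<longrightarrow> iter_deriv vs f p = iter_deriv vs g p)"

section \<open>Smooth manifolds\<close>

text \<open>A chart is a domain together with a coordinate map, of which only the values on the domain
  matter. The dimension of the manifold is the dimension of the model space \<open>'e\<close>.\<close>

type_synonym ('a, 'e) chart = "'a set \<times> ('a \<Rightarrow> 'e)"

abbreviation cdom :: "('a, 'e) chart \<Rightarrow> 'a set" where "cdom c \<equiv> fst c"

abbreviation cmap :: "('a, 'e) chart \<Rightarrow> 'a \<Rightarrow> 'e" where "cmap c \<equiv> snd c"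

definition cimg :: "('a, 'e) chart \<Rightarrow> 'e set" where
  "cimg c = cmap c ` cdom c"

definition cinv :: "('a, 'e) chart \<Rightarrow> 'e \<Rightarrow> 'a" where
  "cinv c = inv_into (cdom c) (cmap c)"

definition smooth_atlas :: "'a topology \<Rightarrow> ('a, 'e::euclidean_space) chart set \<Rightarrow> bool" where
  "smooth_atlas M A \<longleftrightarrow>
     (\<forall>c\<in>A. openin M (cdom c) \<and> open (cimg c) \<and>
        homeomorphic_map (subtopology M (cdom c)) (top_of_set (cimg c)) (cmap c)) \<and>
     topspace M = (\<Union>c\<in>A. cdom c) \<and>
     (\<forall>c\<in>A. \<forall>c'\<in>A. smooth_on (cmap c ` (cdom c \<inter> cdom c')) (cmap c' \<circ> cinv c))"

definition smooth_manifold :: "'a topology \<Rightarrow> ('a, 'e::euclidean_space) chart set \<Rightarrow> bool" where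
  "smooth_manifold M A \<longleftrightarrow> Hausdorff_space M \<and> second_countable M \<and> smooth_atlas M A"

definition charts_at :: "('a, 'e) chart set \<Rightarrow> 'a \<Rightarrow> ('a, 'e) chart set" where
  "charts_at A y = {c \<in> A. y \<in> cdom c}"

text \<open>The intersection \<open>U \<inter> cdom c \<inter> f -` cdom c'\<close> is open by continuity of \<open>f\<close>.\<close>

definition smooth_map ::
  "'a topology \<Rightarrow> ('a, 'e::euclidean_space) chart set \<Rightarrow> 'a set \<Rightarrow> ('a \<Rightarrow> 'a) \<Rightarrow> bool" where
  "smooth_map M A U f \<longleftrightarrow>
     continuous_map (subtopology M U) M f \<and>
     (\<forall>c\<in>A. \<forall>c'\<in>A. smooth_on (cmap c ` (U \<inter> cdom c \<inter> f -` cdom c')) (cmap c' \<circ> f \<circ> cinv c))"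

text \<open>\<open>f\<close> restricts to a diffeomorphism from the open set \<open>U\<close> onto the open set \<open>f ` U\<close>.\<close>

definition local_diffeo ::
  "'a topology \<Rightarrow> ('a, 'e::euclidean_space) chart set \<Rightarrow> 'a set \<Rightarrow> ('a \<Rightarrow> 'a) \<Rightarrow> bool" where
  "local_diffeo M A U f \<longleftrightarrow>
     openin M U \<and> openin M (f ` U) \<and> inj_on f U \<and>
     smooth_map M A U f \<and> smooth_map M A (f ` U) (inv_into U f)"

text \<open>Equality of the \<open>m\<close>-jets at \<open>x\<close> of two local maps that both fix \<open>x\<close>. The condition does not
  depend on the chart around \<open>x\<close>, so that all charts may be used.\<close>

definition same_map_jet ::
  "('a, 'e::euclidean_space) chart set \<Rightarrow> nat \<Rightarrow> ('a \<Rightarrow> 'a) \<Rightarrow> ('a \<Rightarrow> 'a) \<Rightarrow> 'a \<Rightarrow> bool" where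
  "same_map_jet A m f g x \<longleftrightarrow>
     (\<forall>c\<in>charts_at A x. same_jet m (cmap c \<circ> f \<circ> cinv c) (cmap c \<circ> g \<circ> cinv c) (cmap c x))"

section \<open>Tangent vectors\<close>

text \<open>A tangent vector at \<open>y\<close> is given by its components in all charts around \<open>y\<close>, related to
  each other by the derivatives of the transition maps; it is set to \<open>0\<close> at the other charts.\<close>

type_synonym ('a, 'e) tvec = "('a, 'e) chart \<Rightarrow> 'e"

definition tangent_space ::
  "('a, 'e::euclidean_space) chart set \<Rightarrow> 'a \<Rightarrow> ('a, 'e) tvec set" where
  "tangent_space A y =
     {v. (\<forall>c\<in>charts_at A y. \<forall>c'\<in>charts_at A y.
            v c' = frechet_derivative (cmap c' \<circ> cinv c) (at (cmap c y)) (v c)) \<and>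
         (\<forall>c. c \<notin> charts_at A y \<longrightarrow> v c = 0)}"

text \<open>The tangent vector at \<open>y\<close> whose component in the chart \<open>c\<close> around \<open>y\<close> is \<open>u\<close>.\<close>

definition tvec_of ::
  "('a, 'e::euclidean_space) chart set \<Rightarrow> ('a, 'e) chart \<Rightarrow> 'a \<Rightarrow> 'e \<Rightarrow> ('a, 'e) tvec" where
  "tvec_of A c y u =
     (\<lambda>c'. if c' \<in> charts_at A y
           then frechet_derivative (cmap c' \<circ> cinv c) (at (cmap c y)) u else 0)"

text \<open>The differential of \<open>f\<close> at \<open>y\<close>; the result does not depend on the choice of \<open>c\<close>.\<close>

definition tangent_map ::
  "('a, 'e::euclidean_space) chart set \<Rightarrow> ('a \<Rightarrow> 'a) \<Rightarrow> 'a \<Rightarrow> ('a, 'e) tvec \<Rightarrow> ('a, 'e) tvec" where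
  "tangent_map A f y v =
     (let c = (SOME c. c \<in> charts_at A y) in
        (\<lambda>c'. if c' \<in> charts_at A (f y)
              then frechet_derivative (cmap c' \<circ> f \<circ> cinv c) (at (cmap c y)) (v c) else 0))"

section \<open>Sub-Riemannian structures\<close>

text \<open>A field of pairs (hyperplane, scalar product) is given by \<open>D\<close> and \<open>h\<close>, where \<open>D y\<close> is a set
  of tangent vectors at \<open>y\<close>, and only the values of \<open>h y\<close> on \<open>D y\<close> are relevant. The next two
  definitions are the expressions of \<open>D\<close> and \<open>h\<close> in a chart.\<close>

definition hyp_in_chart ::
  "('a, 'e::euclidean_space) chart set \<Rightarrow> ('a \<Rightarrow> ('a, 'e) tvec set) \<Rightarrow> ('a, 'e) chart
     \<Rightarrow> 'e \<Rightarrow> 'e set" where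
  "hyp_in_chart A D c p = {u. tvec_of A c (cinv c p) u \<in> D (cinv c p)}"

definition metric_in_chart ::
  "('a, 'e::euclidean_space) chart set \<Rightarrow> ('a \<Rightarrow> ('a, 'e) tvec \<Rightarrow> ('a, 'e) tvec \<Rightarrow> real)
     \<Rightarrow> ('a, 'e) chart \<Rightarrow> 'e \<Rightarrow> 'e \<Rightarrow> 'e \<Rightarrow> real" where
  "metric_in_chart A h c p u v =
     h (cinv c p) (tvec_of A c (cinv c p) u) (tvec_of A c (cinv c p) v)"

definition euclidean_hyperplane ::
  "'e::euclidean_space set \<Rightarrow> ('e \<Rightarrow> 'e \<Rightarrow> real) \<Rightarrow> bool" where
  "euclidean_hyperplane P q \<longleftrightarrow>
     subspace P \<and> dim P + 1 = DIM('e) \<and>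
     (\<forall>u\<in>P. \<forall>u'\<in>P. \<forall>v\<in>P. q (u + u') v = q u v + q u' v) \<and>
     (\<forall>u\<in>P. \<forall>v\<in>P. \<forall>r. q (r *\<^sub>R u) v = r * q u v) \<and>
     (\<forall>u\<in>P. \<forall>v\<in>P. q u v = q v u) \<and>
     (\<forall>u\<in>P. u \<noteq> 0 \<longrightarrow> q u u > 0)"

text \<open>Affine charts on the manifold of pairs (hyperplane \<open>P\<close> of \<open>'e\<close>, scalar product \<open>q\<close> on \<open>P\<close>).
  For a vector \<open>w\<close>, the pairs with \<open>w \<notin> P\<close> form an open set, on which \<open>P\<close> is recorded by the
  projection \<open>proj_along w P\<close> of \<open>'e\<close> onto \<open>P\<close> along \<open>w\<close> (that is, \<open>P\<close> is seen as a graph over a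
  fixed hyperplane supplementary to \<open>w\<close>) and \<open>q\<close> by the symmetric bilinear form
  \<open>q (proj_along w P u) (proj_along w P v)\<close>. These projections and forms range over an open
  subset of an affine space. As usual, smoothness and jets of sections do not depend on
  the charts, of the manifold and of the fibre, in which they are tested.\<close>

definition proj_along :: "'e::euclidean_space \<Rightarrow> 'e set \<Rightarrow> 'e \<Rightarrow> 'e" where
  "proj_along w P v = (THE u. u \<in> P \<and> (\<exists>t. v = u + t *\<^sub>R w))"

definition hyp_coord ::
  "('a, 'e::euclidean_space) chart set \<Rightarrow> ('a \<Rightarrow> ('a, 'e) tvec set) \<Rightarrow> ('a, 'e) chart
     \<Rightarrow> 'e \<Rightarrow> 'e \<Rightarrow> 'e \<Rightarrow> 'e" where
  "hyp_coord A D c w v p = proj_along w (hyp_in_chart A D c p) v"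

definition metric_coord ::
  "('a, 'e::euclidean_space) chart set \<Rightarrow> ('a \<Rightarrow> ('a, 'e) tvec set)
     \<Rightarrow> ('a \<Rightarrow> ('a, 'e) tvec \<Rightarrow> ('a, 'e) tvec \<Rightarrow> real) \<Rightarrow> ('a, 'e) chart
     \<Rightarrow> 'e \<Rightarrow> 'e \<Rightarrow> 'e \<Rightarrow> 'e \<Rightarrow> real" where
  "metric_coord A D h c w u v p =
     metric_in_chart A h c p (hyp_coord A D c w u p) (hyp_coord A D c w v p)"

definition smooth_section ::
  "('a, 'e::euclidean_space) chart set \<Rightarrow> ('a \<Rightarrow> ('a, 'e) tvec set)
     \<Rightarrow> ('a \<Rightarrow> ('a, 'e) tvec \<Rightarrow> ('a, 'e) tvec \<Rightarrow> real) \<Rightarrow> bool" where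
  "smooth_section A D h \<longleftrightarrow>
     (\<forall>c\<in>A. \<forall>p\<in>cimg c. \<forall>w. w \<notin> hyp_in_chart A D c p \<longrightarrow>
        (\<exists>N. open N \<and> p \<in> N \<and> N \<subseteq> cimg c \<and>
             (\<forall>q\<in>N. w \<notin> hyp_in_chart A D c q) \<and>
             (\<forall>v. smooth_on N (hyp_coord A D c w v)) \<and>
             (\<forall>u v. smooth_on N (metric_coord A D h c w u v))))"

definition sub_riemannian ::
  "'a topology \<Rightarrow> ('a, 'e::euclidean_space) chart set \<Rightarrow> ('a \<Rightarrow> ('a, 'e) tvec set)
     \<Rightarrow> ('a \<Rightarrow> ('a, 'e) tvec \<Rightarrow> ('a, 'e) tvec \<Rightarrow> real) \<Rightarrow> bool" where
  "sub_riemannian M A D h \<longleftrightarrow>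
     (\<forall>y\<in>topspace M. D y \<subseteq> tangent_space A y) \<and>
     (\<forall>c\<in>A. \<forall>p\<in>cimg c.
        euclidean_hyperplane (hyp_in_chart A D c p) (metric_in_chart A h c p)) \<and>
     smooth_section A D h"

text \<open>Equality of the \<open>m\<close>-jets at \<open>x\<close> of two sections that are defined and smooth near \<open>x\<close>. Some
  \<open>w\<close> lies outside both hyperplanes at \<open>x\<close>, so that equality of the \<open>0\<close>-jets means equality of the
  two pairs at \<open>x\<close>.\<close>

definition same_section_jet ::
  "('a, 'e::euclidean_space) chart set \<Rightarrow> nat
     \<Rightarrow> ('a \<Rightarrow> ('a, 'e) tvec set) \<Rightarrow> ('a \<Rightarrow> ('a, 'e) tvec \<Rightarrow> ('a, 'e) tvec \<Rightarrow> real)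
     \<Rightarrow> ('a \<Rightarrow> ('a, 'e) tvec set) \<Rightarrow> ('a \<Rightarrow> ('a, 'e) tvec \<Rightarrow> ('a, 'e) tvec \<Rightarrow> real)
     \<Rightarrow> 'a \<Rightarrow> bool" where
  "same_section_jet A m D h D' h' x \<longleftrightarrow>
     (\<forall>c\<in>charts_at A x. \<forall>w.
        w \<notin> hyp_in_chart A D c (cmap c x) \<longrightarrow> w \<notin> hyp_in_chart A D' c (cmap c x) \<longrightarrow>
        (\<forall>v. same_jet m (hyp_coord A D c w v) (hyp_coord A D' c w v) (cmap c x)) \<and>
        (\<forall>u v. same_jet m (metric_coord A D h c w u v) (metric_coord A D' h' c w u v) (cmap c x)))"

definition pullback_hyp ::
  "('a, 'e::euclidean_space) chart set \<Rightarrow> ('a \<Rightarrow> 'a) \<Rightarrow> ('a \<Rightarrow> ('a, 'e) tvec set)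
     \<Rightarrow> 'a \<Rightarrow> ('a, 'e) tvec set" where
  "pullback_hyp A f D y = {v \<in> tangent_space A y. tangent_map A f y v \<in> D (f y)}"

definition pullback_metric ::
  "('a, 'e::euclidean_space) chart set \<Rightarrow> ('a \<Rightarrow> 'a)
     \<Rightarrow> ('a \<Rightarrow> ('a, 'e) tvec \<Rightarrow> ('a, 'e) tvec \<Rightarrow> real)
     \<Rightarrow> 'a \<Rightarrow> ('a, 'e) tvec \<Rightarrow> ('a, 'e) tvec \<Rightarrow> real" where
  "pullback_metric A f h y u v = h (f y) (tangent_map A f y u) (tangent_map A f y v)"

text \<open>\<open>f\<close> represents an \<open>m\<close>-isometry at \<open>x\<close>; the condition depends only on the \<open>m\<close>-jet of \<open>f\<close>.\<close>

definition jet_isometry ::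
  "'a topology \<Rightarrow> ('a, 'e::euclidean_space) chart set \<Rightarrow> ('a \<Rightarrow> ('a, 'e) tvec set)
     \<Rightarrow> ('a \<Rightarrow> ('a, 'e) tvec \<Rightarrow> ('a, 'e) tvec \<Rightarrow> real) \<Rightarrow> nat \<Rightarrow> 'a \<Rightarrow> ('a \<Rightarrow> 'a) \<Rightarrow> bool" where
  "jet_isometry M A D h m x f \<longleftrightarrow>
     m \<ge> 1 \<and> (\<exists>U. x \<in> U \<and> local_diffeo M A U f) \<and> f x = x \<and>
     same_section_jet A (m - 1) (pullback_hyp A f D) (pullback_metric A f h) D h x"

text \<open>\<open>(m, k)\<close>-sub-rigidity, where \<open>m = k + s\<close>.\<close>

definition sub_rigid ::
  "'a topology \<Rightarrow> ('a, 'e::euclidean_space) chart set \<Rightarrow> ('a \<Rightarrow> ('a, 'e) tvec set)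
     \<Rightarrow> ('a \<Rightarrow> ('a, 'e) tvec \<Rightarrow> ('a, 'e) tvec \<Rightarrow> real) \<Rightarrow> nat \<Rightarrow> nat \<Rightarrow> bool" where
  "sub_rigid M A D h m k \<longleftrightarrow>
     (\<forall>x\<in>topspace M. \<forall>f. jet_isometry M A D h m x f \<longrightarrow>
        same_map_jet A k f id x \<longrightarrow> same_map_jet A (k + 1) f id x)"

section \<open>Contact structures\<close>

text \<open>A form of degree \<open>k\<close> on \<open>'e\<close> is a function of a sequence of vectors that depends only on the
  first \<open>k\<close> of them.\<close>

type_synonym 'e form = "(nat \<Rightarrow> 'e) \<Rightarrow> real"

definition wedge :: "nat \<Rightarrow> nat \<Rightarrow> 'e form \<Rightarrow> 'e form \<Rightarrow> 'e form" where
  "wedge k l \<alpha> \<beta> v =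
     (\<Sum>\<pi> | \<pi> permutes {..<k + l}.
        of_int (sign \<pi>) * \<alpha> (\<lambda>i. v (\<pi> i)) * \<beta> (\<lambda>i. v (\<pi> (k + i)))) / (fact k * fact l)"

primrec wedge_power :: "nat \<Rightarrow> 'e form \<Rightarrow> nat \<Rightarrow> 'e form" where
  "wedge_power k \<alpha> 0 = (\<lambda>v. 1)"
| "wedge_power k \<alpha> (Suc j) = wedge k (k * j) \<alpha> (wedge_power k \<alpha> j)"

text \<open>The exterior derivative at \<open>p\<close> of the \<open>1\<close>-form \<open>\<theta>\<close>, where \<open>\<theta> q\<close> is its value at \<open>q\<close>.\<close>

definition ext_deriv :: "('e::euclidean_space \<Rightarrow> 'e \<Rightarrow> real) \<Rightarrow> 'e \<Rightarrow> 'e form" where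
  "ext_deriv \<theta> p v =
     frechet_derivative (\<lambda>q. \<theta> q (v 1)) (at p) (v 0) -
     frechet_derivative (\<lambda>q. \<theta> q (v 0)) (at p) (v 1)"

definition form_in_chart ::
  "('a, 'e::euclidean_space) chart set \<Rightarrow> ('a \<Rightarrow> ('a, 'e) tvec \<Rightarrow> real) \<Rightarrow> ('a, 'e) chart
     \<Rightarrow> 'e \<Rightarrow> 'e \<Rightarrow> real" where
  "form_in_chart A \<omega> c p u = \<omega> (cinv c p) (tvec_of A c (cinv c p) u)"

definition one_form_on ::
  "('a, 'e::euclidean_space) chart set \<Rightarrow> 'a set \<Rightarrow> ('a \<Rightarrow> ('a, 'e) tvec \<Rightarrow> real) \<Rightarrow> bool" where
  "one_form_on A U \<omega> \<longleftrightarrow>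
     (\<forall>c\<in>A. (\<forall>p\<in>cmap c ` (U \<inter> cdom c). linear (form_in_chart A \<omega> c p)) \<and>
            (\<forall>u. smooth_on (cmap c ` (U \<inter> cdom c)) (\<lambda>p. form_in_chart A \<omega> c p u)))"

text \<open>The form \<open>\<omega> \<and> (d\<omega>)\<^sup>d\<close>, of top degree \<open>2 * d + 1\<close>, vanishes nowhere on \<open>U\<close>.\<close>

definition contact_form_on ::
  "('a, 'e::euclidean_space) chart set \<Rightarrow> nat \<Rightarrow> 'a set \<Rightarrow> ('a \<Rightarrow> ('a, 'e) tvec \<Rightarrow> real) \<Rightarrow> bool"
  where
  "contact_form_on A d U \<omega> \<longleftrightarrow>
     one_form_on A U \<omega> \<and>
     (\<forall>c\<in>A. \<forall>p\<in>cmap c ` (U \<inter> cdom c).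
        \<exists>v. wedge 1 (2 * d) (\<lambda>v. form_in_chart A \<omega> c p (v 0))
              (wedge_power 2 (ext_deriv (form_in_chart A \<omega> c) p) d) v \<noteq> 0)"

definition contact ::
  "'a topology \<Rightarrow> ('a, 'e::euclidean_space) chart set \<Rightarrow> nat \<Rightarrow> ('a \<Rightarrow> ('a, 'e) tvec set) \<Rightarrow> bool"
  where
  "contact M A d D \<longleftrightarrow>
     DIM('e) = 2 * d + 1 \<and>
     (\<forall>x\<in>topspace M. \<exists>U \<omega>. openin M U \<and> x \<in> U \<and> contact_form_on A d U \<omega> \<and>
        (\<forall>y\<in>U. D y = {v \<in> tangent_space A y. \<omega> y v = 0}))"

end

theory Submission
  imports Defs Jordan_Normal_Form.Determinant
begin

text \<open>In a chart around \<open>x\<close>, let \<open>B\<close> be the second derivative at \<open>p\<close> of the expression \<open>F\<close> of \<open>f\<close>, let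
  \<open>\<theta>\<close> be the form with kernel \<open>D\<close> and \<open>\<theta> w = 1\<close> for a fixed \<open>w\<close>, and write the pullback of \<open>\<theta>\<close> as
  \<open>\<lambda> \<theta>'\<close> with \<open>\<theta>' w = 1\<close>. Up to order \<open>3\<close>, \<open>\<theta>'\<close> agrees with \<open>\<theta>\<close> and the pulled back metric with \<open>h\<close>.
  The exterior derivatives satisfy \<open>F\<^sup>*d\<theta> = d\<lambda> \<and> \<theta>' + \<lambda> d\<theta>'\<close>, so that the ratio of the Gram determinants
  of \<open>d\<theta>\<close> and \<open>h\<close> on \<open>D\<close>, which does not vanish by the contact condition, is multiplied by a power of
  \<open>\<lambda>\<close>. Its second order expansion gives \<open>d\<lambda> = 0\<close> and \<open>D\<^sup>2\<lambda>(u, v) = \<mu>(B(u, v))\<close> at \<open>p\<close> for a linear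
  form \<open>\<mu>\<close>. Consequently \<open>B\<close> takes its values in \<open>D\<close>, and it vanishes on \<open>D \<times> D\<close> because \<open>F\<close> preserves \<open>h\<close>
  to first order. The first order part of the formula for \<open>F\<^sup>*d\<theta>\<close>, evaluated on \<open>w\<close> and \<open>v\<close> in
  \<open>D\<close>, now reads \<open>d\<theta>(B(u, w), v) = - \<mu>(B(u, v)) = 0\<close> for \<open>u\<close> in \<open>D\<close> and then for \<open>u = w\<close>, and \<open>B = 0\<close>
  since \<open>d\<theta>\<close> is nondegenerate on \<open>D\<close>.\<close>

no_notation scalar_prod (infix "\<bullet>" 70)

section \<open>Functions of class \<open>C\<^sup>k\<close>\<close>

text \<open>The obstacle is that the structure does not see the transverse direction w: the metric
  lives on D, and the hyperplane field determines \<theta> only up to a factor. The 2-jet of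
  \<lambda> is therefore unknown at the start, and its derivatives spoil every use of d\<theta> to
  reach B(u, w) and B(w, w). The ratio of determinants is a scalar that fixes this scale. It need
  not be constant: F is tangent to the identity, so composing a scalar g with F changes it only by
  t^2/2 Dg(B(u, u)) + o(t^2) along the line p + t u. All second order information on \<lambda> is
  thus carried linearly by B itself, and disappears wherever B is already known to vanish. The
  vector w, kept constant in the chart, gives an affine chart of the fibre, in which comparing
  hyperplane fields means comparing \<theta>' with \<theta>. The order 4 is counted backwards:
  second derivatives of \<lambda> require d\<theta>' to second order, hence \<theta>' to third
  order, hence the 3-jet of the pulled back section, which is what a 4-isometry controls.\<close>

definition ddir :: "'e \<Rightarrow> ('e::euclidean_space \<Rightarrow> 'f::real_normed_vector) \<Rightarrow> 'e \<Rightarrow> 'f" where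
  "ddir v f x = frechet_derivative f (at x) v"

lemma Ck_on_Suc_iff [simp]:
  "Ck_on (Suc k) f S \<longleftrightarrow> f differentiable_on S \<and> (\<forall>v. Ck_on k (ddir v f) S)"
  by (simp add: ddir_def[abs_def])

declare Ck_on.simps(2) [simp del]

lemma iter_deriv_Cons [simp]: "iter_deriv (v # vs) f = iter_deriv vs (ddir v f)"
  by (simp add: ddir_def[abs_def])

declare iter_deriv.simps(2) [simp del]

lemma ddir_eqI: "(f has_derivative f') (at x) \<Longrightarrow> ddir v f x = f' v"
  unfolding ddir_def by (metis frechet_derivative_at)

text \<open>\<open>frechet_derivative\<close> is a Hilbert choice among the maps that satisfy
  \<open>has_derivative\<close>, a predicate depending only on the germ at x. The two choices
  therefore coincide even where no derivative exists.\<close>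

lemma ddir_cong_open:
  assumes "open S" "x \<in> S" "\<And>y. y \<in> S \<Longrightarrow> f y = g y"
  shows "ddir v f x = ddir v g x"
proof -
  have "(f has_derivative d) (at x) \<longleftrightarrow> (g has_derivative d) (at x)" for d
    using has_derivative_transform_within_open[OF _ assms(1,2)] assms(3) by metis
  then show ?thesis unfolding ddir_def frechet_derivative_def by simp
qed

lemma Ck_on_differentiable:
  assumes "Ck_on (Suc k) f S" "open S" "x \<in> S"
  shows "(f has_derivative (\<lambda>v. ddir v f x)) (at x)"
proof -
  have "f differentiable_on S" using assms(1) by simp
  then have "f differentiable (at x)"
    using assms(2,3) by (metis at_within_open differentiable_on_def)
  then show ?thesis by (simp add: frechet_derivative_works ddir_def)
qed

lemma ddir_add: "(f has_derivative (\<lambda>v. ddir v f x)) (at x) \<Longrightarrow> ddir (a + b) f x = ddir a f x + ddir b f x"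
  by (drule has_derivative_linear) (rule linear_add)

lemma ddir_scaleR: "(f has_derivative (\<lambda>v. ddir v f x)) (at x) \<Longrightarrow> ddir (r *\<^sub>R a) f x = r *\<^sub>R ddir a f x"
  by (drule has_derivative_linear) (rule linear_scale)

lemma Ck_on_ddir: "Ck_on (Suc k) f S \<Longrightarrow> Ck_on k (ddir v f) S"
  by simp

lemma Ck_on_cong:
  fixes f g :: "'a::euclidean_space \<Rightarrow> 'b::real_normed_vector"
  assumes "open S" "\<And>x. x \<in> S \<Longrightarrow> f x = g x" "Ck_on k f S"
  shows "Ck_on k g S"
  using assms(2,3)
proof (induction k arbitrary: f g)
  case 0
  then show ?case by (simp cong: continuous_on_cong)
next
  case (Suc k)
  have "(g has_derivative (\<lambda>v. ddir v f x)) (at x)" if "x \<in> S" for x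
    by (rule has_derivative_transform_within_open[OF
          Ck_on_differentiable[OF Suc.prems(2) assms(1) that] assms(1) that Suc.prems(1)])
  then have "g differentiable_on S"
    by (meson differentiableI differentiable_at_withinI differentiable_on_def)
  moreover have "Ck_on k (ddir v g) S" for v
    by (rule Suc.IH[OF ddir_cong_open[OF assms(1) _ Suc.prems(1)] Ck_on_ddir[OF Suc.prems(2)]])
  ultimately show ?case by simp
qed

lemma Ck_onI:
  assumes "open S" "\<And>x. x \<in> S \<Longrightarrow> (f has_derivative f' x) (at x)"
    "\<And>v. Ck_on k (\<lambda>x. f' x v) S"
  shows "Ck_on (Suc k) f S"
proof -
  have "f differentiable_on S"
    using assms(2) by (meson differentiableI differentiable_at_withinI differentiable_on_def)
  moreover have "Ck_on k (ddir v f) S" for v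
    by (rule Ck_on_cong[OF assms(1) _ assms(3)[of v]]) (simp add: ddir_eqI[OF assms(2)])
  ultimately show ?thesis by simp
qed

lemma Ck_on_subset: "Ck_on k f S \<Longrightarrow> T \<subseteq> S \<Longrightarrow> Ck_on k f T"
  by (induction k arbitrary: f)
     (auto intro: continuous_on_subset differentiable_on_subset)

lemma Ck_on_SucD: "Ck_on (Suc k) f S \<Longrightarrow> Ck_on k f S"
proof (induction k arbitrary: f)
  case 0
  then show ?case by (simp add: differentiable_imp_continuous_on)
next
  case (Suc k)
  have "Ck_on k (ddir v f) S" for v
    by (rule Suc.IH[OF Ck_on_ddir[OF Suc.prems]])
  then show ?case using Suc.prems by simp
qed

lemma Ck_on_mono: "Ck_on k f S \<Longrightarrow> j \<le> k \<Longrightarrow> Ck_on j f S"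
proof (induction k)
  case (Suc k)
  then show ?case using Ck_on_SucD[of k f S] by (cases "j = Suc k") auto
qed simp

lemma Ck_on_continuous: "Ck_on k f S \<Longrightarrow> continuous_on S f"
  using Ck_on_mono[of k f S 0] by simp

lemma ddir_const [simp]: "ddir v (\<lambda>x. c) = (\<lambda>x. 0)"
  by (simp add: ddir_def fun_eq_iff)

lemma Ck_on_const: "open S \<Longrightarrow> Ck_on k (\<lambda>x. c) S"
  by (induction k arbitrary: c) auto

lemma Ck_on_bounded_linear:
  assumes "open S" "bounded_linear L"
  shows "Ck_on k f S \<Longrightarrow> Ck_on k (\<lambda>x. L (f x)) S"
proof (induction k arbitrary: f)
  case 0
  then show ?case
    by (simp add: bounded_linear.continuous_on[OF assms(2)])
next
  case (Suc k)
  show ?case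
  proof (rule Ck_onI[OF assms(1)])
    show "((\<lambda>x. L (f x)) has_derivative (\<lambda>v. L (ddir v f x))) (at x)" if "x \<in> S" for x
      by (rule bounded_linear.has_derivative[OF assms(2) Ck_on_differentiable[OF Suc.prems assms(1) that]])
    show "Ck_on k (\<lambda>x. L (ddir v f x)) S" for v
      by (rule Suc.IH[OF Ck_on_ddir[OF Suc.prems]])
  qed
qed

lemma Ck_on_add:
  assumes "open S"
  shows "Ck_on k f S \<Longrightarrow> Ck_on k g S \<Longrightarrow> Ck_on k (\<lambda>x. f x + g x) S"
proof (induction k arbitrary: f g)
  case 0
  then show ?case by (simp add: continuous_on_add)
next
  case (Suc k)
  show ?case
  proof (rule Ck_onI[OF assms])
    show "((\<lambda>x. f x + g x) has_derivative (\<lambda>v. ddir v f x + ddir v g x)) (at x)" if "x \<in> S" for x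
      by (intro has_derivative_add Ck_on_differentiable[OF Suc.prems(1) assms that]
          Ck_on_differentiable[OF Suc.prems(2) assms that])
    show "Ck_on k (\<lambda>x. ddir v f x + ddir v g x) S" for v
      by (intro Suc.IH Ck_on_ddir[OF Suc.prems(1)] Ck_on_ddir[OF Suc.prems(2)])
  qed
qed

lemma Ck_on_minus: "open S \<Longrightarrow> Ck_on k f S \<Longrightarrow> Ck_on k (\<lambda>x. - f x) S"
  by (rule Ck_on_bounded_linear[OF _ bounded_linear_minus[OF bounded_linear_ident]])

lemma Ck_on_diff:
  "open S \<Longrightarrow> Ck_on k f S \<Longrightarrow> Ck_on k g S \<Longrightarrow> Ck_on k (\<lambda>x. f x - g x) S"
  using Ck_on_add[of S k f "\<lambda>x. - g x"] Ck_on_minus[of S k g] by simp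

lemma Ck_on_sum:
  "open S \<Longrightarrow> (\<And>i. i \<in> I \<Longrightarrow> Ck_on k (f i) S) \<Longrightarrow> Ck_on k (\<lambda>x. \<Sum>i\<in>I. f i x) S"
  by (induction I rule: infinite_finite_induct) (auto simp: Ck_on_const intro!: Ck_on_add)

lemma (in bounded_bilinear) Ck_on:
  assumes "open S"
  shows "Ck_on k f S \<Longrightarrow> Ck_on k g S \<Longrightarrow> Ck_on k (\<lambda>x. prod (f x) (g x)) S"
proof (induction k arbitrary: f g)
  case 0
  then show ?case by (simp add: continuous_on)
next
  case (Suc k)
  note d = Ck_on_differentiable[OF Suc.prems(1) assms] Ck_on_differentiable[OF Suc.prems(2) assms]
  show ?case
  proof (rule Ck_onI[OF assms])
    show "((\<lambda>x. prod (f x) (g x)) has_derivative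
        (\<lambda>v. prod (f x) (ddir v g x) + prod (ddir v f x) (g x))) (at x)" if "x \<in> S" for x
      by (rule FDERIV[OF d[OF that]])
    show "Ck_on k (\<lambda>x. prod (f x) (ddir v g x) + prod (ddir v f x) (g x)) S" for v
      by (intro Ck_on_add[OF assms] Suc.IH Ck_on_SucD[OF Suc.prems(1)] Ck_on_SucD[OF Suc.prems(2)]
          Ck_on_ddir[OF Suc.prems(1)] Ck_on_ddir[OF Suc.prems(2)])
  qed
qed

lemmas Ck_on_mult = bounded_bilinear.Ck_on[OF bounded_bilinear_mult]
lemmas Ck_on_inner = bounded_bilinear.Ck_on[OF bounded_bilinear_inner]
lemmas Ck_on_scaleR = bounded_bilinear.Ck_on[OF bounded_bilinear_scaleR]

lemma Ck_on_prod:
  fixes f :: "'i \<Rightarrow> 'e::euclidean_space \<Rightarrow> 'f::{real_normed_algebra,comm_monoid_mult}"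
  shows "open S \<Longrightarrow> (\<And>i. i \<in> I \<Longrightarrow> Ck_on k (f i) S) \<Longrightarrow> Ck_on k (\<lambda>x. \<Prod>i\<in>I. f i x) S"
  by (induction I rule: infinite_finite_induct) (auto simp: Ck_on_const intro!: Ck_on_mult)

lemma Ck_on_inverse:
  fixes g :: "'e::euclidean_space \<Rightarrow> real"
  assumes "open S" "\<And>x. x \<in> S \<Longrightarrow> g x \<noteq> 0"
  shows "Ck_on k g S \<Longrightarrow> Ck_on k (\<lambda>x. inverse (g x)) S"
proof (induction k)
  case 0
  then show ?case using assms by (simp add: continuous_on_inverse)
next
  case (Suc k)
  show ?case
  proof (rule Ck_onI[OF assms(1)])
    show "((\<lambda>x. inverse (g x)) has_derivative
        (\<lambda>v. - (inverse (g x) * ddir v g x * inverse (g x)))) (at x)" if "x \<in> S" for x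
      by (rule Deriv.has_derivative_inverse[OF assms(2)[OF that]
            Ck_on_differentiable[OF Suc.prems assms(1) that]])
    show "Ck_on k (\<lambda>x. - (inverse (g x) * ddir v g x * inverse (g x))) S" for v
      by (intro Ck_on_mult Ck_on_minus assms(1) Suc.IH Ck_on_SucD[OF Suc.prems]
          Ck_on_ddir[OF Suc.prems])
  qed
qed

lemma ddir_sum_Basis:
  assumes "(f has_derivative (\<lambda>v. ddir v f x)) (at x)"
  shows "ddir v f x = (\<Sum>b\<in>Basis. (v \<bullet> b) *\<^sub>R ddir b f x)"
proof -
  interpret linear "\<lambda>v. ddir v f x" using has_derivative_linear[OF assms] .
  have "ddir v f x = ddir (\<Sum>b\<in>Basis. (v \<bullet> b) *\<^sub>R b) f x" by (simp add: euclidean_representation)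
  also have "\<dots> = (\<Sum>b\<in>Basis. (v \<bullet> b) *\<^sub>R ddir b f x)" by (simp add: sum scale)
  finally show ?thesis .
qed

text \<open>In the chain rule the direction \<open>ddir v F x\<close> varies with x, so the
  induction hypothesis does not apply directly. Expanding over \<open>Basis\<close> leaves
  derivatives of g in fixed directions, composed with F and multiplied by coefficients of class
  C^k.\<close>

lemma Ck_on_compose:
  fixes F :: "'e::euclidean_space \<Rightarrow> 'd::euclidean_space"
  assumes "open S" "open T" "F ` S \<subseteq> T"
  shows "Ck_on k F S \<Longrightarrow> Ck_on k g T \<Longrightarrow> Ck_on k (\<lambda>x. g (F x)) S"
proof (induction k arbitrary: g)
  case 0
  then show ?case using continuous_on_compose2[OF _ _ assms(3)] by simp
next
  case (Suc k)
  note F = Ck_on_SucD[OF Suc.prems(1)] Ck_on_ddir[OF Suc.prems(1)]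
  have dg: "(g has_derivative (\<lambda>v. ddir v g (F x))) (at (F x))" if "x \<in> S" for x
    using Ck_on_differentiable[OF Suc.prems(2) assms(2)] that assms(3) by blast
  have "((\<lambda>x. g (F x)) has_derivative (\<lambda>v. \<Sum>b\<in>Basis. (ddir v F x \<bullet> b) *\<^sub>R ddir b g (F x))) (at x)"
    if "x \<in> S" for x
    using has_derivative_compose[OF Ck_on_differentiable[OF Suc.prems(1) assms(1) that] dg[OF that]]
    by (subst ddir_sum_Basis[OF dg[OF that], symmetric])
  moreover have "Ck_on k (\<lambda>x. \<Sum>b\<in>Basis. (ddir v F x \<bullet> b) *\<^sub>R ddir b g (F x)) S" for v
    by (intro Ck_on_ddir[OF Suc.prems(2)] Ck_on_sum[OF assms(1)] Ck_on_scaleR[OF assms(1)] Suc.IH[OF F(1)]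
        Ck_on_inner[OF assms(1)] F Ck_on_const[OF assms(1)])
  ultimately show ?case
    by (intro Ck_onI[OF assms(1),
          where f' = "\<lambda>x v. \<Sum>b\<in>Basis. (ddir v F x \<bullet> b) *\<^sub>R ddir b g (F x)"])
qed

lemma smooth_on_Ck: "smooth_on S f \<Longrightarrow> Ck_on k f S"
  by (simp add: smooth_on_def)

section \<open>Restriction to lines and symmetry of second derivatives\<close>

lemma has_vector_derivative_line:
  assumes "(f has_derivative f') (at (a + t *\<^sub>R u))"
  shows "((\<lambda>s. f (a + s *\<^sub>R u)) has_vector_derivative f' u) (at t)"
proof -
  have "((\<lambda>s. a + s *\<^sub>R u) has_derivative (\<lambda>s. s *\<^sub>R u)) (at t)"
    by (auto intro!: derivative_eq_intros)
  from has_derivative_compose[OF this assms] show ?thesis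
    unfolding has_vector_derivative_def
    using linear_simps(5)[OF has_derivative_bounded_linear[OF assms]] by simp
qed

lemma eventually_line:
  fixes p u :: "'e::real_normed_vector"
  assumes "open S" "p \<in> S"
  shows "\<forall>\<^sub>F t in nhds 0. p + t *\<^sub>R u \<in> S"
proof -
  have "((\<lambda>t. p + t *\<^sub>R u) \<longlongrightarrow> p + 0 *\<^sub>R u) (nhds 0)"
    by (intro tendsto_intros tendsto_ident_at filterlim_ident)
  then show ?thesis using assms topological_tendstoD by fastforce
qed

lemma tendsto_line: "((\<lambda>t. p + t *\<^sub>R u) \<longlongrightarrow> p) (at 0)"
  for p u :: "'e::real_normed_vector"
proof -
  have "((\<lambda>t. p + t *\<^sub>R u) \<longlongrightarrow> p + 0 *\<^sub>R u) (at 0)" by (intro tendsto_intros)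
  then show ?thesis by simp
qed

text \<open>Two applications of the mean value theorem: in direction u to the difference of f across
  s v, then in direction v to the difference of \<open>ddir u f\<close>. The point y is controlled
  only in its distance to x, which suits a continuity argument.\<close>

lemma Ck_on_second_difference:
  fixes f :: "'e::euclidean_space \<Rightarrow> real"
  assumes "Ck_on 2 f S" "open S" "ball x r \<subseteq> S" "s > 0" "s * (norm u + norm v) < r"
  shows "\<exists>y. norm (y - x) \<le> s * (norm u + norm v) \<and>
    f (x + s *\<^sub>R u + s *\<^sub>R v) - f (x + s *\<^sub>R u) - f (x + s *\<^sub>R v) + f x
      = s\<^sup>2 * ddir v (ddir u f) y"
proof -
  have near: "norm (a *\<^sub>R u + b *\<^sub>R v) \<le> s * (norm u + norm v)"
    if "0 \<le> a" "a \<le> s" "0 \<le> b" "b \<le> s" for a b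
  proof -
    have "norm (a *\<^sub>R u + b *\<^sub>R v) \<le> a * norm u + b * norm v"
      using norm_triangle_ineq[of "a *\<^sub>R u" "b *\<^sub>R v"] that by simp
    also have "\<dots> \<le> s * norm u + s * norm v"
      using that by (intro add_mono mult_right_mono) auto
    finally show ?thesis by (simp add: distrib_left)
  qed
  then have mem: "x + a *\<^sub>R u + b *\<^sub>R v \<in> S" if "0 \<le> a" "a \<le> s" "0 \<le> b" "b \<le> s" for a b
  proof -
    have "dist x (x + (a *\<^sub>R u + b *\<^sub>R v)) = norm (a *\<^sub>R u + b *\<^sub>R v)"
      by (metis add_diff_cancel_left' dist_commute dist_norm)
    then have "dist x (x + (a *\<^sub>R u + b *\<^sub>R v)) < r"
      using near[OF that] assms(5) by linarith
    then show ?thesis using assms(3) by (auto simp: add.assoc)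
  qed
  have C: "Ck_on (Suc 1) f S" "Ck_on (Suc 0) (ddir u f) S"
    using assms(1) by (simp_all add: numeral_2_eq_2)
  note d1 = Ck_on_differentiable[OF C(1) assms(2)] and d2 = Ck_on_differentiable[OF C(2) assms(2)]
  have "\<exists>\<xi>>0. \<xi> < s \<and> (f (x + s *\<^sub>R v + s *\<^sub>R u) - f (x + s *\<^sub>R u)) - 
      (f (x + s *\<^sub>R v + 0 *\<^sub>R u) - f (x + 0 *\<^sub>R u)) =
    (s - 0) * (ddir u f (x + s *\<^sub>R v + \<xi> *\<^sub>R u) - ddir u f (x + \<xi> *\<^sub>R u))"
  proof (rule MVT2[OF assms(4)])
    fix t assume t: "0 \<le> t" "t \<le> s"
    have m: "x + s *\<^sub>R v + t *\<^sub>R u \<in> S" "x + t *\<^sub>R u \<in> S"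
      using mem[of t s] mem[of t 0] t assms(4) by (simp_all add: algebra_simps)
    show "((\<lambda>t. f (x + s *\<^sub>R v + t *\<^sub>R u) - f (x + t *\<^sub>R u)) has_real_derivative
        ddir u f (x + s *\<^sub>R v + t *\<^sub>R u) - ddir u f (x + t *\<^sub>R u)) (at t)"
      using has_vector_derivative_diff[OF has_vector_derivative_line[OF d1[OF m(1)]]
          has_vector_derivative_line[OF d1[OF m(2)]]]
      by (simp add: has_real_derivative_iff_has_vector_derivative)
  qed
  then obtain \<xi> where \<xi>: "0 < \<xi>" "\<xi> < s"
    "f (x + s *\<^sub>R u + s *\<^sub>R v) - f (x + s *\<^sub>R u) - f (x + s *\<^sub>R v) + f x =
    s * (ddir u f (x + \<xi> *\<^sub>R u + s *\<^sub>R v) - ddir u f (x + \<xi> *\<^sub>R u))"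
    by (auto simp: algebra_simps)
  have "\<exists>\<eta>>0. \<eta> < s \<and> ddir u f (x + \<xi> *\<^sub>R u + s *\<^sub>R v) - ddir u f (x + \<xi> *\<^sub>R u + 0 *\<^sub>R v) =
    (s - 0) * ddir v (ddir u f) (x + \<xi> *\<^sub>R u + \<eta> *\<^sub>R v)"
  proof (rule MVT2[OF assms(4)])
    fix t assume t: "0 \<le> t" "t \<le> s"
    have m: "x + \<xi> *\<^sub>R u + t *\<^sub>R v \<in> S" using mem[of \<xi> t] t \<xi> by simp
    show "((\<lambda>t. ddir u f (x + \<xi> *\<^sub>R u + t *\<^sub>R v)) has_real_derivative
        ddir v (ddir u f) (x + \<xi> *\<^sub>R u + t *\<^sub>R v)) (at t)"
      using has_vector_derivative_line[OF d2[OF m]]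
      by (simp add: has_real_derivative_iff_has_vector_derivative)
  qed
  then obtain \<eta> where \<eta>: "0 < \<eta>" "\<eta> < s"
    "ddir u f (x + \<xi> *\<^sub>R u + s *\<^sub>R v) - ddir u f (x + \<xi> *\<^sub>R u) =
      s * ddir v (ddir u f) (x + \<xi> *\<^sub>R u + \<eta> *\<^sub>R v)" by auto
  show ?thesis
    using near[of \<xi> \<eta>] \<xi> \<eta>
    by (intro exI[of _ "x + \<xi> *\<^sub>R u + \<eta> *\<^sub>R v"]) (simp add: power2_eq_square algebra_simps)
qed

text \<open>The second difference is symmetric in u and v, so the two mixed derivatives take a
  common value at points arbitrarily near x; continuity at x does the rest.\<close>

lemma ddir_commute_real:
  fixes f :: "'e::euclidean_space \<Rightarrow> real"
  assumes "Ck_on 2 f S" "open S" "x \<in> S"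
  shows "ddir u (ddir v f) x = ddir v (ddir u f) x"
proof (rule ccontr)
  let ?a = "ddir u (ddir v f)" and ?b = "ddir v (ddir u f)"
  assume ne: "?a x \<noteq> ?b x"
  define e where "e = \<bar>?a x - ?b x\<bar> / 2"
  have e: "e > 0" using ne by (simp add: e_def)
  have c: "continuous_on S ?a" "continuous_on S ?b"
    using assms(1) by (simp_all add: numeral_2_eq_2)
  then have cont: "isCont ?a x" "isCont ?b x"
    using assms(2,3) by (auto simp: continuous_on_eq_continuous_at)
  obtain d1 where d1: "d1 > 0" "\<And>y. dist y x < d1 \<Longrightarrow> dist (?a y) (?a x) < e"
    using cont(1) e unfolding continuous_at_eps_delta by blast
  obtain d2 where d2: "d2 > 0" "\<And>y. dist y x < d2 \<Longrightarrow> dist (?b y) (?b x) < e"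
    using cont(2) e unfolding continuous_at_eps_delta by blast
  obtain r where r: "r > 0" "ball x r \<subseteq> S"
    using assms(2,3) openE by blast
  define m where "m = min r (min d1 d2)"
  \<comment> \<open>The summand 1 keeps n positive when u and v are both zero. With s n = m/2 both
    intermediate points fall within m/2 of x.\<close>
  define n where "n = norm u + norm v + 1"
  define s where "s = m / (2 * n)"
  have m: "m > 0" using d1(1) d2(1) r(1) by (simp add: m_def)
  have n: "n > 0" unfolding n_def by (smt (verit) norm_ge_zero)
  have s: "s > 0" using m n by (simp add: s_def)
  have "s * (norm u + norm v) \<le> s * n" using s by (simp add: n_def)
  also have "\<dots> = m / 2" using n by (simp add: s_def)
  also have "\<dots> < m" using m by simp
  finally have sm: "s * (norm u + norm v) < m" .
  then have sr: "s * (norm u + norm v) < r" and sr': "s * (norm v + norm u) < r"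
    by (simp_all add: m_def add.commute)
  obtain y where y: "norm (y - x) \<le> s * (norm u + norm v)"
    "f (x + s *\<^sub>R u + s *\<^sub>R v) - f (x + s *\<^sub>R u) - f (x + s *\<^sub>R v) + f x = s\<^sup>2 * ?b y"
    using Ck_on_second_difference[OF assms(1,2) r(2) s sr] by blast
  obtain z where z: "norm (z - x) \<le> s * (norm v + norm u)"
    "f (x + s *\<^sub>R v + s *\<^sub>R u) - f (x + s *\<^sub>R v) - f (x + s *\<^sub>R u) + f x = s\<^sup>2 * ?a z"
    using Ck_on_second_difference[OF assms(1,2) r(2) s sr'] by blast
  have "s\<^sup>2 * ?b y = s\<^sup>2 * ?a z"
    using y(2) z(2) by (simp add: algebra_simps)
  then have "?b y = ?a z" using s by simp
  moreover have "dist (?a z) (?a x) < e"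
    using z(1) sm by (intro d1(2)) (simp add: m_def dist_norm add.commute)
  moreover have "dist (?b y) (?b x) < e"
    using y(1) sm by (intro d2(2)) (simp add: m_def dist_norm)
  ultimately show False
    using abs_triangle_ineq4[of "?a z - ?b x" "?a z - ?a x"] unfolding e_def dist_real_def by simp
qed

lemma ddir_bounded_linear:
  assumes "(f has_derivative (\<lambda>v. ddir v f x)) (at x)" "bounded_linear L"
  shows "ddir v (\<lambda>y. L (f y)) x = L (ddir v f x)"
  by (rule ddir_eqI[OF bounded_linear.has_derivative[OF assms(2,1)]])

lemma ddir_commute:
  fixes f :: "'e::euclidean_space \<Rightarrow> 'd::euclidean_space"
  assumes "Ck_on 2 f S" "open S" "x \<in> S"
  shows "ddir u (ddir v f) x = ddir v (ddir u f) x"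
proof (rule euclidean_eqI)
  fix b :: 'd
  have C: "Ck_on (Suc 1) f S" "Ck_on (Suc 0) (ddir v f) S" for v
    using assms(1) by (simp_all add: numeral_2_eq_2)
  have eq: "ddir u (ddir v f) x \<bullet> b = ddir u (ddir v (\<lambda>y. f y \<bullet> b)) x" for u v
  proof -
    have "ddir u (ddir v (\<lambda>y. f y \<bullet> b)) x = ddir u (\<lambda>y. ddir v f y \<bullet> b) x"
      using ddir_bounded_linear[OF Ck_on_differentiable[OF C(1) assms(2)] bounded_linear_inner_left]
      by (intro ddir_cong_open[OF assms(2,3)]) auto
    also have "\<dots> = ddir u (ddir v f) x \<bullet> b"
      by (rule ddir_bounded_linear[OF Ck_on_differentiable[OF C(2) assms(2,3)]
            bounded_linear_inner_left])
    finally show ?thesis by simp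
  qed
  have "Ck_on 2 (\<lambda>y. f y \<bullet> b) S"
    by (rule Ck_on_bounded_linear[OF assms(2) bounded_linear_inner_left assms(1)])
  then show "ddir u (ddir v f) x \<bullet> b = ddir v (ddir u f) x \<bullet> b"
    unfolding eq by (rule ddir_commute_real[OF _ assms(2,3)])
qed

text \<open>Mean value inequality on the ball of radius |t|, where \<phi>' is bounded by e/2 |t|^m.
  Both the comparison of jets and the Taylor formula below follow by differentiating along a line
  and integrating back with this rule.\<close>

lemma little_o_integrate:
  fixes \<phi> :: "real \<Rightarrow> 'f::real_normed_vector"
  assumes der: "\<forall>\<^sub>F t in nhds 0. (\<phi> has_vector_derivative \<phi>' t) (at t)"
    and z: "\<phi> 0 = 0" "\<phi>' 0 = 0" and lim: "((\<lambda>t. \<phi>' t /\<^sub>R t ^ m) \<longlongrightarrow> 0) (at 0)"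
  shows "((\<lambda>t. \<phi> t /\<^sub>R t ^ Suc m) \<longlongrightarrow> 0) (at 0)"
proof (rule tendstoI)
  fix e :: real assume e: "e > 0"
  have "\<forall>\<^sub>F t in at 0. dist (\<phi>' t /\<^sub>R t ^ m) 0 < e / 2"
    using tendstoD[OF lim, of "e / 2"] e by simp
  then have "\<forall>\<^sub>F t in nhds 0. t \<noteq> 0 \<longrightarrow> dist (\<phi>' t /\<^sub>R t ^ m) 0 < e / 2"
    by (simp add: eventually_at_filter)
  then have "\<forall>\<^sub>F t in nhds 0. norm (\<phi>' t) \<le> e / 2 * \<bar>t\<bar> ^ m"
  proof (rule eventually_mono)
    fix t :: real assume a: "t \<noteq> 0 \<longrightarrow> dist (\<phi>' t /\<^sub>R t ^ m) 0 < e / 2"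
    show "norm (\<phi>' t) \<le> e / 2 * \<bar>t\<bar> ^ m"
    \<comment> \<open>A limit at 0 says nothing about t = 0 itself, but the mean value inequality is
      applied on a set containing 0; there \<open>\<phi>' 0 = 0\<close> gives the bound.\<close>
    proof (cases "t = 0")
      case True then show ?thesis using z e by simp
    next
      case False
      then have "\<bar>t\<bar> ^ m > 0" by simp
      then show ?thesis using a False by (simp add: power_abs field_simps)
    qed
  qed
  with der have "\<forall>\<^sub>F t in nhds 0. (\<phi> has_vector_derivative \<phi>' t) (at t) \<and>
      norm (\<phi>' t) \<le> e / 2 * \<bar>t\<bar> ^ m" by (rule eventually_conj)
  then obtain d where d: "d > 0" "\<And>t. \<bar>t\<bar> < d \<Longrightarrow> (\<phi> has_vector_derivative \<phi>' t) (at t)"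
    "\<And>t. \<bar>t\<bar> < d \<Longrightarrow> norm (\<phi>' t) \<le> e / 2 * \<bar>t\<bar> ^ m"
    unfolding eventually_nhds_metric by (auto simp: dist_real_def)
  have "dist (\<phi> t /\<^sub>R t ^ Suc m) 0 < e" if t: "t \<noteq> 0" "\<bar>t\<bar> < d" for t
  proof -
    have "norm (\<phi> t - \<phi> 0) \<le> (e / 2 * \<bar>t\<bar> ^ m) * norm (t - 0)"
    proof (rule differentiable_bound[where S = "cball 0 \<bar>t\<bar>" and f' = "\<lambda>s h. h *\<^sub>R \<phi>' s"])
      fix s :: real assume "s \<in> cball 0 \<bar>t\<bar>"
      then have s: "\<bar>s\<bar> \<le> \<bar>t\<bar>" by simp
      then show "(\<phi> has_derivative (\<lambda>h. h *\<^sub>R \<phi>' s)) (at s within cball 0 \<bar>t\<bar>)"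
        using d(2)[of s] t by (simp add: has_vector_derivative_def has_derivative_at_withinI)
      have "norm (\<phi>' s) \<le> e / 2 * \<bar>s\<bar> ^ m" using d(3)[of s] s t by simp
      also have "\<dots> \<le> e / 2 * \<bar>t\<bar> ^ m" using s e by (intro mult_left_mono power_mono) auto
      finally have "norm (\<phi>' s) * norm h \<le> e / 2 * \<bar>t\<bar> ^ m * norm h" for h :: real
        by (rule mult_right_mono) simp
      then show "onorm (\<lambda>h. h *\<^sub>R \<phi>' s) \<le> e / 2 * \<bar>t\<bar> ^ m"
        by (intro onorm_le) (simp add: mult.commute)
    qed auto
    then have "norm (\<phi> t) \<le> e / 2 * \<bar>t\<bar> ^ Suc m" using z by (simp add: algebra_simps)
    moreover have "\<bar>t\<bar> ^ Suc m > 0" using t by (simp del: power_Suc)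
    ultimately have "norm (\<phi> t) / \<bar>t\<bar> ^ Suc m \<le> e / 2"
      by (simp add: field_simps del: power_Suc)
    then have "norm (\<phi> t) / \<bar>t\<bar> ^ Suc m < e" using e by linarith
    then show ?thesis by (simp add: power_abs divide_inverse abs_mult mult.commute)
  qed
  then show "\<forall>\<^sub>F t in at 0. dist (\<phi> t /\<^sub>R t ^ Suc m) 0 < e"
    unfolding eventually_at using d(1) by (auto simp: dist_real_def)
qed

section \<open>Jets and second order expansions along lines\<close>

lemma same_jet_Suc:
  "same_jet (Suc m) f g p \<longleftrightarrow> f p = g p \<and> (\<forall>v. same_jet m (ddir v f) (ddir v g) p)"
proof
  assume a: "same_jet (Suc m) f g p"
  have "f p = g p" using a[unfolded same_jet_def, rule_format, of "[]"] by simp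
  moreover have "same_jet m (ddir v f) (ddir v g) p" for v
    unfolding same_jet_def
  proof safe
    fix vs :: "'a list" assume "length vs \<le> m"
    then show "iter_deriv vs (ddir v f) p = iter_deriv vs (ddir v g) p"
      using a[unfolded same_jet_def, rule_format, of "v # vs"] by simp
  qed
  ultimately show "f p = g p \<and> (\<forall>v. same_jet m (ddir v f) (ddir v g) p)" by simp
next
  assume a: "f p = g p \<and> (\<forall>v. same_jet m (ddir v f) (ddir v g) p)"
  show "same_jet (Suc m) f g p"
    unfolding same_jet_def
  proof safe
    fix vs :: "'a list" assume "length vs \<le> Suc m"
    then show "iter_deriv vs f p = iter_deriv vs g p"
      using a by (cases vs) (auto simp: same_jet_def)
  qed
qed

lemma same_jet_0: "same_jet 0 f g p \<longleftrightarrow> f p = g p"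
  by (simp add: same_jet_def)

lemma same_jet_mono: "same_jet m f g p \<Longrightarrow> k \<le> m \<Longrightarrow> same_jet k f g p"
  by (simp add: same_jet_def)

lemma same_jet_cong:
  assumes "open S" "p \<in> S" "\<And>q. q \<in> S \<Longrightarrow> f q = f' q" "\<And>q. q \<in> S \<Longrightarrow> g q = g' q"
    and "same_jet m f g p"
  shows "same_jet m f' g' p"
  using assms(3-)
proof (induction m arbitrary: f f' g g')
  case 0
  then show ?case using assms(2) by (simp add: same_jet_0)
next
  case (Suc m)
  have "same_jet m (ddir v f') (ddir v g') p" for v
  proof (rule Suc.IH)
    show "ddir v f q = ddir v f' q" if "q \<in> S" for q
      by (rule ddir_cong_open[OF assms(1) that Suc.prems(1)])
    show "ddir v g q = ddir v g' q" if "q \<in> S" for q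
      by (rule ddir_cong_open[OF assms(1) that Suc.prems(2)])
    show "same_jet m (ddir v f) (ddir v g) p" using Suc.prems(3) by (simp add: same_jet_Suc)
  qed
  then show ?case using Suc.prems assms(2) by (simp add: same_jet_Suc)
qed

text \<open>Differentiation turns the constant a into 0, hence the induction over arbitrary a. The
  rule serves to read off a scalar coefficient from the jet of a vector valued map.\<close>

lemma same_jet_affine:
  assumes "open S" "p \<in> S" "Ck_on m f S" "Ck_on m g S" and L: "bounded_linear L"
    and "same_jet m f g p"
  shows "same_jet m (\<lambda>x. a + L (f x)) (\<lambda>x. a + L (g x)) p"
  using assms(3,4,6)
proof (induction m arbitrary: f g a)
  case 0
  then show ?case by (simp add: same_jet_0)
next
  case (Suc m)
  have D: "ddir v (\<lambda>x. a + L (f x)) q = 0 + L (ddir v f q)" if "Ck_on (Suc m) f S" "q \<in> S" for f v q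
    using ddir_eqI[OF has_derivative_add[OF has_derivative_const
          bounded_linear.has_derivative[OF L Ck_on_differentiable[OF that(1) assms(1) that(2)]]]]
    by simp
  have "same_jet m (ddir v (\<lambda>x. a + L (f x))) (ddir v (\<lambda>x. a + L (g x))) p" for v
  proof (rule same_jet_cong[OF assms(1,2)])
    show "same_jet m (\<lambda>x. 0 + L (ddir v f x)) (\<lambda>x. 0 + L (ddir v g x)) p"
      using Suc.prems(3)
      by (intro Suc.IH Ck_on_ddir[OF Suc.prems(1)] Ck_on_ddir[OF Suc.prems(2)])
        (simp add: same_jet_Suc)
  qed (rule D[OF Suc.prems(1), symmetric] D[OF Suc.prems(2), symmetric], assumption)+
  then show ?case using Suc.prems(3) by (simp add: same_jet_Suc)
qed

text \<open>Induction on the order: the derivative along the line has one order less, and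
  integration gains one power of t. Equality of jets becomes a limit, which passes through products
  and determinants more easily than iterated derivatives do.\<close>

lemma same_jet_little_o:
  assumes "open S" "p \<in> S"
  shows "Ck_on m f S \<Longrightarrow> Ck_on m g S \<Longrightarrow> same_jet m f g p \<Longrightarrow>
    ((\<lambda>t. (f (p + t *\<^sub>R u) - g (p + t *\<^sub>R u)) /\<^sub>R t ^ m) \<longlongrightarrow> 0) (at 0)"
proof (induction m arbitrary: f g)
  case 0
  have "isCont f p" "isCont g p"
    using 0 assms by (auto simp: continuous_on_eq_continuous_at)
  then have "((\<lambda>t. f (p + t *\<^sub>R u) - g (p + t *\<^sub>R u)) \<longlongrightarrow> f p - g p) (at 0)"
    by (intro tendsto_diff isCont_tendsto_compose[OF _ tendsto_line])
  then show ?case using 0 by (simp add: same_jet_0)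
next
  case (Suc m)
  note j = Suc.prems(3)[unfolded same_jet_Suc]
  show ?case
  proof (rule little_o_integrate[where \<phi>' = "\<lambda>t. ddir u f (p + t *\<^sub>R u) - ddir u g (p + t *\<^sub>R u)"])
    show "\<forall>\<^sub>F t in nhds 0. ((\<lambda>t. f (p + t *\<^sub>R u) - g (p + t *\<^sub>R u)) has_vector_derivative
        ddir u f (p + t *\<^sub>R u) - ddir u g (p + t *\<^sub>R u)) (at t)"
      using eventually_line[OF assms]
      by (rule eventually_mono)
        (intro has_vector_derivative_diff has_vector_derivative_line
          Ck_on_differentiable[OF Suc.prems(1) assms(1)] Ck_on_differentiable[OF Suc.prems(2) assms(1)])
    show "((\<lambda>t. (ddir u f (p + t *\<^sub>R u) - ddir u g (p + t *\<^sub>R u)) /\<^sub>R t ^ m) \<longlongrightarrow> 0) (at 0)"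
      using j by (intro Suc.IH Ck_on_ddir[OF Suc.prems(1)] Ck_on_ddir[OF Suc.prems(2)]) simp
    show "f (p + 0 *\<^sub>R u) - g (p + 0 *\<^sub>R u) = 0" using j by simp
    show "ddir u f (p + 0 *\<^sub>R u) - ddir u g (p + 0 *\<^sub>R u) = 0"
      using j same_jet_mono[of m "ddir u f" "ddir u g" p 0] by (simp add: same_jet_0)
  qed
qed

text \<open>Differentiability of \<open>ddir u f\<close> at p, read along the line, is a statement
  with error o(t); integrating it once gives the error o(t^2).\<close>

lemma Ck_on_Taylor2:
  assumes "Ck_on 2 f S" "open S" "p \<in> S"
  shows "((\<lambda>t. (f (p + t *\<^sub>R u) - f p - t *\<^sub>R ddir u f p) /\<^sub>R t\<^sup>2)
    \<longlongrightarrow> (1/2) *\<^sub>R ddir u (ddir u f) p) (at 0)"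
proof -
  let ?c = "ddir u (ddir u f) p"
  have C: "Ck_on (Suc 1) f S" "Ck_on (Suc 0) (ddir u f) S"
    using assms(1) by (simp_all add: numeral_2_eq_2)
  note d1 = Ck_on_differentiable[OF C(1) assms(2)]
  have "((\<lambda>t. ddir u f (p + t *\<^sub>R u)) has_vector_derivative ?c) (at 0)"
    using Ck_on_differentiable[OF C(2) assms(2,3)] by (intro has_vector_derivative_line) simp
  then have "((\<lambda>t. (ddir u f (p + t *\<^sub>R u) - ddir u f p - t *\<^sub>R ?c) /\<^sub>R \<bar>t\<bar>) \<longlongrightarrow> 0) (at 0)"
    unfolding has_vector_derivative_def has_derivative_at_within by (simp add: diff_diff_eq)
  then have "((\<lambda>t. norm ((ddir u f (p + t *\<^sub>R u) - ddir u f p - t *\<^sub>R ?c) /\<^sub>R t)) \<longlongrightarrow> 0) (at 0)"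
    by (drule_tac tendsto_norm_zero) simp
  then have "((\<lambda>t. (ddir u f (p + t *\<^sub>R u) - ddir u f p - t *\<^sub>R ?c) /\<^sub>R t ^ 1) \<longlongrightarrow> 0) (at 0)"
    by (drule_tac tendsto_norm_zero_cancel) simp
  then have "((\<lambda>t. (f (p + t *\<^sub>R u) - f p - t *\<^sub>R ddir u f p - (t\<^sup>2 / 2) *\<^sub>R ?c) /\<^sub>R t ^ Suc 1)
    \<longlongrightarrow> 0) (at 0)"
    using eventually_line[OF assms(2,3), of u]
    by (intro little_o_integrate[where \<phi>' = "\<lambda>t. ddir u f (p + t *\<^sub>R u) - ddir u f p - t *\<^sub>R ?c"])
      (auto elim!: eventually_mono intro!: derivative_eq_intros has_vector_derivative_line d1)
  then have "((\<lambda>t. (f (p + t *\<^sub>R u) - f p - t *\<^sub>R ddir u f p - (t\<^sup>2 / 2) *\<^sub>R ?c) /\<^sub>R t ^ Suc 1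
     + (1/2) *\<^sub>R ?c) \<longlongrightarrow> 0 + (1/2) *\<^sub>R ?c) (at 0)"
    by (intro tendsto_add tendsto_const)
  moreover
  have "(f (p + t *\<^sub>R u) - f p - t *\<^sub>R ddir u f p - (t\<^sup>2 / 2) *\<^sub>R ?c) /\<^sub>R t ^ Suc 1
     + (1/2) *\<^sub>R ?c = (f (p + t *\<^sub>R u) - f p - t *\<^sub>R ddir u f p) /\<^sub>R t\<^sup>2"
    if "t \<noteq> 0" for t
  proof -
    have "inverse t * inverse t * (t * t) = 1" using that by (simp add: field_simps)
    then show ?thesis by (simp add: power2_eq_square scaleR_diff_right)
  qed
  then have "\<forall>\<^sub>F t in at 0. (f (p + t *\<^sub>R u) - f p - t *\<^sub>R ddir u f p - (t\<^sup>2 / 2) *\<^sub>R ?c) /\<^sub>R t ^ Suc 1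
     + (1/2) *\<^sub>R ?c = (f (p + t *\<^sub>R u) - f p - t *\<^sub>R ddir u f p) /\<^sub>R t\<^sup>2"
    by (simp add: eventually_at_filter)
  ultimately show ?thesis
    by (auto elim: Lim_transform_eventually)
qed

text \<open>Maps of class C^1 are strictly differentiable: the mean value inequality is applied to f
  minus its linear part at p, with both endpoints free.\<close>

lemma Ck_on_strict_differentiable:
  fixes f :: "'e::euclidean_space \<Rightarrow> 'f::real_normed_vector"
  assumes "Ck_on 1 f S" "open S" "p \<in> S" "e > 0"
  shows "\<exists>d>0. \<forall>x\<in>ball p d. \<forall>y\<in>ball p d.
    norm (f x - f y - ddir (x - y) f p) \<le> e * norm (x - y)"
proof -
  have C: "Ck_on (Suc 0) f S" using assms(1) by simp
  note der = Ck_on_differentiable[OF C assms(2)]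
  \<comment> \<open>The difference of the derivatives at z and p is estimated by a sum over
    \<open>Basis\<close>, so each of the DIM('e) terms receives an equal share of e.\<close>
  define e' where "e' = e / DIM('e)"
  have e': "e' > 0" using assms(4) by (simp add: e'_def)
  have "\<exists>d>0. \<forall>x\<in>ball p d. norm (ddir b f x - ddir b f p) < e'" for b
  proof -
    have "isCont (ddir b f) p"
      using C assms(2,3) by (simp add: continuous_on_eq_continuous_at)
    then obtain d where "d > 0" "\<And>x. dist x p < d \<Longrightarrow> dist (ddir b f x) (ddir b f p) < e'"
      unfolding continuous_at_eps_delta using e' by blast
    then show ?thesis by (intro exI[of _ d]) (simp add: dist_commute flip: dist_norm)
  qed
  then obtain D where D: "\<And>b. D b > 0" "\<And>b x. x \<in> ball p (D b) \<Longrightarrow> norm (ddir b f x - ddir b f p) < e'"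
    by metis
  obtain r where r: "r > 0" "ball p r \<subseteq> S" using assms(2,3) openE by blast
  define d where "d = min r (Min (D ` Basis))"
  have d: "d > 0" using r(1) D(1) by (simp add: d_def)
  have bound: "norm (ddir b f x - ddir b f p) < e'" if "b \<in> Basis" "x \<in> ball p d" for b x
  proof -
    have "d \<le> D b" using that(1) by (simp add: d_def min.coboundedI2)
    then show ?thesis using that(2) by (intro D(2)) auto
  qed
  have inS: "x \<in> S" if "x \<in> ball p d" for x using that r(2) by (auto simp: d_def)
  have lin: "linear (\<lambda>v. ddir v f p)" by (rule has_derivative_linear[OF der[OF assms(3)]])
  have "norm (f x - f y - ddir (x - y) f p) \<le> e * norm (x - y)"
    if xy: "x \<in> ball p d" "y \<in> ball p d" for x y
  proof -
    have "norm ((f x - ddir x f p) - (f y - ddir y f p)) \<le> e * norm (x - y)"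
    proof (rule differentiable_bound[where S = "ball p d"
          and f' = "\<lambda>z v. ddir v f z - ddir v f p"])
      fix z assume z: "z \<in> ball p d"
      have "((\<lambda>z. f z - ddir z f p) has_derivative (\<lambda>v. ddir v f z - ddir v f p)) (at z)"
        by (intro has_derivative_diff der inS z linear_imp_has_derivative lin)
      then show "((\<lambda>z. f z - ddir z f p) has_derivative (\<lambda>v. ddir v f z - ddir v f p))
          (at z within ball p d)"
        by (rule has_derivative_at_withinI)
      show "onorm (\<lambda>v. ddir v f z - ddir v f p) \<le> e"
      proof (rule onorm_le)
        fix v
        have "ddir v f z - ddir v f p = (\<Sum>b\<in>Basis. (v \<bullet> b) *\<^sub>R (ddir b f z - ddir b f p))"
          using ddir_sum_Basis[OF der[OF inS[OF z]], of v] ddir_sum_Basis[OF der[OF assms(3)], of v]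
          by (simp add: scaleR_diff_right sum_subtractf)
        also have "norm \<dots> \<le> (\<Sum>b\<in>(Basis::'e set). norm v * e')"
        proof (rule sum_norm_le)
          fix b :: 'e assume b: "b \<in> Basis"
          show "norm ((v \<bullet> b) *\<^sub>R (ddir b f z - ddir b f p)) \<le> norm v * e'"
            using bound[OF b z] Basis_le_norm[OF b, of v] e' by (simp add: mult_mono)
        qed
        also have "\<dots> = e * norm v" by (simp add: e'_def)
        finally show "norm (ddir v f z - ddir v f p) \<le> e * norm v" .
      qed
    qed (use xy in auto)
    then show ?thesis by (simp add: linear_diff[OF lin] algebra_simps)
  qed
  then show ?thesis using d by blast
qed

section \<open>Gram determinants and second order agreement\<close>

text \<open>The order m will be the dimension of a hyperplane, a number and not a type, hence
  matrices indexed by natural numbers.\<close>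

definition gram_det :: "nat \<Rightarrow> (nat \<Rightarrow> nat \<Rightarrow> real) \<Rightarrow> real" where
  "gram_det m Q = Determinant.det (Matrix.mat m m (\<lambda>(i, j). Q i j))"

lemma gram_det_permutations:
  "gram_det m Q = (\<Sum>\<pi> | \<pi> permutes {0..<m}. signof \<pi> * (\<Prod>i=0..<m. Q i (\<pi> i)))"
  unfolding gram_det_def
  by (subst det_def'[of _ m]) (auto intro!: sum.cong prod.cong dest: permutes_in_image)

lemma gram_det_cong:
  "(\<And>i j. i < m \<Longrightarrow> j < m \<Longrightarrow> Q i j = Q' i j) \<Longrightarrow> gram_det m Q = gram_det m Q'"
  unfolding gram_det_permutations by (auto intro!: sum.cong prod.cong dest: permutes_in_image)

lemma gram_det_scale: "gram_det m (\<lambda>i j. c * Q i j) = c ^ m * gram_det m Q"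
  by (simp add: gram_det_permutations prod.distrib sum_distrib_left mult_ac)

text \<open>In matrix terms Q' = L^T Q L. When the same L serves for two forms, the square of its
  determinant drops out of their ratio.\<close>

lemma gram_det_congruence:
  fixes Q Q' L :: "nat \<Rightarrow> nat \<Rightarrow> real"
  assumes "\<And>i j. i < m \<Longrightarrow> j < m \<Longrightarrow> Q' i j = (\<Sum>k<m. \<Sum>l<m. L k i * L l j * Q k l)"
  shows "gram_det m Q' = (gram_det m L)\<^sup>2 * gram_det m Q"
proof -
  let ?Q = "Matrix.mat m m (\<lambda>(i, j). Q i j)" and ?L = "Matrix.mat m m (\<lambda>(i, j). L i j)"
  have "Matrix.mat m m (\<lambda>(i, j). Q' i j) = transpose_mat ?L * (?Q * ?L)"
    by (rule eq_matI)
      (auto simp: scalar_prod_def assms sum_distrib_left atLeast0LessThan mult_ac intro!: sum.cong)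
  moreover have "Determinant.det (transpose_mat ?L * (?Q * ?L)) =
      Determinant.det (transpose_mat ?L) * (Determinant.det ?Q * Determinant.det ?L)"
    using Determinant.det_mult[of "transpose_mat ?L" m "?Q * ?L"] Determinant.det_mult[of ?Q m ?L]
      mult_carrier_mat[of ?Q m m ?L m] by simp
  ultimately show ?thesis
    by (simp add: gram_det_def Determinant.det_transpose[of _ m] power2_eq_square)
qed

text \<open>A kernel vector of the matrix is the coefficient family of a combination that is
  orthogonal to all \<open>b i\<close>.\<close>

lemma gram_det_nonzero:
  fixes b :: "nat \<Rightarrow> 'e::real_vector" and Q :: "'e \<Rightarrow> 'e \<Rightarrow> real"
  assumes lin: "\<And>x. linear (Q x)"
    and indep: "\<And>c. (\<Sum>i<m. c i *\<^sub>R b i) = 0 \<Longrightarrow> \<forall>i<m. c i = 0"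
    and nondeg: "\<And>c. (\<forall>i<m. Q (b i) (\<Sum>j<m. c j *\<^sub>R b j) = 0) \<Longrightarrow> (\<Sum>j<m. c j *\<^sub>R b j) = 0"
  shows "gram_det m (\<lambda>i j. Q (b i) (b j)) \<noteq> 0"
  unfolding gram_det_def
proof
  let ?M = "Matrix.mat m m (\<lambda>(i, j). Q (b i) (b j))"
  assume "Determinant.det ?M = 0"
  then obtain v where v: "v \<in> carrier_vec m" "v \<noteq> 0\<^sub>v m" "?M *\<^sub>v v = 0\<^sub>v m"
    using det_0_iff_vec_prod_zero_field[of ?M m] by auto
  let ?c = "vec_index v"
  have "Q (b i) (\<Sum>j<m. ?c j *\<^sub>R b j) = 0" if "i < m" for i
  proof -
    have "Q (b i) (\<Sum>j<m. ?c j *\<^sub>R b j) = (\<Sum>j<m. ?c j * Q (b i) (b j))"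
      using lin[of "b i"] by (simp add: linear_sum linear_scale)
    also have "\<dots> = vec_index (?M *\<^sub>v v) i"
      using that v(1) by (auto simp: scalar_prod_def mult.commute atLeast0LessThan intro!: sum.cong)
    finally show ?thesis using that v(3) by simp
  qed
  then have "\<forall>i<m. ?c i = 0" using nondeg indep by blast
  then have "v = 0\<^sub>v m" using v(1) by (intro eq_vecI) auto
  with v(2) show False by simp
qed

lemma Ck_on_gram_det:
  fixes Q :: "'e::euclidean_space \<Rightarrow> nat \<Rightarrow> nat \<Rightarrow> real"
  assumes "open S" "\<And>i j. i < m \<Longrightarrow> j < m \<Longrightarrow> Ck_on k (\<lambda>x. Q x i j) S"
  shows "Ck_on k (\<lambda>x. gram_det m (Q x)) S"
  unfolding gram_det_permutations
  by (intro Ck_on_sum Ck_on_mult Ck_on_const Ck_on_prod assms) (auto dest: permutes_in_image)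

text \<open>Equality up to o(t^2) at 0. The limit of g belongs to the relation because it keeps the
  error f f' - g g' of a product at o(t^2).\<close>

definition agree2 :: "(real \<Rightarrow> real) \<Rightarrow> (real \<Rightarrow> real) \<Rightarrow> bool" where
  "agree2 f g \<longleftrightarrow> (\<exists>c. (g \<longlongrightarrow> c) (at 0)) \<and> ((\<lambda>t. (f t - g t) / t\<^sup>2) \<longlongrightarrow> 0) (at 0)"

lemma agree2_const: "agree2 (\<lambda>t. c) (\<lambda>t. c)"
  unfolding agree2_def by (auto intro: tendsto_const)

lemma agree2_cong:
  assumes "agree2 f g" "\<forall>\<^sub>F t in at 0. g t = h t"
  shows "agree2 f h"
proof -
  obtain c where c: "(g \<longlongrightarrow> c) (at 0)" "((\<lambda>t. (f t - g t) / t\<^sup>2) \<longlongrightarrow> 0) (at 0)"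
    using assms(1) unfolding agree2_def by blast
  have "\<forall>\<^sub>F t in at 0. (f t - g t) / t\<^sup>2 = (f t - h t) / t\<^sup>2"
    using assms(2) by (rule eventually_mono) simp
  from Lim_transform_eventually[OF c(2) this] Lim_transform_eventually[OF c(1) assms(2)]
  show ?thesis unfolding agree2_def by blast
qed

lemma agree2_tendsto:
  assumes "agree2 f g" "(g \<longlongrightarrow> c) (at 0)"
  shows "(f \<longlongrightarrow> c) (at 0)"
proof -
  have "((\<lambda>t. (f t - g t) / t\<^sup>2 * t\<^sup>2 + g t) \<longlongrightarrow> 0 * 0\<^sup>2 + c) (at 0)"
    using assms unfolding agree2_def by (intro tendsto_intros) auto
  moreover have "\<forall>\<^sub>F t in at 0. (f t - g t) / t\<^sup>2 * t\<^sup>2 + g t = f t"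
    by (simp add: eventually_at_filter)
  ultimately show ?thesis by (auto elim: Lim_transform_eventually)
qed

lemma agree2_add:
  assumes "agree2 f g" "agree2 f' g'"
  shows "agree2 (\<lambda>t. f t + f' t) (\<lambda>t. g t + g' t)"
proof -
  obtain c c' where "(g \<longlongrightarrow> c) (at 0)" "(g' \<longlongrightarrow> c') (at 0)" using assms agree2_def by auto
  then have "((\<lambda>t. g t + g' t) \<longlongrightarrow> c + c') (at 0)" by (rule tendsto_add)
  moreover have "((\<lambda>t. (f t - g t) / t\<^sup>2 + (f' t - g' t) / t\<^sup>2) \<longlongrightarrow> 0 + 0) (at 0)"
    using assms unfolding agree2_def by (intro tendsto_add) auto
  ultimately show ?thesis
    unfolding agree2_def by (auto simp: add_divide_distrib[symmetric] algebra_simps)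
qed

lemma agree2_mult:
  assumes "agree2 f g" "agree2 f' g'"
  shows "agree2 (\<lambda>t. f t * f' t) (\<lambda>t. g t * g' t)"
proof -
  obtain c c' where c: "(g \<longlongrightarrow> c) (at 0)" "(g' \<longlongrightarrow> c') (at 0)" using assms agree2_def by auto
  then have "((\<lambda>t. g t * g' t) \<longlongrightarrow> c * c') (at 0)" by (rule tendsto_mult)
  moreover have "((\<lambda>t. (f t - g t) / t\<^sup>2 * f' t + g t * ((f' t - g' t) / t\<^sup>2)) \<longlongrightarrow> 0 * c' + c * 0) (at 0)"
    using assms c agree2_tendsto[OF assms(2) c(2)] unfolding agree2_def by (intro tendsto_intros) auto
  moreover have "(f t - g t) / t\<^sup>2 * f' t + g t * ((f' t - g' t) / t\<^sup>2) = (f t * f' t - g t * g' t) / t\<^sup>2" for t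
    by (simp add: add_divide_distrib[symmetric] algebra_simps)
  ultimately show ?thesis
    unfolding agree2_def by auto
qed

lemma agree2_diff:
  "agree2 f g \<Longrightarrow> agree2 f' g' \<Longrightarrow> agree2 (\<lambda>t. f t - f' t) (\<lambda>t. g t - g' t)"
  using agree2_add[OF _ agree2_mult[OF agree2_const[of "- 1"]], of f g f' g'] by simp

lemma agree2_sum:
  "(\<And>i. i \<in> I \<Longrightarrow> agree2 (f i) (g i)) \<Longrightarrow> agree2 (\<lambda>t. \<Sum>i\<in>I. f i t) (\<lambda>t. \<Sum>i\<in>I. g i t)"
  by (induction I rule: infinite_finite_induct) (auto intro: agree2_add agree2_const)

lemma agree2_prod:
  "(\<And>i. i \<in> I \<Longrightarrow> agree2 (f i) (g i)) \<Longrightarrow> agree2 (\<lambda>t. \<Prod>i\<in>I. f i t) (\<lambda>t. \<Prod>i\<in>I. g i t)"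
  by (induction I rule: infinite_finite_induct) (auto intro: agree2_mult agree2_const)

lemma agree2_gram_det:
  assumes "\<And>i j. i < m \<Longrightarrow> j < m \<Longrightarrow> agree2 (\<lambda>t. Q t i j) (\<lambda>t. Q' t i j)"
  shows "agree2 (\<lambda>t. gram_det m (Q t)) (\<lambda>t. gram_det m (Q' t))"
  unfolding gram_det_permutations
  by (intro agree2_sum agree2_mult agree2_const agree2_prod assms) (auto dest: permutes_in_image)

lemma has_real_derivative_bilinear_family:
  fixes K :: "real \<Rightarrow> 'e::euclidean_space \<Rightarrow> 'e \<Rightarrow> real"
  assumes bil: "\<forall>\<^sub>F t in nhds 0. bilinear (K t)"
    and K': "\<And>a b. ((\<lambda>t. K t a b) has_real_derivative K' a b) (at 0)"
    and x: "(x has_vector_derivative x') (at 0)" and y: "(y has_vector_derivative y') (at 0)"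
  shows "((\<lambda>t. K t (x t) (y t)) has_real_derivative
    K' (x 0) (y 0) + K 0 x' (y 0) + K 0 (x 0) y') (at 0)"
proof -
  have expand: "k a b = (\<Sum>i\<in>Basis. \<Sum>j\<in>Basis. (a \<bullet> i) * (b \<bullet> j) * k i j)"
    if "bilinear k" for k :: "'e \<Rightarrow> 'e \<Rightarrow> real" and a b
  proof -
    have l: "linear (k a)" "linear (\<lambda>a. k a b)" for a b using that by (auto simp: bilinear_def)
    have "k a b = k (\<Sum>i\<in>Basis. (a \<bullet> i) *\<^sub>R i) b" by (simp add: euclidean_representation)
    also have "\<dots> = (\<Sum>i\<in>Basis. (a \<bullet> i) * k i b)"
      by (simp add: linear_sum[OF l(2)] linear_scale[OF l(2)])
    also have "\<dots> = (\<Sum>i\<in>Basis. (a \<bullet> i) * k i (\<Sum>j\<in>Basis. (b \<bullet> j) *\<^sub>R j))"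
      by (simp add: euclidean_representation)
    also have "\<dots> = (\<Sum>i\<in>Basis. \<Sum>j\<in>Basis. (a \<bullet> i) * (b \<bullet> j) * k i j)"
      by (simp add: linear_sum[OF l(1)] linear_scale[OF l(1)] sum_distrib_left mult.assoc)
    finally show ?thesis .
  qed
  have K0: "bilinear (K 0)" using bil by (rule eventually_nhds_x_imp_x)
  have deriv: "((\<lambda>t. K t (x t) (y t)) has_real_derivative
      (\<Sum>i\<in>Basis. \<Sum>j\<in>Basis. (x 0 \<bullet> i) * (y 0 \<bullet> j) * K' i j)
      + K 0 x' (y 0) + K 0 (x 0) y') (at 0)"
    if x: "(x has_vector_derivative x') (at 0)" and y: "(y has_vector_derivative y') (at 0)" for x y x' y'
  proof -
    have "((\<lambda>t. x t \<bullet> i) has_real_derivative x' \<bullet> i) (at 0)"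
      "((\<lambda>t. y t \<bullet> i) has_real_derivative y' \<bullet> i) (at 0)" for i
      using bounded_linear.has_vector_derivative[OF bounded_linear_inner_left x]
        bounded_linear.has_vector_derivative[OF bounded_linear_inner_left y]
      by (simp_all add: has_real_derivative_iff_has_vector_derivative)
    then have "((\<lambda>t. \<Sum>i\<in>Basis. \<Sum>j\<in>Basis. (x t \<bullet> i) * (y t \<bullet> j) * K t i j) has_real_derivative
      (\<Sum>i\<in>Basis. \<Sum>j\<in>Basis. (x 0 \<bullet> i) * (y 0 \<bullet> j) * K' i j +
         ((x' \<bullet> i) * (y 0 \<bullet> j) + (x 0 \<bullet> i) * (y' \<bullet> j)) * K 0 i j)) (at 0)"
      by (auto intro!: derivative_eq_intros K' sum.cong simp: algebra_simps)
    then have *: "((\<lambda>t. \<Sum>i\<in>Basis. \<Sum>j\<in>Basis. (x t \<bullet> i) * (y t \<bullet> j) * K t i j) has_real_derivative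
      (\<Sum>i\<in>Basis. \<Sum>j\<in>Basis. (x 0 \<bullet> i) * (y 0 \<bullet> j) * K' i j)
      + K 0 x' (y 0) + K 0 (x 0) y') (at 0)"
      unfolding expand[OF K0, of x'] expand[OF K0, of "x 0"]
      by (simp add: sum.distrib algebra_simps)
    have "\<forall>\<^sub>F t in nhds 0. K t (x t) (y t) = (\<Sum>i\<in>Basis. \<Sum>j\<in>Basis. (x t \<bullet> i) * (y t \<bullet> j) * K t i j)"
      using bil by (rule eventually_mono) (rule expand)
    then show ?thesis using * by (subst DERIV_cong_ev[OF refl _ refl])
  qed
  \<comment> \<open>K' is only a family of derivatives at fixed arguments. Applying the expanded
    formula to the constant curves x 0 and y 0, and comparing with K' by uniqueness of derivatives,
    identifies the sum.\<close>
  have "(\<Sum>i\<in>Basis. \<Sum>j\<in>Basis. (x 0 \<bullet> i) * (y 0 \<bullet> j) * K' i j) = K' (x 0) (y 0)"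
  proof -
    have z: "K 0 0 c = 0" "K 0 c 0 = 0" for c
      using K0 bilinear_lzero bilinear_rzero by blast+
    show ?thesis
      using DERIV_unique[OF deriv[of "\<lambda>_. x 0" 0 "\<lambda>_. y 0" 0] K'[of "x 0" "y 0"]] z by simp
  qed
  then show ?thesis using deriv[OF x y] by simp
qed

text \<open>Both points move, so strict differentiability is used: f(x) - f(y) = Df(p)(x - y) + o(|x
  - y|), where |x - y| = O(t^2). The application has x t = F(p + t u) and y t = p + t u.\<close>

lemma Ck_on_tendsto_quotient2:
  assumes f: "Ck_on 1 f S" "open S" "p \<in> S"
    and x: "(x \<longlongrightarrow> p) (at 0)" and y: "(y \<longlongrightarrow> p) (at 0)"
    and z: "((\<lambda>t. (x t - y t) /\<^sub>R t\<^sup>2) \<longlongrightarrow> z) (at (0::real))"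
  shows "((\<lambda>t. (f (x t) - f (y t)) /\<^sub>R t\<^sup>2) \<longlongrightarrow> ddir z f p) (at 0)"
proof -
  have C: "Ck_on (Suc 0) f S" using f(1) by simp
  have bl: "bounded_linear (\<lambda>v. ddir v f p)"
    by (rule has_derivative_bounded_linear[OF Ck_on_differentiable[OF C f(2,3)]])
  have main: "((\<lambda>t. ddir ((x t - y t) /\<^sub>R t\<^sup>2) f p) \<longlongrightarrow> ddir z f p) (at 0)"
    by (rule bounded_linear.tendsto[OF bl z])
  have rem: "((\<lambda>t. (f (x t) - f (y t) - ddir (x t - y t) f p) /\<^sub>R t\<^sup>2) \<longlongrightarrow> 0) (at 0)"
  proof (rule tendstoI)
    fix e :: real assume e: "e > 0"
    define n where "n = norm z + 1"
    define e' where "e' = e / (2 * n)"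
    have "n > 0" unfolding n_def by (smt (verit) norm_ge_zero)
    then have e': "e' > 0" "e' * n = e / 2" using e by (simp_all add: e'_def)
    obtain d where d: "d > 0" "\<And>a b. a \<in> ball p d \<Longrightarrow> b \<in> ball p d \<Longrightarrow>
        norm (f a - f b - ddir (a - b) f p) \<le> e' * norm (a - b)"
      using Ck_on_strict_differentiable[OF f e'(1)] by blast
    have "\<forall>\<^sub>F t in at 0. norm ((x t - y t) /\<^sub>R t\<^sup>2) < n"
      by (rule order_tendstoD(2)[OF tendsto_norm[OF z]]) (simp add: n_def)
    with tendstoD[OF x d(1)] tendstoD[OF y d(1)]
    show "\<forall>\<^sub>F t in at 0. dist ((f (x t) - f (y t) - ddir (x t - y t) f p) /\<^sub>R t\<^sup>2) 0 < e"
    proof eventually_elim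
      case (elim t)
      have "norm (f (x t) - f (y t) - ddir (x t - y t) f p) \<le> e' * norm (x t - y t)"
        using elim by (intro d(2)) (simp_all add: dist_commute)
      then have "inverse (t\<^sup>2) * norm (f (x t) - f (y t) - ddir (x t - y t) f p)
          \<le> inverse (t\<^sup>2) * (e' * norm (x t - y t))"
        by (rule mult_left_mono) simp
      also have "\<dots> = e' * norm ((x t - y t) /\<^sub>R t\<^sup>2)" by simp
      also have "\<dots> \<le> e' * n" using elim e'(1) by (intro mult_left_mono) auto
      also have "\<dots> < e" using e'(2) e by simp
      finally show ?case by simp
    qed
  qed
  have "(f (x t) - f (y t) - ddir (x t - y t) f p) /\<^sub>R t\<^sup>2 + ddir ((x t - y t) /\<^sub>R t\<^sup>2) f p
      = (f (x t) - f (y t)) /\<^sub>R t\<^sup>2" for t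
    unfolding linear_simps(5)[OF bl] by (simp add: scaleR_diff_right)
  then show ?thesis using tendsto_add[OF rem main] by simp
qed

section \<open>The second derivative of a pullback that preserves the jets\<close>

text \<open>The data in one chart, freed of the manifold. H is the metric composed with the
  projections along w, hence a form on the whole space that vanishes on w and is positive on the
  kernel of \<theta> at p. \<open>\<theta>'\<close> and \<open>H'\<close> are the coordinates of the
  pulled back pair in the same fibre chart; \<open>nondeg\<close> is the contact condition at p. The
  set V is so small that F maps it into N and \<open>lam\<close> has no zero on it.\<close>

locale contact_two_jet =
  fixes p :: "'e::euclidean_space" and N V :: "'e set" and \<theta> :: "'e \<Rightarrow> 'e"
    and H :: "'e \<Rightarrow> 'e \<Rightarrow> 'e \<Rightarrow> real" and w :: 'e and F :: "'e \<Rightarrow> 'e"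
    and lam :: "'e \<Rightarrow> real" and \<theta>' :: "'e \<Rightarrow> 'e \<Rightarrow> real" and H' :: "'e \<Rightarrow> 'e \<Rightarrow> 'e \<Rightarrow> real"
  defines "lam \<equiv> \<lambda>q. \<theta> (F q) \<bullet> ddir w F q"
    and "\<theta>' \<equiv> \<lambda>q v. (\<theta> (F q) \<bullet> ddir v F q) / lam q"
    and "H' \<equiv> \<lambda>q u v. H (F q) (ddir (u - \<theta>' q u *\<^sub>R w) F q) (ddir (v - \<theta>' q v *\<^sub>R w) F q)"
  assumes open_N: "open N" and open_V: "open V" and p: "p \<in> V" and VN: "V \<subseteq> N"
    and FV: "F ` V \<subseteq> N" and Fp: "F p = p" and smooth_F: "\<And>k. Ck_on k F V"
    and DF: "\<And>v. ddir v F p = v"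
    and smooth_\<theta>: "\<And>k. Ck_on k \<theta> N" and \<theta>_w: "\<And>q. q \<in> N \<Longrightarrow> \<theta> q \<bullet> w = 1"
    and smooth_H: "\<And>k u v. Ck_on k (\<lambda>q. H q u v) N"
    and bilinear_H: "\<And>q. q \<in> N \<Longrightarrow> bilinear (H q)"
    and sym_H: "\<And>q u v. q \<in> N \<Longrightarrow> H q u v = H q v u"
    and H_w: "\<And>q v. q \<in> N \<Longrightarrow> H q w v = 0"
    and pos_H: "\<And>u. \<theta> p \<bullet> u = 0 \<Longrightarrow> u \<noteq> 0 \<Longrightarrow> H p u u > 0"
    and lam_nz: "\<And>q. q \<in> V \<Longrightarrow> lam q \<noteq> 0"
    and nondeg: "\<And>z. \<theta> p \<bullet> z = 0 \<Longrightarrow>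
      (\<And>v. \<theta> p \<bullet> v = 0 \<Longrightarrow> ddir z \<theta> p \<bullet> v - ddir v \<theta> p \<bullet> z = 0) \<Longrightarrow> z = 0"
    and DIM_ge: "DIM('e) \<ge> 2"
    and jet_proj: "\<And>v. same_jet 3 (\<lambda>q. v - \<theta>' q v *\<^sub>R w) (\<lambda>q. v - (\<theta> q \<bullet> v) *\<^sub>R w) p"
    and jet_H: "\<And>u v. same_jet 3 (\<lambda>q. H' q u v) (\<lambda>q. H q u v) p"
begin

section \<open>The pulled back form and its first order consequences at p\<close>

definition "d\<theta> q a b = ddir a \<theta> q \<bullet> b - ddir b \<theta> q \<bullet> a"

definition "d\<theta>' q a b = ddir a (\<lambda>q. \<theta>' q b) q - ddir b (\<lambda>q. \<theta>' q a) q"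

definition "B u v = ddir u (ddir v F) p"

lemma pN: "p \<in> N"
  using p VN by blast

lemma smooth_DF: "Ck_on k (ddir v F) V"
  by (rule Ck_on_ddir[OF smooth_F])

lemma smooth_\<theta>F: "Ck_on k (\<lambda>q. \<theta> (F q)) V"
  by (rule Ck_on_compose[OF open_V open_N FV smooth_F smooth_\<theta>])

lemma smooth_lam: "Ck_on k lam V"
  unfolding lam_def by (rule Ck_on_inner[OF open_V smooth_\<theta>F smooth_DF])

lemma smooth_\<theta>': "Ck_on k (\<lambda>q. \<theta>' q v) V"
  unfolding \<theta>'_def divide_inverse
  by (intro Ck_on_mult Ck_on_inner Ck_on_inverse open_V smooth_\<theta>F smooth_DF smooth_lam lam_nz)

lemma smooth_\<theta>_inner: "Ck_on k (\<lambda>q. \<theta> q \<bullet> v) N"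
  by (rule Ck_on_inner[OF open_N smooth_\<theta> Ck_on_const[OF open_N]])

lemma jet_\<theta>: "same_jet 3 (\<lambda>q. \<theta>' q v) (\<lambda>q. \<theta> q \<bullet> v) p"
proof -
  \<comment> \<open>The coefficient r is recovered from v - r w by taking the inner product with w;
    \<open>?L\<close> together with its additive constant is this affine inverse.\<close>
  let ?L = "\<lambda>z. - (1 / (w \<bullet> w)) * (z \<bullet> w)"
  have w: "w \<bullet> w \<noteq> 0" using \<theta>_w[OF pN] by auto
  have "same_jet 3 (\<lambda>q. v \<bullet> w / (w \<bullet> w) + ?L (v - \<theta>' q v *\<^sub>R w))
      (\<lambda>q. v \<bullet> w / (w \<bullet> w) + ?L (v - (\<theta> q \<bullet> v) *\<^sub>R w)) p"
  proof (rule same_jet_affine[OF open_V p _ _ _ jet_proj])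
    show "Ck_on 3 (\<lambda>q. v - \<theta>' q v *\<^sub>R w) V"
      by (intro Ck_on_diff Ck_on_scaleR Ck_on_const open_V smooth_\<theta>')
    show "Ck_on 3 (\<lambda>q. v - (\<theta> q \<bullet> v) *\<^sub>R w) V"
      by (intro Ck_on_diff Ck_on_scaleR Ck_on_const open_V Ck_on_subset[OF smooth_\<theta>_inner VN])
    show "bounded_linear ?L" by (intro bounded_linear_const_mult bounded_linear_inner_left)
  qed
  moreover have "v \<bullet> w / (w \<bullet> w) + ?L (v - r *\<^sub>R w) = r" for r
    using w by (simp add: inner_diff_left field_simps)
  ultimately show ?thesis by simp
qed

lemma smooth_D\<theta>: "Ck_on k (ddir a \<theta>) N"
  by (rule Ck_on_ddir[OF smooth_\<theta>])

lemma D_F: "q \<in> V \<Longrightarrow> (F has_derivative (\<lambda>v. ddir v F q)) (at q)"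
  by (rule Ck_on_differentiable[OF smooth_F open_V])

lemma D_\<theta>: "q \<in> N \<Longrightarrow> (\<theta> has_derivative (\<lambda>v. ddir v \<theta> q)) (at q)"
  by (rule Ck_on_differentiable[OF smooth_\<theta> open_N])

lemma D_\<theta>': "q \<in> V \<Longrightarrow> ((\<lambda>q. \<theta>' q b) has_derivative (\<lambda>v. ddir v (\<lambda>q. \<theta>' q b) q)) (at q)"
  by (rule Ck_on_differentiable[OF smooth_\<theta>' open_V])

lemma D_lam: "q \<in> V \<Longrightarrow> (lam has_derivative (\<lambda>v. ddir v lam q)) (at q)"
  by (rule Ck_on_differentiable[OF smooth_lam open_V])

lemma D_DF: "q \<in> V \<Longrightarrow> (ddir v F has_derivative (\<lambda>u. ddir u (ddir v F) q)) (at q)"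
  by (rule Ck_on_differentiable[OF smooth_DF open_V])

lemma linear_DF: "q \<in> V \<Longrightarrow> linear (\<lambda>v. ddir v F q)"
  by (rule has_derivative_linear[OF D_F])

lemma linear_\<theta>': "q \<in> V \<Longrightarrow> linear (\<theta>' q)"
  unfolding \<theta>'_def
  by (intro linearI) (simp_all add: linear_add[OF linear_DF] linear_scale[OF linear_DF]
      inner_add_right add_divide_distrib)

lemma lam_\<theta>': "q \<in> V \<Longrightarrow> \<theta> (F q) \<bullet> ddir v F q = lam q * \<theta>' q v"
  using lam_nz by (simp add: \<theta>'_def)

lemma \<theta>'_w: "q \<in> V \<Longrightarrow> \<theta>' q w = 1"
  using lam_nz by (simp add: \<theta>'_def lam_def)

lemma lam_p: "lam p = 1"
  by (simp add: lam_def Fp DF \<theta>_w pN)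

lemma \<theta>'_p: "\<theta>' p v = \<theta> p \<bullet> v"
  by (simp add: \<theta>'_def lam_p Fp DF)

lemma D_pullback:
  assumes "q \<in> V"
  shows "ddir a (\<lambda>q. \<theta> (F q) \<bullet> ddir b F q) q =
    \<theta> (F q) \<bullet> ddir a (ddir b F) q + ddir (ddir a F q) \<theta> (F q) \<bullet> ddir b F q"
proof -
  have "((\<lambda>q. \<theta> (F q)) has_derivative (\<lambda>v. ddir (ddir v F q) \<theta> (F q))) (at q)"
    using has_derivative_compose[OF D_F[OF assms] D_\<theta>] FV assms by blast
  from ddir_eqI[OF has_derivative_inner[OF this D_DF[OF assms]]] show ?thesis by simp
qed

lemma D_lam_\<theta>':
  assumes "q \<in> V"
  shows "ddir a (\<lambda>q. \<theta> (F q) \<bullet> ddir b F q) q =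
    ddir a lam q * \<theta>' q b + lam q * ddir a (\<lambda>q. \<theta>' q b) q"
proof -
  have "ddir a (\<lambda>q. \<theta> (F q) \<bullet> ddir b F q) q = ddir a (\<lambda>q. lam q * \<theta>' q b) q"
    by (rule ddir_cong_open[OF open_V assms lam_\<theta>'])
  also have "\<dots> = ddir a lam q * \<theta>' q b + lam q * ddir a (\<lambda>q. \<theta>' q b) q"
    using ddir_eqI[OF has_derivative_mult[OF D_lam[OF assms] D_\<theta>'[OF assms]]] by simp
  finally show ?thesis .
qed

text \<open>\<open>D_pullback\<close> and \<open>D_lam_\<theta>'\<close> compute the same
  derivative, once by the chain rule and once from the product of \<open>lam\<close> and
  \<open>\<theta>'\<close>. After antisymmetrisation in a and b the second derivatives of F
  cancel.\<close>

lemma d_pullback: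
  assumes "q \<in> V"
  shows "d\<theta> (F q) (ddir a F q) (ddir b F q) =
    ddir a lam q * \<theta>' q b - ddir b lam q * \<theta>' q a + lam q * d\<theta>' q a b"
proof -
  have "d\<theta> (F q) (ddir a F q) (ddir b F q) =
      ddir a (\<lambda>q. \<theta> (F q) \<bullet> ddir b F q) q - ddir b (\<lambda>q. \<theta> (F q) \<bullet> ddir a F q) q"
    unfolding d\<theta>_def D_pullback[OF assms]
    using ddir_commute[OF smooth_F open_V assms, of a b] by simp
  also have "\<dots> = ddir a lam q * \<theta>' q b - ddir b lam q * \<theta>' q a + lam q * d\<theta>' q a b"
    unfolding D_lam_\<theta>'[OF assms] d\<theta>'_def by (simp add: algebra_simps)
  finally show ?thesis .
qed

lemma bilinear_d\<theta>: "q \<in> N \<Longrightarrow> bilinear (d\<theta> q)"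
  unfolding bilinear_def d\<theta>_def
  by (auto intro!: linearI
      simp: ddir_add[OF D_\<theta>] ddir_scaleR[OF D_\<theta>] inner_add_left inner_add_right algebra_simps)

lemma d\<theta>_alt: "d\<theta> q a b = - d\<theta> q b a"
  by (simp add: d\<theta>_def)

lemma bilinear_d\<theta>':
  assumes "q \<in> V"
  shows "bilinear (d\<theta>' q)"
proof -
  have "ddir a (\<lambda>q. \<theta>' q (b + c)) q = ddir a (\<lambda>q. \<theta>' q b) q + ddir a (\<lambda>q. \<theta>' q c) q" for a b c
  proof -
    have "ddir a (\<lambda>q. \<theta>' q (b + c)) q = ddir a (\<lambda>q. \<theta>' q b + \<theta>' q c) q"
      by (rule ddir_cong_open[OF open_V assms]) (simp add: linear_add[OF linear_\<theta>'])
    then show ?thesis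
      using ddir_eqI[OF has_derivative_add[OF D_\<theta>'[OF assms] D_\<theta>'[OF assms]]] by simp
  qed
  moreover have "ddir a (\<lambda>q. \<theta>' q (r *\<^sub>R b)) q = r * ddir a (\<lambda>q. \<theta>' q b) q" for a b r
  proof -
    have "ddir a (\<lambda>q. \<theta>' q (r *\<^sub>R b)) q = ddir a (\<lambda>q. r * \<theta>' q b) q"
      by (rule ddir_cong_open[OF open_V assms]) (simp add: linear_scale[OF linear_\<theta>'])
    then show ?thesis
      using ddir_eqI[OF has_derivative_mult_right[OF D_\<theta>'[OF assms]]] by simp
  qed
  ultimately show ?thesis
    unfolding bilinear_def d\<theta>'_def
    by (auto intro!: linearI
        simp: ddir_add[OF D_\<theta>'[OF assms]] ddir_scaleR[OF D_\<theta>'[OF assms]] algebra_simps)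
qed

lemma B_sym: "B u v = B v u"
  unfolding B_def by (rule ddir_commute[OF smooth_F open_V p])

lemma bilinear_B: "bilinear B"
proof -
  have "linear (\<lambda>u. B u v)" for v
    unfolding B_def by (rule has_derivative_linear[OF D_DF[OF p]])
  moreover have "B u = (\<lambda>v. B v u)" for u
    using B_sym by auto
  ultimately show ?thesis
    unfolding bilinear_def by metis
qed

lemma D_\<theta>'_p: "ddir u (\<lambda>q. \<theta>' q v) p = ddir u \<theta> p \<bullet> v"
proof -
  have "iter_deriv [u] (\<lambda>q. \<theta>' q v) p = iter_deriv [u] (\<lambda>q. \<theta> q \<bullet> v) p"
    using jet_\<theta>[of v, unfolded same_jet_def, rule_format, of "[u]"] by simp
  then show ?thesis
    using ddir_bounded_linear[OF D_\<theta>[OF pN] bounded_linear_inner_left] by simp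
qed

text \<open>The same two expressions at p, now without antisymmetrisation: the 1-jets of \<theta>'
  and \<theta> agree there, so the derivatives of the forms cancel and the component of B transverse
  to D is governed by d\<lambda>.\<close>

lemma \<theta>_B: "\<theta> p \<bullet> B u v = ddir u lam p * (\<theta> p \<bullet> v)"
  using D_pullback[OF p, of u v] D_lam_\<theta>'[OF p, of u v]
  by (simp add: Fp DF \<theta>'_p lam_p D_\<theta>'_p B_def)

lemma D_F_line: "((\<lambda>t. ddir v F (p + t *\<^sub>R u)) has_vector_derivative B u v) (at 0)"
  unfolding B_def by (rule has_vector_derivative_line) (simp add: D_DF[OF p])

lemma D_comp_F_line:
  fixes g :: "'e \<Rightarrow> real"
  assumes "\<And>k. Ck_on k g N"
  shows "((\<lambda>t. g (F (p + t *\<^sub>R u))) has_real_derivative ddir u g p) (at 0)"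
proof -
  have "(g has_derivative (\<lambda>v. ddir v g (F p))) (at (F p))"
    unfolding Fp by (rule Ck_on_differentiable[OF assms open_N pN])
  from has_derivative_compose[OF D_F[OF p] this]
  have "((\<lambda>q. g (F q)) has_derivative (\<lambda>v. ddir v g p)) (at p)" by (simp add: DF Fp)
  then show ?thesis
    unfolding has_real_derivative_iff_has_vector_derivative
    by (intro has_vector_derivative_line) simp
qed

lemma line_V: "\<forall>\<^sub>F t in nhds 0. p + t *\<^sub>R u \<in> V"
  by (rule eventually_line[OF open_V p])

text \<open>The arguments of H in \<open>H'\<close> vary with q, whereas \<open>smooth_H\<close>
  concerns fixed vectors; the expansion separates the two dependences.\<close>

lemma H'_expand:
  assumes "q \<in> V"
  shows "H' q a b = (\<Sum>i\<in>Basis. \<Sum>j\<in>Basis.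
    ((ddir a F q - \<theta>' q a *\<^sub>R ddir w F q) \<bullet> i) * ((ddir b F q - \<theta>' q b *\<^sub>R ddir w F q) \<bullet> j) * H (F q) i j)"
proof -
  have bil: "bilinear (H (F q))" using assms FV by (intro bilinear_H) blast
  let ?x = "\<lambda>a. ddir a F q - \<theta>' q a *\<^sub>R ddir w F q"
  have "H' q a b = H (F q) (?x a) (?x b)"
    unfolding H'_def using assms by (simp add: linear_diff[OF linear_DF] linear_scale[OF linear_DF])
  also have "\<dots> = (\<Sum>(i, j)\<in>Basis \<times> Basis. H (F q) ((?x a \<bullet> i) *\<^sub>R i) ((?x b \<bullet> j) *\<^sub>R j))"
    by (subst bilinear_sum[OF bil, symmetric]) (simp add: euclidean_representation)
  also have "\<dots> = (\<Sum>i\<in>Basis. \<Sum>j\<in>Basis. (?x a \<bullet> i) * (?x b \<bullet> j) * H (F q) i j)"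
    by (simp add: sum.cartesian_product[symmetric] bilinear_lmul[OF bil] bilinear_rmul[OF bil] mult_ac)
  finally show ?thesis .
qed

lemma smooth_H': "Ck_on k (\<lambda>q. H' q a b) V"
proof -
  have "Ck_on k (\<lambda>q. H (F q) i j) V" for i j
    by (rule Ck_on_compose[OF open_V open_N FV smooth_F smooth_H])
  then have "Ck_on k (\<lambda>q. \<Sum>i\<in>Basis. \<Sum>j\<in>Basis.
    ((ddir a F q - \<theta>' q a *\<^sub>R ddir w F q) \<bullet> i) * ((ddir b F q - \<theta>' q b *\<^sub>R ddir w F q) \<bullet> j) * H (F q) i j) V"
    by (intro Ck_on_sum Ck_on_mult Ck_on_inner Ck_on_diff Ck_on_scaleR Ck_on_const open_V
        smooth_DF smooth_\<theta>')
  then show ?thesis by (rule Ck_on_cong[OF open_V, rotated]) (simp only: H'_expand)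
qed

text \<open>Derivative at p, along the line p + t u, of the relation defining \<open>H'\<close>. By
  equality of jets the derivative of H at fixed arguments occurs on both sides, which leaves only
  the variation of the arguments.\<close>

lemma H_B_skew:
  assumes "\<theta> p \<bullet> a = 0" "\<theta> p \<bullet> b = 0"
  shows "H p (B u a) b + H p a (B u b) = 0"
proof -
  \<comment> \<open>\<open>x a\<close> is the image under DF of the projection of a to the pulled
    back hyperplane. For a in the kernel of \<theta> at p its derivative at 0 is B(u, a) up to a
    multiple of w, which H does not see.\<close>
  define x where "x a t = ddir a F (p + t *\<^sub>R u) - \<theta>' (p + t *\<^sub>R u) a *\<^sub>R ddir w F (p + t *\<^sub>R u)" for a t
  define x' where "x' a = B u a - (ddir u \<theta> p \<bullet> a) *\<^sub>R w" for a
  have x: "(x a has_vector_derivative x' a) (at 0)" if "\<theta> p \<bullet> a = 0" for a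
  proof -
    have "((\<lambda>t. \<theta>' (p + t *\<^sub>R u) a) has_real_derivative ddir u \<theta> p \<bullet> a) (at 0)"
      unfolding has_real_derivative_iff_has_vector_derivative D_\<theta>'_p[symmetric]
      by (rule has_vector_derivative_line) (simp add: D_\<theta>'[OF p])
    from has_vector_derivative_diff[OF D_F_line has_vector_derivative_scaleR[OF this D_F_line]]
    show ?thesis
      unfolding x_def[abs_def] x'_def by (simp add: \<theta>'_p that DF)
  qed
  have x0: "x a 0 = a" if "\<theta> p \<bullet> a = 0" for a
    using that by (simp add: x_def \<theta>'_p DF)
  have "\<forall>\<^sub>F t in nhds 0. bilinear (H (F (p + t *\<^sub>R u)))"
    using line_V[of u] by (rule eventually_mono) (use FV in \<open>auto intro: bilinear_H\<close>)
  from has_real_derivative_bilinear_family[OF this D_comp_F_line[OF smooth_H] x[OF assms(1)] x[OF assms(2)]]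
  have 1: "((\<lambda>t. H (F (p + t *\<^sub>R u)) (x a t) (x b t)) has_real_derivative
      ddir u (\<lambda>q. H q a b) p + H p (x' a) b + H p a (x' b)) (at 0)"
    by (simp add: x0 assms Fp)
  have "\<forall>\<^sub>F t in nhds 0. H (F (p + t *\<^sub>R u)) (x a t) (x b t) = H' (p + t *\<^sub>R u) a b"
    using line_V[of u]
    by (rule eventually_mono)
      (simp add: H'_def x_def linear_diff[OF linear_DF] linear_scale[OF linear_DF])
  then have "((\<lambda>t. H' (p + t *\<^sub>R u) a b) has_real_derivative
      ddir u (\<lambda>q. H q a b) p + H p (x' a) b + H p a (x' b)) (at 0)"
    using 1 by (subst (asm) DERIV_cong_ev[OF refl _ refl])
  moreover have "((\<lambda>t. H' (p + t *\<^sub>R u) a b) has_real_derivative ddir u (\<lambda>q. H' q a b) p) (at 0)"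
    unfolding has_real_derivative_iff_has_vector_derivative
    using Ck_on_differentiable[OF smooth_H' open_V p] by (intro has_vector_derivative_line) simp
  moreover have "ddir u (\<lambda>q. H' q a b) p = ddir u (\<lambda>q. H q a b) p"
  proof -
    have "iter_deriv [u] (\<lambda>q. H' q a b) p = iter_deriv [u] (\<lambda>q. H q a b) p"
      using jet_H[of a b, unfolded same_jet_def, rule_format, of "[u]"] by simp
    then show ?thesis by simp
  qed
  ultimately have "H p (x' a) b + H p a (x' b) = 0"
    using DERIV_unique by fastforce
  moreover have "H p (x' a) b = H p (B u a) b" "H p a (x' b) = H p a (B u b)"
    using H_w[OF pN] sym_H[OF pN] unfolding x'_def
    by (simp_all add: bilinear_lsub[OF bilinear_H[OF pN]] bilinear_rsub[OF bilinear_H[OF pN]]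
        bilinear_lmul[OF bilinear_H[OF pN]] bilinear_rmul[OF bilinear_H[OF pN]])
  ultimately show ?thesis by simp
qed

text \<open>On \<open>N\<close>, \<open>\<Omega> q i j\<close> is the value of \<open>d\<theta> q\<close> on the projections of \<open>b i\<close> and \<open>b j\<close> to the
  kernel of \<open>\<theta> q\<close> along \<open>w\<close>.\<close>

definition "\<Omega> b q i j = d\<theta> q (b i) (b j) - (\<theta> q \<bullet> b i) * d\<theta> q w (b j) - (\<theta> q \<bullet> b j) * d\<theta> q (b i) w"

definition "\<Omega>' b q i j = d\<theta>' q (b i) (b j) - \<theta>' q (b i) * d\<theta>' q w (b j) - \<theta>' q (b j) * d\<theta>' q (b i) w"

lemma \<Omega>_proj:
  assumes "q \<in> N"
  shows "\<Omega> b q i j = d\<theta> q (b i - (\<theta> q \<bullet> b i) *\<^sub>R w) (b j - (\<theta> q \<bullet> b j) *\<^sub>R w)"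
  using d\<theta>_alt[of q w w] unfolding \<Omega>_def
  by (simp add: bilinear_lsub[OF bilinear_d\<theta>[OF assms]] bilinear_rsub[OF bilinear_d\<theta>[OF assms]]
      bilinear_lmul[OF bilinear_d\<theta>[OF assms]] bilinear_rmul[OF bilinear_d\<theta>[OF assms]])

lemma \<Omega>'_proj:
  assumes "q \<in> V"
  shows "\<Omega>' b q i j = d\<theta>' q (b i - \<theta>' q (b i) *\<^sub>R w) (b j - \<theta>' q (b j) *\<^sub>R w)"
  unfolding \<Omega>'_def
  by (simp add: bilinear_lsub[OF bilinear_d\<theta>'[OF assms]] bilinear_rsub[OF bilinear_d\<theta>'[OF assms]]
      bilinear_lmul[OF bilinear_d\<theta>'[OF assms]] bilinear_rmul[OF bilinear_d\<theta>'[OF assms]] d\<theta>'_def[of q w w])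

lemma H_proj:
  assumes "q \<in> N"
  shows "H q (u - r *\<^sub>R w) (v - s *\<^sub>R w) = H q u v"
  using H_w[OF assms] sym_H[OF assms]
  by (simp add: bilinear_lsub[OF bilinear_H[OF assms]] bilinear_rsub[OF bilinear_H[OF assms]]
      bilinear_lmul[OF bilinear_H[OF assms]] bilinear_rmul[OF bilinear_H[OF assms]])

section \<open>Second order comparison of the two structures and expansion of \<lambda>\<close>

lemma agree2_jet:
  assumes "Ck_on 2 f V" "Ck_on 2 g V" "same_jet 2 f g p"
  shows "agree2 (\<lambda>t. f (p + t *\<^sub>R u)) (\<lambda>t. g (p + t *\<^sub>R u))"
proof -
  have "isCont g p"
    using Ck_on_continuous[OF assms(2)] open_V p by (simp add: continuous_on_eq_continuous_at)
  then have "((\<lambda>t. g (p + t *\<^sub>R u)) \<longlongrightarrow> g p) (at 0)"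
    by (rule isCont_tendsto_compose[OF _ tendsto_line])
  then show ?thesis
    using same_jet_little_o[OF open_V p assms, of u] unfolding agree2_def
    by (auto simp: divide_inverse mult.commute)
qed

lemma agree2_\<theta>: "agree2 (\<lambda>t. \<theta>' (p + t *\<^sub>R u) v) (\<lambda>t. \<theta> (p + t *\<^sub>R u) \<bullet> v)"
  by (rule agree2_jet[OF smooth_\<theta>' Ck_on_subset[OF smooth_\<theta>_inner VN] same_jet_mono[OF jet_\<theta>]]) simp

lemma D_\<theta>_inner: "q \<in> N \<Longrightarrow> ddir a (\<lambda>q. \<theta> q \<bullet> b) q = ddir a \<theta> q \<bullet> b"
  by (rule ddir_bounded_linear[OF D_\<theta> bounded_linear_inner_left])

lemma smooth_d\<theta>: "Ck_on k (\<lambda>q. d\<theta> q a b) N"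
  unfolding d\<theta>_def by (intro Ck_on_diff Ck_on_inner smooth_D\<theta> Ck_on_const open_N)

lemma smooth_d\<theta>': "Ck_on k (\<lambda>q. d\<theta>' q a b) V"
  unfolding d\<theta>'_def by (intro Ck_on_diff open_V Ck_on_ddir[OF smooth_\<theta>'])

text \<open>One derivative is lost in passing to the exterior derivative, so second order agreement
  here draws on the third order part of \<open>jet_\<theta>\<close>.\<close>

lemma agree2_d\<theta>: "agree2 (\<lambda>t. d\<theta>' (p + t *\<^sub>R u) a b) (\<lambda>t. d\<theta> (p + t *\<^sub>R u) a b)"
proof -
  have 1: "agree2 (\<lambda>t. ddir a (\<lambda>q. \<theta>' q b) (p + t *\<^sub>R u)) (\<lambda>t. ddir a (\<lambda>q. \<theta> q \<bullet> b) (p + t *\<^sub>R u))" for a b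
  proof (intro agree2_jet Ck_on_ddir[OF smooth_\<theta>'] Ck_on_subset[OF Ck_on_ddir[OF smooth_\<theta>_inner] VN])
    have "same_jet (Suc 2) (\<lambda>q. \<theta>' q b) (\<lambda>q. \<theta> q \<bullet> b) p" using jet_\<theta>[of b] by simp
    then show "same_jet 2 (ddir a (\<lambda>q. \<theta>' q b)) (ddir a (\<lambda>q. \<theta> q \<bullet> b)) p"
      unfolding same_jet_Suc by blast
  qed
  have "agree2 (\<lambda>t. d\<theta>' (p + t *\<^sub>R u) a b)
      (\<lambda>t. ddir a (\<lambda>q. \<theta> q \<bullet> b) (p + t *\<^sub>R u) + (- 1) * ddir b (\<lambda>q. \<theta> q \<bullet> a) (p + t *\<^sub>R u))"
    using agree2_add[OF 1[of a b] agree2_mult[OF agree2_const[of "- 1"] 1[of b a]]]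
    by (simp add: d\<theta>'_def)
  moreover have "\<forall>\<^sub>F t in at 0. ddir a (\<lambda>q. \<theta> q \<bullet> b) (p + t *\<^sub>R u) +
      (- 1) * ddir b (\<lambda>q. \<theta> q \<bullet> a) (p + t *\<^sub>R u) = d\<theta> (p + t *\<^sub>R u) a b"
    using line_V[of u] unfolding eventually_at_filter
    by (rule eventually_mono) (use VN in \<open>auto simp: d\<theta>_def D_\<theta>_inner\<close>)
  ultimately show ?thesis by (rule agree2_cong)
qed

lemma agree2_H: "agree2 (\<lambda>t. H' (p + t *\<^sub>R u) a b) (\<lambda>t. H (p + t *\<^sub>R u) a b)"
  by (rule agree2_jet[OF smooth_H' Ck_on_subset[OF smooth_H VN] same_jet_mono[OF jet_H]]) simp

lemma agree2_\<Omega>: "agree2 (\<lambda>t. \<Omega>' b (p + t *\<^sub>R u) i j) (\<lambda>t. \<Omega> b (p + t *\<^sub>R u) i j)"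
  unfolding \<Omega>_def \<Omega>'_def by (intro agree2_diff agree2_mult agree2_\<theta> agree2_d\<theta>)

text \<open>The frame is chosen at p only. At nearby points its projections along w take its place,
  which avoids the construction of a moving frame.\<close>

lemma kernel_frame:
  obtains m and b :: "nat \<Rightarrow> 'e" where "m > 0" "\<And>i. i < m \<Longrightarrow> \<theta> p \<bullet> b i = 0"
    "\<And>u. \<theta> p \<bullet> u = 0 \<Longrightarrow> \<exists>c. u = (\<Sum>i<m. c i *\<^sub>R b i)"
    "\<And>c. (\<Sum>i<m. c i *\<^sub>R b i) = 0 \<Longrightarrow> \<forall>i<m. c i = 0"
proof -
  let ?P = "{u. \<theta> p \<bullet> u = 0}"
  obtain S where S: "S \<subseteq> ?P" "independent S" "?P \<subseteq> span S" "card S = dim ?P"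
    using basis_exists by blast
  have fin: "finite S" using S(2) by (rule independent_imp_finite)
  obtain b where b: "bij_betw b {..<card S} S"
    using ex_bij_betw_nat_finite[OF fin] by (auto simp: atLeast0LessThan)
  define m where "m = card S"
  have "\<theta> p \<noteq> 0" using \<theta>_w[OF pN] by auto
  \<comment> \<open>m is the dimension of the hyperplane; it will be a divisor in the expansion of
    \<lambda>.\<close>
  then have "m > 0" using S(4) DIM_ge by (simp add: m_def dim_hyperplane)
  moreover have "\<theta> p \<bullet> b i = 0" if "i < m" for i
    using S(1) b that unfolding m_def bij_betw_def by auto
  moreover have "\<exists>c. u = (\<Sum>i<m. c i *\<^sub>R b i)" if "\<theta> p \<bullet> u = 0" for u
  proof -
    have "u \<in> span S" using S(3) that by auto
    then obtain c where "u = (\<Sum>v\<in>S. c v *\<^sub>R v)"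
      using span_finite[OF fin] by auto
    then have "u = (\<Sum>i<m. c (b i) *\<^sub>R b i)"
      unfolding m_def using sum.reindex_bij_betw[OF b, of "\<lambda>v. c v *\<^sub>R v"] by simp
    then show ?thesis by (rule exI[of _ "\<lambda>i. c (b i)"])
  qed
  moreover have "\<forall>i<m. c i = 0" if "(\<Sum>i<m. c i *\<^sub>R b i) = 0" for c
  proof -
    let ?g = "\<lambda>v. c (the_inv_into {..<m} b v)"
    have inv: "the_inv_into {..<m} b (b i) = i" if "i < m" for i
      using b that unfolding m_def by (simp add: bij_betw_def the_inv_into_f_f)
    have "(\<Sum>v\<in>S. ?g v *\<^sub>R v) = (\<Sum>i<m. ?g (b i) *\<^sub>R b i)"
      unfolding m_def using sum.reindex_bij_betw[OF b, of "\<lambda>v. c (the_inv_into {..<card S} b v) *\<^sub>R v"] by simp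
    also have "\<dots> = 0" using that inv by simp
    finally have z: "(\<Sum>v\<in>S. ?g v *\<^sub>R v) = 0" .
    show ?thesis
    proof safe
      fix i assume i: "i < m"
      then have "b i \<in> S" using b unfolding m_def bij_betw_def by blast
      from independentD[OF S(2) fin subset_refl z this] show "c i = 0" by (simp add: inv[OF i])
    qed
  qed
  ultimately show ?thesis using that by blast
qed

text \<open>With \<alpha> and \<kappa> the Gram determinants of d\<theta> and H on the projected
  frame, \<open>transform\<close> says that \<alpha>/\<kappa> at F q is \<open>lam q ^ m\<close>
  times \<alpha>'/\<kappa>' at q. Up to o(t^2) the primed determinants may be replaced by \<alpha>
  and \<kappa>, and passing from q to F q moves the point by t^2/2 B(u, u) + o(t^2). Hence lam^m - 1
  starts at order t^2.\<close>

lemma lam_expansion: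
  obtains \<mu> where "linear \<mu>" "\<And>u. ((\<lambda>t. (lam (p + t *\<^sub>R u) - 1) / t\<^sup>2) \<longlongrightarrow> \<mu> (B u u)) (at 0)"
proof -
  obtain m and b :: "nat \<Rightarrow> 'e" where m: "m > 0" and b: "\<And>i. i < m \<Longrightarrow> \<theta> p \<bullet> b i = 0"
    and span: "\<And>u. \<theta> p \<bullet> u = 0 \<Longrightarrow> \<exists>c. u = (\<Sum>i<m. c i *\<^sub>R b i)"
    and indep: "\<And>c. (\<Sum>i<m. c i *\<^sub>R b i) = 0 \<Longrightarrow> \<forall>i<m. c i = 0"
    by (rule kernel_frame) (rule that)
  define \<alpha> where "\<alpha> q = gram_det m (\<Omega> b q)" for q
  define \<kappa> where "\<kappa> q = gram_det m (\<lambda>i j. H q (b i) (b j))" for q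
  define \<alpha>' where "\<alpha>' q = gram_det m (\<Omega>' b q)" for q
  define \<kappa>' where "\<kappa>' q = gram_det m (\<lambda>i j. H' q (b i) (b j))" for q
  have ker_comb: "\<theta> p \<bullet> (\<Sum>i<m. c i *\<^sub>R b i) = 0" for c
    using b by (simp add: inner_sum_right)
  have \<alpha>0: "\<alpha> p \<noteq> 0"
  proof -
    have "gram_det m (\<lambda>i j. d\<theta> p (b i) (b j)) \<noteq> 0"
    proof (rule gram_det_nonzero[OF _ indep])
      show "linear (d\<theta> p x)" for x using bilinear_d\<theta>[OF pN] by (simp add: bilinear_def)
      fix c assume c: "\<forall>i<m. d\<theta> p (b i) (\<Sum>j<m. c j *\<^sub>R b j) = 0"
      let ?z = "\<Sum>j<m. c j *\<^sub>R b j"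
      show "?z = 0"
      proof (rule nondeg[OF ker_comb])
        fix v assume "\<theta> p \<bullet> v = 0"
        then obtain a where a: "v = (\<Sum>i<m. a i *\<^sub>R b i)" using span by blast
        have lz: "linear (\<lambda>v. d\<theta> p v ?z)" using bilinear_d\<theta>[OF pN] by (simp add: bilinear_def)
        have "d\<theta> p v ?z = (\<Sum>i<m. a i * d\<theta> p (b i) ?z)"
          unfolding a linear_sum[OF lz] linear_scale[OF lz] by simp
        also have "\<dots> = 0" using c by simp
        finally show "ddir ?z \<theta> p \<bullet> v - ddir v \<theta> p \<bullet> ?z = 0" by (simp add: d\<theta>_def)
      qed
    qed
    moreover have "gram_det m (\<Omega> b p) = gram_det m (\<lambda>i j. d\<theta> p (b i) (b j))"
      by (rule gram_det_cong) (simp add: \<Omega>_def b)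
    ultimately show ?thesis by (simp add: \<alpha>_def)
  qed
  have \<kappa>0: "\<kappa> p \<noteq> 0"
    unfolding \<kappa>_def
  proof (rule gram_det_nonzero[OF _ indep])
    show "linear (H p x)" for x using bilinear_H[OF pN] by (simp add: bilinear_def)
    fix c assume c: "\<forall>i<m. H p (b i) (\<Sum>j<m. c j *\<^sub>R b j) = 0"
    let ?z = "\<Sum>j<m. c j *\<^sub>R b j"
    have lz: "linear (\<lambda>v. H p v ?z)" using bilinear_H[OF pN] by (simp add: bilinear_def)
    have "H p ?z ?z = (\<Sum>i<m. c i * H p (b i) ?z)"
      using linear_sum[OF lz, of "\<lambda>i. c i *\<^sub>R b i" "{..<m}"] by (simp add: linear_scale[OF lz])
    also have "\<dots> = 0" using c by simp
    finally show "?z = 0" using pos_H[OF ker_comb, of c] by fastforce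
  qed
  have smooth: "Ck_on 1 \<alpha> N" "Ck_on 1 \<kappa> N"
    unfolding \<alpha>_def[abs_def] \<kappa>_def[abs_def] \<Omega>_def[abs_def]
    by (intro Ck_on_gram_det Ck_on_diff Ck_on_mult open_N smooth_d\<theta> smooth_\<theta>_inner smooth_H)+
  \<comment> \<open>The vectors \<open>x i\<close>, images of the projected frame, lie in the kernel
    of \<theta> at F q. One matrix L expresses them in the projected frame there, so (det L)^2 drops
    out between d\<theta> and H. The factor \<open>lam q ^ m\<close> comes from d\<theta> alone, as
    d\<lambda> \<and> \<theta>' vanishes on the kernel of \<theta>'.\<close>
  have transform: "\<alpha> (F q) * \<kappa>' q = lam q ^ m * \<alpha>' q * \<kappa> (F q)" if q: "q \<in> V" for q
  proof -
    have FN: "F q \<in> N" using FV q by blast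
    define x where "x i = ddir (b i - \<theta>' q (b i) *\<^sub>R w) F q" for i
    let ?\<pi> = "\<lambda>v. v - (\<theta> (F q) \<bullet> v) *\<^sub>R w"
    have \<theta>x: "\<theta> (F q) \<bullet> x i = 0" for i
      unfolding x_def lam_\<theta>'[OF q]
      by (simp add: linear_diff[OF linear_\<theta>'[OF q]] linear_scale[OF linear_\<theta>'[OF q]] \<theta>'_w[OF q])
    \<comment> \<open>The decomposition known at p is reused at F q: \<open>x i\<close> is a
      combination of the \<open>b k\<close> plus a multiple of w, while \<open>?\<pi>\<close> fixes
      \<open>x i\<close> and kills w.\<close>
    have "\<exists>c. x i = (\<Sum>k<m. c k *\<^sub>R ?\<pi> (b k))" for i
    proof -
      have "\<theta> p \<bullet> (x i - (\<theta> p \<bullet> x i) *\<^sub>R w) = 0"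
        using \<theta>_w[OF pN] by (simp add: inner_diff_right)
      then obtain c where "x i - (\<theta> p \<bullet> x i) *\<^sub>R w = (\<Sum>k<m. c k *\<^sub>R b k)" using span by blast
      then have xi: "x i = (\<Sum>k<m. c k *\<^sub>R b k) + (\<theta> p \<bullet> x i) *\<^sub>R w" by (simp add: algebra_simps)
      have lin: "linear ?\<pi>"
        by (intro linearI) (simp_all add: inner_add_right algebra_simps)
      have "x i = ?\<pi> (x i)" using \<theta>x by simp
      also have "\<dots> = ?\<pi> ((\<Sum>k<m. c k *\<^sub>R b k) + (\<theta> p \<bullet> x i) *\<^sub>R w)" using xi by simp
      also have "\<dots> = (\<Sum>k<m. c k *\<^sub>R ?\<pi> (b k)) + (\<theta> p \<bullet> x i) *\<^sub>R ?\<pi> w"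
        unfolding linear_add[OF lin] linear_sum[OF lin] linear_scale[OF lin] ..
      also have "?\<pi> w = 0" using \<theta>_w[OF FN] by simp
      finally show ?thesis by auto
    qed
    then have "\<exists>c. \<forall>i. x i = (\<Sum>k<m. c i k *\<^sub>R ?\<pi> (b k))" by (intro choice allI)
    then obtain c where c: "\<And>i. x i = (\<Sum>k<m. c i k *\<^sub>R ?\<pi> (b k))" by blast
    define L where "L k i = c i k" for k i
    have L: "x i = (\<Sum>k<m. L k i *\<^sub>R ?\<pi> (b k))" for i
      unfolding L_def by (rule c)
    have expand: "Q (x i) (x j) = (\<Sum>k<m. \<Sum>l<m. L k i * L l j * Q (?\<pi> (b k)) (?\<pi> (b l)))"
      if "bilinear Q" for Q :: "'e \<Rightarrow> 'e \<Rightarrow> real" and i j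
    proof -
      have "Q (x i) (x j) = (\<Sum>(k, l)\<in>{..<m} \<times> {..<m}. Q (L k i *\<^sub>R ?\<pi> (b k)) (L l j *\<^sub>R ?\<pi> (b l)))"
        unfolding L[of i] L[of j] by (rule bilinear_sum[OF that])
      then show ?thesis
        by (simp only: sum.cartesian_product[symmetric] bilinear_lmul[OF that] bilinear_rmul[OF that]
            real_scaleR_def mult_ac)
    qed
    have "gram_det m (\<lambda>i j. lam q * \<Omega>' b q i j) = (gram_det m L)\<^sup>2 * \<alpha> (F q)"
      unfolding \<alpha>_def
    proof (rule gram_det_congruence)
      fix i j
      have "lam q * \<Omega>' b q i j = d\<theta> (F q) (x i) (x j)"
        unfolding x_def d_pullback[OF q] \<Omega>'_proj[OF q]
        by (simp add: linear_diff[OF linear_\<theta>'[OF q]] linear_scale[OF linear_\<theta>'[OF q]] \<theta>'_w[OF q])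
      then show "lam q * \<Omega>' b q i j = (\<Sum>k<m. \<Sum>l<m. L k i * L l j * \<Omega> b (F q) k l)"
        unfolding \<Omega>_proj[OF FN] expand[OF bilinear_d\<theta>[OF FN]] .
    qed
    then have 1: "lam q ^ m * \<alpha>' q = (gram_det m L)\<^sup>2 * \<alpha> (F q)"
      by (simp add: gram_det_scale \<alpha>'_def)
    have 2: "\<kappa>' q = (gram_det m L)\<^sup>2 * \<kappa> (F q)"
      unfolding \<kappa>_def \<kappa>'_def
    proof (rule gram_det_congruence)
      fix i j
      have "H' q (b i) (b j) = H (F q) (x i) (x j)" by (simp add: x_def H'_def)
      then show "H' q (b i) (b j) = (\<Sum>k<m. \<Sum>l<m. L k i * L l j * H (F q) (b k) (b l))"
        unfolding expand[OF bilinear_H[OF FN]] H_proj[OF FN] .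
    qed
    show ?thesis using 1 2 by simp
  qed
  \<comment> \<open>The logarithmic derivative of \<alpha>/\<kappa> along z/2, divided by m because
    lam^m - 1 behaves like m (lam - 1).\<close>
  define \<mu> where "\<mu> z = (ddir ((1/2) *\<^sub>R z) \<alpha> p / \<alpha> p - ddir ((1/2) *\<^sub>R z) \<kappa> p / \<kappa> p) / m" for z
  have D: "(\<alpha> has_derivative (\<lambda>v. ddir v \<alpha> p)) (at p)" "(\<kappa> has_derivative (\<lambda>v. ddir v \<kappa> p)) (at p)"
    by (rule Ck_on_differentiable[OF smooth(1)[unfolded One_nat_def] open_N pN],
        rule Ck_on_differentiable[OF smooth(2)[unfolded One_nat_def] open_N pN])
  have "linear \<mu>"
    unfolding \<mu>_def
    by (intro linearI) (simp_all add: ddir_add[OF D(1)] ddir_add[OF D(2)] ddir_scaleR[OF D(1)]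
        ddir_scaleR[OF D(2)] scaleR_add_right add_divide_distrib diff_divide_distrib
        right_diff_distrib)
  moreover have "((\<lambda>t. (lam (p + t *\<^sub>R u) - 1) / t\<^sup>2) \<longlongrightarrow> \<mu> (B u u)) (at 0)" for u
  proof -
    let ?q = "\<lambda>t. p + t *\<^sub>R u"
    have lim_cont: "((\<lambda>t. g (?q t)) \<longlongrightarrow> g p) (at 0)" if "Ck_on 1 g V" for g :: "'e \<Rightarrow> real"
      by (rule isCont_tendsto_compose[OF _ tendsto_line])
         (use Ck_on_continuous[OF that] open_V p in \<open>simp add: continuous_on_eq_continuous_at\<close>)
    have lim_F: "((\<lambda>t. F (?q t)) \<longlongrightarrow> p) (at 0)"
    proof -
      have "isCont F p"
        using Ck_on_continuous[OF smooth_F] open_V p by (simp add: continuous_on_eq_continuous_at)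
      from isCont_tendsto_compose[OF this tendsto_line] show ?thesis by (simp add: Fp)
    qed
    have F2: "((\<lambda>t. (F (?q t) - ?q t) /\<^sub>R t\<^sup>2) \<longlongrightarrow> (1/2) *\<^sub>R B u u) (at 0)"
      using Ck_on_Taylor2[OF smooth_F open_V p, of u] by (simp add: Fp DF B_def diff_diff_eq)
    have comp: "((\<lambda>t. (g (F (?q t)) - g (?q t)) / t\<^sup>2) \<longlongrightarrow> ddir ((1/2) *\<^sub>R B u u) g p) (at 0)"
      if "Ck_on 1 g N" for g :: "'e \<Rightarrow> real"
      using Ck_on_tendsto_quotient2[OF that open_N pN lim_F tendsto_line F2]
      unfolding real_scaleR_def divide_inverse by (simp only: mult.commute)
    have \<alpha>': "agree2 (\<lambda>t. \<alpha>' (?q t)) (\<lambda>t. \<alpha> (?q t))"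
      unfolding \<alpha>_def \<alpha>'_def by (intro agree2_gram_det agree2_\<Omega>)
    have \<kappa>': "agree2 (\<lambda>t. \<kappa>' (?q t)) (\<lambda>t. \<kappa> (?q t))"
      unfolding \<kappa>_def \<kappa>'_def by (intro agree2_gram_det agree2_H)
    have la: "((\<lambda>t. \<alpha> (?q t)) \<longlongrightarrow> \<alpha> p) (at 0)" "((\<lambda>t. \<kappa> (?q t)) \<longlongrightarrow> \<kappa> p) (at 0)"
      by (rule lim_cont[OF Ck_on_subset[OF smooth(1) VN]], rule lim_cont[OF Ck_on_subset[OF smooth(2) VN]])
    have la': "((\<lambda>t. \<alpha>' (?q t)) \<longlongrightarrow> \<alpha> p) (at 0)" "((\<lambda>t. \<kappa>' (?q t)) \<longlongrightarrow> \<kappa> p) (at 0)"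
      using agree2_tendsto[OF \<alpha>' la(1)] agree2_tendsto[OF \<kappa>' la(2)] .
    have laF: "((\<lambda>t. \<kappa> (F (?q t))) \<longlongrightarrow> \<kappa> p) (at 0)"
    proof -
      have "isCont \<kappa> p"
        using Ck_on_continuous[OF smooth(2)] open_N pN by (simp add: continuous_on_eq_continuous_at)
      from isCont_tendsto_compose[OF this lim_F] show ?thesis .
    qed
    have z: "((\<lambda>t. (\<alpha>' (?q t) - \<alpha> (?q t)) / t\<^sup>2) \<longlongrightarrow> 0) (at 0)"
      "((\<lambda>t. (\<kappa>' (?q t) - \<kappa> (?q t)) / t\<^sup>2) \<longlongrightarrow> 0) (at 0)"
      using \<alpha>' \<kappa>' by (simp_all add: agree2_def)
    have l_lam: "((\<lambda>t. lam (?q t)) \<longlongrightarrow> 1) (at 0)"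
      using lim_cont[OF smooth_lam] by (simp add: lam_p)
    \<comment> \<open>The geometric sum in \<open>?S\<close> isolates lam - 1 from lam^m - 1.
      \<open>?T\<close> is (\<alpha>(F q) \<kappa>'(q) - \<alpha>'(q) \<kappa>(F q)) / t^2,
      telescoped into differences whose quotients by t^2 converge.\<close>
    let ?S = "\<lambda>t. (\<Sum>i<m. lam (?q t) ^ i) * \<alpha>' (?q t) * \<kappa> (F (?q t))"
    let ?T = "\<lambda>t. (\<alpha> (F (?q t)) - \<alpha> (?q t)) / t\<^sup>2 * \<kappa>' (?q t)
        + \<alpha> (?q t) * ((\<kappa>' (?q t) - \<kappa> (?q t)) / t\<^sup>2)
        - (\<alpha>' (?q t) - \<alpha> (?q t)) / t\<^sup>2 * \<kappa> (?q t)
        - \<alpha>' (?q t) * ((\<kappa> (F (?q t)) - \<kappa> (?q t)) / t\<^sup>2)"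
    have "(?S \<longlongrightarrow> (\<Sum>i<m. 1 ^ i) * \<alpha> p * \<kappa> p) (at 0)"
      by (intro tendsto_intros l_lam la' laF)
    then have S: "(?S \<longlongrightarrow> m * \<alpha> p * \<kappa> p) (at 0)" by simp
    have T: "(?T \<longlongrightarrow> ddir ((1/2) *\<^sub>R B u u) \<alpha> p * \<kappa> p + \<alpha> p * 0 - 0 * \<kappa> p
        - \<alpha> p * ddir ((1/2) *\<^sub>R B u u) \<kappa> p) (at 0)"
      by (intro tendsto_intros comp smooth la la' z)
    have nz: "m * \<alpha> p * \<kappa> p \<noteq> 0" using m \<alpha>0 \<kappa>0 by simp
    have lim: "((\<lambda>t. ?T t / ?S t) \<longlongrightarrow> (ddir ((1/2) *\<^sub>R B u u) \<alpha> p * \<kappa> p + \<alpha> p * 0 - 0 * \<kappa> p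
        - \<alpha> p * ddir ((1/2) *\<^sub>R B u u) \<kappa> p) / (m * \<alpha> p * \<kappa> p)) (at 0)"
      by (rule tendsto_divide[OF T S nz])
    have val: "(ddir ((1/2) *\<^sub>R B u u) \<alpha> p * \<kappa> p + \<alpha> p * 0 - 0 * \<kappa> p
        - \<alpha> p * ddir ((1/2) *\<^sub>R B u u) \<kappa> p) / (m * \<alpha> p * \<kappa> p) = \<mu> (B u u)"
      unfolding \<mu>_def using m \<alpha>0 \<kappa>0 by (simp add: field_simps)
    have "\<forall>\<^sub>F t in at 0. ?S t \<noteq> 0"
      by (rule tendsto_imp_eventually_ne[OF S nz])
    moreover have "\<forall>\<^sub>F t in at 0. ?q t \<in> V"
      using line_V[of u] by (simp add: eventually_at_filter eventually_mono)
    ultimately have "\<forall>\<^sub>F t in at 0. ?T t / ?S t = (lam (?q t) - 1) / t\<^sup>2"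
    proof eventually_elim
      case (elim t)
      have geo: "(lam (?q t) - 1) * (\<Sum>i<m. lam (?q t) ^ i) = lam (?q t) ^ m - 1"
        by (rule power_diff_1_eq[symmetric])
      have "?T t = (\<alpha> (F (?q t)) * \<kappa>' (?q t) - \<alpha>' (?q t) * \<kappa> (F (?q t))) / t\<^sup>2"
        by (simp add: add_divide_distrib[symmetric] diff_divide_distrib[symmetric] algebra_simps)
      also have "\<dots> = (lam (?q t) ^ m - 1) * \<alpha>' (?q t) * \<kappa> (F (?q t)) / t\<^sup>2"
        unfolding transform[OF elim(2)] by (simp add: algebra_simps)
      also have "\<dots> = (lam (?q t) - 1) / t\<^sup>2 * ?S t"
        unfolding geo[symmetric] by (simp add: mult_ac)
      finally have T: "?T t = (lam (?q t) - 1) / t\<^sup>2 * ?S t" .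
      show ?case unfolding T by (rule nonzero_mult_div_cancel_right) (rule elim(1))
    qed
    then show ?thesis using lim unfolding val by (rule Lim_transform_eventually[rotated])
  qed
  ultimately show ?thesis using that by blast
qed

text \<open>A finite limit of (lam - 1)/t^2 excludes a linear term. The Taylor formula then gives
  the second derivative on the diagonal, and polarisation the rest, both sides being
  symmetric.\<close>

lemma lam_two_jet:
  obtains \<mu> where "linear \<mu>" "\<And>u. ddir u lam p = 0" "\<And>u v. ddir u (ddir v lam) p = \<mu> (B u v)"
proof -
  obtain \<mu> where \<mu>: "linear \<mu>" "\<And>u. ((\<lambda>t. (lam (p + t *\<^sub>R u) - 1) / t\<^sup>2) \<longlongrightarrow> \<mu> (B u u)) (at 0)"
    by (rule lam_expansion) (rule that)
  have taylor: "((\<lambda>t. (lam (p + t *\<^sub>R u) - 1 - t * ddir u lam p) / t\<^sup>2) \<longlongrightarrow>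
      1 / 2 * ddir u (ddir u lam) p) (at 0)" for u
    using Ck_on_Taylor2[OF smooth_lam open_V p, of u]
    unfolding lam_p real_scaleR_def divide_inverse by (simp only: mult.commute)
  have first: "ddir u lam p = 0" for u
  proof -
    have "((\<lambda>t. (lam (p + t *\<^sub>R u) - 1) / t\<^sup>2 * t - (lam (p + t *\<^sub>R u) - 1 - t * ddir u lam p) / t\<^sup>2 * t)
        \<longlongrightarrow> \<mu> (B u u) * 0 - 1 / 2 * ddir u (ddir u lam) p * 0) (at 0)"
      by (intro tendsto_intros \<mu>(2) taylor)
    moreover have "\<forall>\<^sub>F t in at 0. (lam (p + t *\<^sub>R u) - 1) / t\<^sup>2 * t
        - (lam (p + t *\<^sub>R u) - 1 - t * ddir u lam p) / t\<^sup>2 * t = ddir u lam p"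
      by (simp add: eventually_at_filter field_simps power2_eq_square)
    ultimately have "((\<lambda>t::real. ddir u lam p) \<longlongrightarrow> 0) (at 0)"
      by (auto elim: Lim_transform_eventually)
    then show ?thesis by (simp add: tendsto_const_iff)
  qed
  have diag: "ddir u (ddir u lam) p = 2 * \<mu> (B u u)" for u
    using tendsto_unique[OF _ taylor[of u]] \<mu>(2)[of u] by (simp add: first)
  have C: "Ck_on (Suc 0) (ddir v lam) V" for v
    by (rule Ck_on_ddir[OF smooth_lam])
  note D = Ck_on_differentiable[OF C open_V p]
  have add2: "ddir u (ddir (v + v') lam) p = ddir u (ddir v lam) p + ddir u (ddir v' lam) p" for u v v'
    using ddir_commute_real[OF smooth_lam open_V p] ddir_add[OF D] by metis
  have "ddir u (ddir v lam) p = 2 * \<mu> (B u v)" for u v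
  proof -
    have "ddir (u + v) (ddir (u + v) lam) p =
        ddir u (ddir u lam) p + 2 * ddir u (ddir v lam) p + ddir v (ddir v lam) p"
      unfolding add2 ddir_add[OF D] ddir_commute_real[OF smooth_lam open_V p, of v u] by simp
    moreover have "\<mu> (B (u + v) (u + v)) = \<mu> (B u u) + 2 * \<mu> (B u v) + \<mu> (B v v)"
      unfolding bilinear_ladd[OF bilinear_B] bilinear_radd[OF bilinear_B] linear_add[OF \<mu>(1)]
      by (simp add: B_sym[of v u])
    ultimately show ?thesis by (simp add: diag)
  qed
  \<comment> \<open>The factor 2 left by the Taylor formula is absorbed into the linear
    form.\<close>
  then have "ddir u (ddir v lam) p = \<mu> (2 *\<^sub>R B u v)" for u v by (simp add: linear_scale[OF \<mu>(1)])
  moreover have "linear (\<lambda>z. \<mu> (2 *\<^sub>R z))"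
    by (intro linearI) (simp_all add: linear_add[OF \<mu>(1)] linear_scale[OF \<mu>(1)] scaleR_add_right)
  ultimately show ?thesis using that[of "\<lambda>z. \<mu> (2 *\<^sub>R z)"] first by blast
qed

lemma \<theta>_B_0: "\<theta> p \<bullet> B u v = 0"
proof -
  obtain \<mu> where "linear \<mu>" and first: "\<And>u. ddir u lam p = 0"
    and "\<And>u v. ddir u (ddir v lam) p = \<mu> (B u v)"
    by (rule lam_two_jet) (rule that)
  show ?thesis by (simp only: \<theta>_B first mult_zero_left)
qed

text \<open>As in the uniqueness of the Levi-Civita connection: a trilinear form that is symmetric in two
  arguments and skew in two others vanishes.\<close>

lemma B_ker:
  assumes "\<theta> p \<bullet> a = 0" "\<theta> p \<bullet> b = 0"
  shows "B a b = 0"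
proof -
  let ?z = "B a b"
  have skew: "H p (B u x) y = - H p (B u y) x" if "\<theta> p \<bullet> x = 0" "\<theta> p \<bullet> y = 0" for u x y
    using H_B_skew[OF that, of u] sym_H[OF pN, of x "B u y"] by simp
  have z: "\<theta> p \<bullet> ?z = 0" by (rule \<theta>_B_0)
  have "H p (B a b) ?z = - H p (B ?z a) b" using skew[OF assms(2) z, of a] B_sym[of a ?z] by simp
  also have "\<dots> = H p (B b ?z) a" using skew[OF assms(1,2), of ?z] B_sym[of b ?z] by simp
  also have "\<dots> = - H p (B a b) ?z" using skew[OF z assms(1), of b] B_sym[of a b] by simp
  finally have 0: "H p ?z ?z = 0" by simp
  show ?thesis
  proof (rule ccontr)
    assume "?z \<noteq> 0"
    from pos_H[OF z this] 0 show False by simp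
  qed
qed

text \<open>Derivative of \<open>d_pullback\<close> at p in direction u. As d\<lambda> vanishes at
  p, only second derivatives of \<lambda> survive from its terms, and the derivatives of d\<theta>
  and d\<theta>' at fixed arguments cancel because the 2-jets of the forms agree.\<close>

lemma d\<theta>_B:
  "d\<theta> p (B u a) b + d\<theta> p a (B u b) =
    ddir u (ddir a lam) p * (\<theta> p \<bullet> b) - ddir u (ddir b lam) p * (\<theta> p \<bullet> a)"
proof -
  obtain \<mu> where first: "\<And>u. ddir u lam p = 0" and "\<And>u v. ddir u (ddir v lam) p = \<mu> (B u v)"
    by (rule lam_two_jet) (rule that)
  let ?q = "\<lambda>t. p + t *\<^sub>R u"
  have line: "((\<lambda>t. f (?q t)) has_real_derivative ddir u f p) (at 0)"
    if "\<And>k. Ck_on k f V" for f :: "'e \<Rightarrow> real"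
    unfolding has_real_derivative_iff_has_vector_derivative
    using Ck_on_differentiable[OF that open_V p] by (intro has_vector_derivative_line) simp
  have "\<forall>\<^sub>F t in nhds 0. bilinear (d\<theta> (F (?q t)))"
    using line_V[of u] by (rule eventually_mono) (use FV in \<open>auto intro: bilinear_d\<theta>\<close>)
  from has_real_derivative_bilinear_family[OF this D_comp_F_line[OF smooth_d\<theta>] D_F_line D_F_line]
  have 1: "((\<lambda>t. d\<theta> (F (?q t)) (ddir a F (?q t)) (ddir b F (?q t))) has_real_derivative
      ddir u (\<lambda>q. d\<theta> q a b) p + d\<theta> p (B u a) b + d\<theta> p a (B u b)) (at 0)"
    by (simp add: Fp DF)
  have prod: "((\<lambda>t. f (?q t) * g (?q t)) has_real_derivative ddir u f p * g p + ddir u g p * f p) (at 0)"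
    if "\<And>k. Ck_on k f V" "\<And>k. Ck_on k g V" for f g :: "'e \<Rightarrow> real"
    using DERIV_mult[OF line[OF that(1)] line[OF that(2)]] by simp
  have "((\<lambda>t. ddir a lam (?q t) * \<theta>' (?q t) b - ddir b lam (?q t) * \<theta>' (?q t) a
      + lam (?q t) * d\<theta>' (?q t) a b) has_real_derivative
      ddir u (ddir a lam) p * (\<theta> p \<bullet> b) - ddir u (ddir b lam) p * (\<theta> p \<bullet> a)
      + ddir u (\<lambda>q. d\<theta>' q a b) p) (at 0)"
    using DERIV_add[OF DERIV_diff[OF prod[OF Ck_on_ddir[OF smooth_lam] smooth_\<theta>'[of _ b]]
          prod[OF Ck_on_ddir[OF smooth_lam] smooth_\<theta>'[of _ a]]] prod[OF smooth_lam smooth_d\<theta>'[of _ a b]],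
          of a b]
    by (simp add: first lam_p \<theta>'_p)
  moreover have "\<forall>\<^sub>F t in nhds 0. ddir a lam (?q t) * \<theta>' (?q t) b - ddir b lam (?q t) * \<theta>' (?q t) a
      + lam (?q t) * d\<theta>' (?q t) a b = d\<theta> (F (?q t)) (ddir a F (?q t)) (ddir b F (?q t))"
    using line_V[of u] by (rule eventually_mono) (simp add: d_pullback)
  ultimately have 2: "((\<lambda>t. d\<theta> (F (?q t)) (ddir a F (?q t)) (ddir b F (?q t))) has_real_derivative
      ddir u (ddir a lam) p * (\<theta> p \<bullet> b) - ddir u (ddir b lam) p * (\<theta> p \<bullet> a)
      + ddir u (\<lambda>q. d\<theta>' q a b) p) (at 0)"
    by (subst (asm) DERIV_cong_ev[OF refl _ refl])
  have "ddir u (\<lambda>q. d\<theta>' q a b) p = ddir u (\<lambda>q. d\<theta> q a b) p"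
  proof -
    have jet: "ddir u (ddir a (\<lambda>q. \<theta>' q b)) p = ddir u (ddir a (\<lambda>q. \<theta> q \<bullet> b)) p" for a b
      using jet_\<theta>[of b, unfolded same_jet_def, rule_format, of "[a, u]"] by simp
    have D': "(ddir a (\<lambda>q. \<theta>' q b) has_derivative (\<lambda>u. ddir u (ddir a (\<lambda>q. \<theta>' q b)) p)) (at p)"
      and D: "(ddir a (\<lambda>q. \<theta> q \<bullet> b) has_derivative (\<lambda>u. ddir u (ddir a (\<lambda>q. \<theta> q \<bullet> b)) p)) (at p)" for a b
      by (rule Ck_on_differentiable[OF Ck_on_ddir[OF smooth_\<theta>'] open_V p],
          rule Ck_on_differentiable[OF Ck_on_ddir[OF smooth_\<theta>_inner] open_N pN])
    have "ddir u (\<lambda>q. d\<theta> q a b) p =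
        ddir u (\<lambda>q. ddir a (\<lambda>q. \<theta> q \<bullet> b) q - ddir b (\<lambda>q. \<theta> q \<bullet> a) q) p"
      by (rule ddir_cong_open[OF open_N pN]) (simp add: d\<theta>_def D_\<theta>_inner)
    then show ?thesis
      using ddir_eqI[OF has_derivative_diff[OF D'[of a b] D'[of b a]], of u]
        ddir_eqI[OF has_derivative_diff[OF D[of a b] D[of b a]], of u]
      by (simp add: d\<theta>'_def jet)
  qed
  then show ?thesis using DERIV_unique[OF 1 2] by simp
qed

lemma second_derivative_zero: "ddir u (ddir v F) p = 0"
proof -
  obtain \<mu> where \<mu>: "linear \<mu>" "\<And>u. ddir u lam p = 0" "\<And>u v. ddir u (ddir v lam) p = \<mu> (B u v)"
    by (rule lam_two_jet) (rule that)
  have \<theta>w: "\<theta> p \<bullet> w = 1" by (rule \<theta>_w[OF pN])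
  have zero: "d\<theta> p 0 x = 0" "d\<theta> p x 0 = 0" for x
    by (simp_all add: bilinear_lzero[OF bilinear_d\<theta>[OF pN]] bilinear_rzero[OF bilinear_d\<theta>[OF pN]])
  \<comment> \<open>In \<open>d\<theta>_B\<close> at (w, v) the assumption on u removes both the
    second term on the left and, through \<mu>, the right-hand side.\<close>
  have step: "B u w = 0" if "\<And>v. \<theta> p \<bullet> v = 0 \<Longrightarrow> B u v = 0" for u
  proof (rule nondeg[OF \<theta>_B_0])
    fix v assume v: "\<theta> p \<bullet> v = 0"
    have "d\<theta> p (B u w) v = 0"
      using d\<theta>_B[of u w v] v by (simp add: that[OF v] \<mu>(3) linear_0[OF \<mu>(1)] zero)
    then show "ddir (B u w) \<theta> p \<bullet> v - ddir v \<theta> p \<bullet> B u w = 0" by (simp add: d\<theta>_def)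
  qed
  have ker_w: "B u w = 0" if "\<theta> p \<bullet> u = 0" for u
    using B_ker[OF that] by (intro step)
  have ww: "B w w = 0"
    using ker_w B_sym by (intro step) metis
  have split: "x = (x - (\<theta> p \<bullet> x) *\<^sub>R w) + (\<theta> p \<bullet> x) *\<^sub>R w" "\<theta> p \<bullet> (x - (\<theta> p \<bullet> x) *\<^sub>R w) = 0" for x
    by (simp_all add: inner_diff_right \<theta>w)
  let ?k = "\<lambda>x. x - (\<theta> p \<bullet> x) *\<^sub>R w"
  have "B u v = B (?k u + (\<theta> p \<bullet> u) *\<^sub>R w) (?k v + (\<theta> p \<bullet> v) *\<^sub>R w)" by simp
  also have "\<dots> = B (?k u) (?k v) + (\<theta> p \<bullet> v) *\<^sub>R B (?k u) w
      + (\<theta> p \<bullet> u) *\<^sub>R B w (?k v) + (\<theta> p \<bullet> u) *\<^sub>R (\<theta> p \<bullet> v) *\<^sub>R B w w"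
    unfolding bilinear_ladd[OF bilinear_B] bilinear_radd[OF bilinear_B]
      bilinear_lmul[OF bilinear_B] bilinear_rmul[OF bilinear_B]
    by (simp add: scaleR_add_right mult.commute)
  also have "\<dots> = 0"
    unfolding B_ker[OF split(2) split(2)] ker_w[OF split(2)] ww B_sym[of w "?k v"] by simp
  finally show ?thesis by (simp add: B_def)
qed

end

section \<open>Nondegeneracy of contact forms\<close>

text \<open>Only the linearity in each of the first \<open>n\<close> arguments and the independence of the others are
  used here; the functions need not be alternating.\<close>

definition multilinear_form :: "nat \<Rightarrow> 'e::real_vector form \<Rightarrow> bool" where
  "multilinear_form n \<Phi> \<longleftrightarrow>
    (\<forall>v i. i < n \<longrightarrow> linear (\<lambda>x. \<Phi> (v(i := x)))) \<and> (\<forall>v i x. i \<ge> n \<longrightarrow> \<Phi> (v(i := x)) = \<Phi> v)"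

text \<open>Summand by summand: changing argument i of v changes argument \<pi>^-1(i) of the
  permuted tuple, which belongs to \<alpha> when it is below k and otherwise to \<beta>, at a
  position lowered by k.\<close>

lemma multilinear_form_wedge:
  fixes \<alpha> \<beta> :: "'e::real_vector form"
  assumes "multilinear_form k \<alpha>" "multilinear_form l \<beta>"
  shows "multilinear_form (k + l) (wedge k l \<alpha> \<beta>)"
proof -
  define K where "K u = \<alpha> u * \<beta> (\<lambda>i. u (k + i))" for u
  define T where "T \<pi> v = K (\<lambda>i. v (\<pi> i))"
    for \<pi> :: "nat \<Rightarrow> nat" and v :: "nat \<Rightarrow> 'e"
  have wedge: "wedge k l \<alpha> \<beta> v =
      (\<Sum>\<pi> | \<pi> permutes {..<k + l}. of_int (sign \<pi>) * T \<pi> v) / (fact k * fact l)" for v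
    by (simp add: wedge_def T_def K_def mult.assoc)
  have upd: "T \<pi> (v(i := x)) = \<alpha> ((\<lambda>j. v (\<pi> j))(inv_into UNIV \<pi> i := x)) *
      \<beta> (\<lambda>j. ((\<lambda>j. v (\<pi> j))(inv_into UNIV \<pi> i := x)) (k + j))" if "\<pi> permutes {..<k + l}" for \<pi> v i x
  proof -
    have "(\<lambda>j. (v(i := x)) (\<pi> j)) = (\<lambda>j. v (\<pi> j))(inv_into UNIV \<pi> i := x)"
      using permutes_inverses[OF that] by (auto simp: fun_eq_iff)
    then show ?thesis unfolding T_def by (simp only: K_def)
  qed
  have shift: "(\<lambda>j. (u(t := x)) (k + j)) = (\<lambda>j. u (k + j))(t - k := x)" if "t \<ge> k" for u :: "nat \<Rightarrow> 'e" and t x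
    using that by (auto simp: fun_eq_iff)
  have noshift: "(\<lambda>j. (u(t := x)) (k + j)) = (\<lambda>j. u (k + j))" if "t < k" for u :: "nat \<Rightarrow> 'e" and t x
    using that by (auto simp: fun_eq_iff)
  have lin: "linear (\<lambda>x. T \<pi> (v(i := x)))" if \<pi>: "\<pi> permutes {..<k + l}" and i: "i < k + l" for \<pi> v i
  proof -
    let ?t = "inv_into UNIV \<pi> i" and ?u = "\<lambda>j. v (\<pi> j)"
    have t: "?t < k + l" using i permutes_in_image[OF permutes_inv[OF \<pi>], of i] by simp
    show ?thesis
    proof (cases "?t < k")
      case True
      have "linear (\<lambda>x. \<alpha> (?u(?t := x)))" using assms(1) True by (simp add: multilinear_form_def)
      from linear_compose_scale_right[OF this, of "\<beta> (\<lambda>j. ?u (k + j))"] show ?thesis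
        unfolding upd[OF \<pi>] noshift[OF True] by (simp add: mult.commute)
    next
      case False
      have "linear (\<lambda>x. \<beta> ((\<lambda>j. ?u (k + j))(?t - k := x)))"
        using assms(2) False t by (simp add: multilinear_form_def)
      moreover have "\<alpha> (?u(?t := x)) = \<alpha> ?u" for x
        using assms(1) False by (simp add: multilinear_form_def)
      moreover have "?t \<ge> k" using False by simp
      ultimately show ?thesis
        unfolding upd[OF \<pi>] shift[OF \<open>?t \<ge> k\<close>] 
        using linear_compose_scale_right[of "\<lambda>x. \<beta> ((\<lambda>j. ?u (k + j))(?t - k := x))" "\<alpha> ?u"] by simp
    qed
  qed
  have "linear (\<lambda>x. wedge k l \<alpha> \<beta> (v(i := x)))" if "i < k + l" for v i
    unfolding wedge
    by (intro linearI) (simp_all add: linear_add[OF lin[OF _ that]] linear_scale[OF lin[OF _ that]]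
        sum.distrib add_divide_distrib sum_distrib_left distrib_left mult_ac)
  moreover have "wedge k l \<alpha> \<beta> (v(i := x)) = wedge k l \<alpha> \<beta> v" if "i \<ge> k + l" for v i x
  proof -
    have "T \<pi> (v(i := x)) = T \<pi> v" if \<pi>: "\<pi> permutes {..<k + l}" for \<pi>
    proof -
      have "\<pi> i = i" using \<pi> \<open>i \<ge> k + l\<close> by (simp add: permutes_def)
      then have t: "inv_into UNIV \<pi> i = i" using permutes_inverses(2)[OF \<pi>, of i] by simp
      have k: "k \<le> i" "\<not> i - k < l" using \<open>i \<ge> k + l\<close> by auto
      show ?thesis
        unfolding upd[OF \<pi>] t shift[OF k(1)] using assms k by (simp add: multilinear_form_def T_def K_def)
    qed
    then show ?thesis unfolding wedge by simp
  qed
  ultimately show ?thesis by (simp add: multilinear_form_def)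
qed

lemma multilinear_form_wedge_power:
  "multilinear_form k \<alpha> \<Longrightarrow> multilinear_form (k * j) (wedge_power k \<alpha> j)"
proof (induction j)
  case 0
  then show ?case by (simp add: multilinear_form_def)
next
  case (Suc j)
  then show ?case using multilinear_form_wedge by simp
qed

text \<open>Composing every permutation with the transposition of i and j leaves the arguments
  unchanged but reverses all signs, so the sum equals its own negative.\<close>

lemma wedge_repeated_0:
  fixes \<alpha> \<beta> :: "'e form"
  assumes "i < k + l" "j < k + l" "i \<noteq> j" "v i = v j"
  shows "wedge k l \<alpha> \<beta> v = 0"
proof -
  let ?\<tau> = "Transposition.transpose i j"
  define K where "K u = \<alpha> (\<lambda>i. u i) * \<beta> (\<lambda>i. u (k + i))" for u
  define S where "S = (\<Sum>\<pi> | \<pi> permutes {..<k + l}. of_int (sign \<pi>) * K (v \<circ> \<pi>))"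
  have \<tau>: "?\<tau> permutes {..<k + l}" using assms by (intro permutes_swap_id) auto
  have v: "v \<circ> ?\<tau> = v" using assms(4) by (auto simp: fun_eq_iff Transposition.transpose_def)
  have "S = (\<Sum>\<pi> | \<pi> permutes {..<k + l}. of_int (sign (?\<tau> \<circ> \<pi>)) * K (v \<circ> (?\<tau> \<circ> \<pi>)))"
    unfolding S_def by (rule setum_permutations_compose_left[OF \<tau>])
  also have "\<dots> = (\<Sum>\<pi> | \<pi> permutes {..<k + l}. - (of_int (sign \<pi>) * K (v \<circ> \<pi>)))"
  proof (rule sum.cong[OF refl])
    fix \<pi> assume "\<pi> \<in> {\<pi>. \<pi> permutes {..<k + l}}"
    then have "permutation \<pi>" using permutation_permutes by blast
    then have "sign (?\<tau> \<circ> \<pi>) = - sign \<pi>"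
      using assms(3) by (simp add: sign_compose sign_swap_id permutation_swap_id)
    then show "of_int (sign (?\<tau> \<circ> \<pi>)) * K (v \<circ> (?\<tau> \<circ> \<pi>)) = - (of_int (sign \<pi>) * K (v \<circ> \<pi>))"
      by (simp add: o_assoc v)
  qed
  also have "\<dots> = - S" by (simp add: S_def sum_negf)
  finally have "S = 0" by simp
  then show ?thesis by (simp add: wedge_def S_def K_def o_def mult.assoc)
qed

text \<open>Arguments are freed from E one at a time, since a linear map that vanishes on E vanishes
  on its span.\<close>

lemma multilinear_form_zeroI:
  assumes "multilinear_form n \<Phi>" "span E = UNIV"
    and "\<And>v. (\<forall>i<n. v i \<in> E) \<Longrightarrow> \<Phi> v = 0"
  shows "\<Phi> v = 0"
proof -
  have "\<Phi> v = 0" if "m \<le> n" "\<forall>i. m \<le> i \<and> i < n \<longrightarrow> v i \<in> E" for m v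
    using that
  proof (induction m arbitrary: v)
    case 0
    then show ?case using assms(3) by auto
  next
    case (Suc m)
    have lin: "linear (\<lambda>x. \<Phi> (v(m := x)))"
      using assms(1) Suc.prems(1) by (simp add: multilinear_form_def)
    have "\<Phi> (v(m := x)) = 0" if "x \<in> span E" for x
      by (rule linear_eq_0_on_span[OF lin _ that], rule Suc.IH)
        (use Suc.prems in auto)
    from this[of "v m"] show ?case using assms(2) by simp
  qed
  then show ?thesis by force
qed

text \<open>The assumption puts z in the radical of \<beta> on P. In each summand of the wedge, z
  occurs either in \<beta> or in the lower power, to which the induction applies.\<close>

lemma wedge_power_0_of_degenerate:
  assumes "\<And>v i. i < 2 \<Longrightarrow> v i = z \<Longrightarrow> v 0 \<in> P \<Longrightarrow> v 1 \<in> P \<Longrightarrow> \<beta> v = 0"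
    and "\<forall>i<2 * j. v i \<in> P" "i < 2 * j" "v i = z"
  shows "wedge_power 2 \<beta> j v = 0"
  using assms(2-)
proof (induction j arbitrary: v i)
  case 0
  then show ?case by simp
next
  case (Suc j)
  have "\<beta> (\<lambda>i. v (\<pi> i)) * wedge_power 2 \<beta> j (\<lambda>i. v (\<pi> (2 + i))) = 0"
    if \<pi>: "\<pi> permutes {..<2 + 2 * j}" for \<pi>
  proof -
    have mem: "v (\<pi> i) \<in> P" if "i < 2 + 2 * j" for i
      using Suc.prems(1) permutes_in_image[OF \<pi>, of i] that by simp
    obtain t where t: "t < 2 + 2 * j" "\<pi> t = i"
      using permutes_inverses(1)[OF \<pi>, of i] permutes_in_image[OF permutes_inv[OF \<pi>], of i] Suc.prems(2)
      by (metis lessThan_iff mult_Suc_right)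
    show ?thesis
    proof (cases "t < 2")
      case True
      then have "\<beta> (\<lambda>i. v (\<pi> i)) = 0"
        using t Suc.prems(3) mem by (intro assms(1)[of t]) auto
      then show ?thesis by simp
    next
      case False
      then have "Suc (Suc (t - 2)) = t" by simp
      then have "wedge_power 2 \<beta> j (\<lambda>i. v (\<pi> (2 + i))) = 0"
        by (intro Suc.IH[of _ "t - 2"]) (use False t Suc.prems(3) mem in auto)
      then show ?thesis by simp
    qed
  qed
  then have "(\<Sum>\<pi> | \<pi> permutes {..<2 + 2 * j}. of_int (sign \<pi>) * \<beta> (\<lambda>i. v (\<pi> i)) *
      wedge_power 2 \<beta> j (\<lambda>i. v (\<pi> (2 + i)))) = 0"
    by (intro sum.neutral) auto
  then show ?case unfolding wedge_power.simps wedge_def by simp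
qed

text \<open>A nonzero radical vector z is extended to a basis of the kernel of \<omega> and, by r,
  to one of the whole space; the top form then vanishes on all tuples of basis vectors. In a summand
  where \<omega> is nonzero its argument is r, so the other 2 d arguments lie in the kernel and
  include z.\<close>

lemma contact_form_nondegenerate:
  fixes \<omega> :: "'e::euclidean_space \<Rightarrow> real" and \<beta> :: "'e \<Rightarrow> 'e \<Rightarrow> real"
  assumes \<omega>: "linear \<omega>" and \<beta>: "bilinear \<beta>" and alt: "\<And>a b. \<beta> a b = - \<beta> b a"
    and dim: "DIM('e) = 2 * d + 1"
    and ne: "wedge 1 (2 * d) (\<lambda>v. \<omega> (v 0)) (wedge_power 2 (\<lambda>v. \<beta> (v 0) (v 1)) d) v \<noteq> 0"
    and z: "\<omega> z = 0" "\<And>x. \<omega> x = 0 \<Longrightarrow> \<beta> z x = 0"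
  shows "z = 0"
proof (rule ccontr)
  assume "z \<noteq> 0"
  let ?P = "{x. \<omega> x = 0}"
  let ?W = "wedge_power 2 (\<lambda>v. \<beta> (v 0) (v 1)) d"
  let ?\<Phi> = "wedge 1 (2 * d) (\<lambda>v. \<omega> (v 0)) ?W"
  have sub: "subspace ?P" by (rule linear_subspace_kernel[OF \<omega>])
  have "independent {z}" using \<open>z \<noteq> 0\<close> by simp
  then obtain B where B: "{z} \<subseteq> B" "B \<subseteq> ?P" "independent B" "?P \<subseteq> span B"
    using maximal_independent_subset_extend[of "{z}" ?P] z(1) by auto
  \<comment> \<open>If \<omega> = 0 the kernel is the whole space and r = z adds nothing to B;
    otherwise r is any vector with \<omega> r nonzero.\<close>
  have "\<exists>r. span (insert r B) = UNIV \<and> (r \<in> B \<or> r \<notin> span B)"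
  proof (cases "?P = UNIV")
    case True
    then show ?thesis using B(1,4) by (intro exI[of _ z]) (auto simp: insert_absorb)
  next
    case False
    then obtain r where r: "\<omega> r \<noteq> 0" by auto
    have "x \<in> span (insert r B)" for x
    proof -
      have "\<omega> (x - (\<omega> x / \<omega> r) *\<^sub>R r) = 0"
        using r by (simp add: linear_diff[OF \<omega>] linear_scale[OF \<omega>])
      then have "x - (\<omega> x / \<omega> r) *\<^sub>R r \<in> span B" using B(4) by auto
      then show ?thesis unfolding span_breakdown_eq by blast
    qed
    moreover have "span B \<subseteq> ?P" by (rule span_minimal[OF B(2) sub])
    ultimately show ?thesis using r by (intro exI[of _ r]) auto
  qed
  then obtain r where r: "span (insert r B) = UNIV" "r \<in> B \<or> r \<notin> span B" by blast
  let ?E = "insert r B"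
  have indE: "independent ?E" using r(2) B(3) by (auto simp: independent_insert insert_absorb)
  have finE: "finite ?E" by (rule independent_imp_finite[OF indE])
  have cardE: "card ?E = 2 * d + 1"
    using dim_eq_card_independent[OF indE] dim_span[of ?E] dim unfolding r(1) by simp
  have zero: "?\<Phi> v = 0" if v: "\<forall>i<1 + 2 * d. v i \<in> ?E" for v
  proof (cases "inj_on v {..<1 + 2 * d}")
    case False
    then obtain i j where "i < 1 + 2 * d" "j < 1 + 2 * d" "i \<noteq> j" "v i = v j"
      unfolding inj_on_def by auto
    then show ?thesis by (rule wedge_repeated_0)
  next
    case True
    \<comment> \<open>An injective tuple of 2 d + 1 basis vectors exhausts the basis, so z occurs in
      it.\<close>
    have "v ` {..<1 + 2 * d} = ?E"
      by (rule card_subset_eq[OF finE]) (use v cardE card_image[OF True] in auto)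
    then obtain s where s: "s < 1 + 2 * d" "v s = z" using B(1) by (metis image_iff insert_subset insertI2 lessThan_iff)
    have "\<omega> (v (\<pi> 0)) * ?W (\<lambda>i. v (\<pi> (1 + i))) = 0" if \<pi>: "\<pi> permutes {..<1 + 2 * d}" for \<pi>
    proof (cases "\<omega> (v (\<pi> 0)) = 0")
      case False
      have lt: "\<pi> i < 1 + 2 * d" if "i < 1 + 2 * d" for i
        using permutes_in_image[OF \<pi>, of i] that by simp
      have r0: "v (\<pi> 0) = r" using False v lt[of 0] B(2) by auto
      have P: "v (\<pi> i) \<in> ?P" if "i < 1 + 2 * d" "i \<noteq> 0" for i
      proof -
        have "\<pi> i \<noteq> \<pi> 0" using permutes_inj[OF \<pi>] that(2) by (auto dest: injD)
        then have "v (\<pi> i) \<noteq> r" using True lt[OF that(1)] lt[of 0] r0 by (auto simp: inj_on_def)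
        then show ?thesis using v lt[OF that(1)] B(2) by auto
      qed
      obtain t where t: "t < 1 + 2 * d" "\<pi> t = s"
        using permutes_inverses(1)[OF \<pi>, of s] permutes_in_image[OF permutes_inv[OF \<pi>], of s] s(1)
        by (metis lessThan_iff)
      have "t \<noteq> 0"
      proof
        assume "t = 0"
        with t(2) s(2) z(1) False show False by simp
      qed
      have "?W (\<lambda>i. v (\<pi> (1 + i))) = 0"
      \<comment> \<open>Argument t of the permuted tuple is argument t - 1 of the wedge power,
        because \<omega> occupies the first place.\<close>
      proof (rule wedge_power_0_of_degenerate[where P = ?P and z = z and i = "t - 1"])
        fix u :: "nat \<Rightarrow> 'e" and i :: nat
        assume u: "i < 2" "u i = z" "u 0 \<in> ?P" "u 1 \<in> ?P"
        then have "i = 0 \<or> i = 1" by auto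
        then show "\<beta> (u 0) (u 1) = 0"
        proof
          assume "i = 0"
          then show ?thesis using u z(2) by simp
        next
          assume "i = 1"
          then show ?thesis using u z(2)[of "u 0"] alt[of "u 0" z] by simp
        qed
      qed (use t s P \<open>t \<noteq> 0\<close> in auto)
      then show ?thesis by simp
    qed simp
    then have "(\<Sum>\<pi> | \<pi> permutes {..<1 + 2 * d}. of_int (sign \<pi>) * \<omega> (v (\<pi> 0)) *
        ?W (\<lambda>i. v (\<pi> (1 + i)))) = 0"
      by (intro sum.neutral) auto
    then show ?thesis unfolding wedge_def by simp
  qed
  have "multilinear_form (1 + 2 * d) ?\<Phi>"
  proof (intro multilinear_form_wedge multilinear_form_wedge_power)
    show "multilinear_form 1 (\<lambda>v. \<omega> (v 0))" using \<omega> by (simp add: multilinear_form_def)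
    have "linear (\<lambda>x. \<beta> ((v(i := x)) 0) ((v(i := x)) 1))" if "i < 2" for v and i :: nat
    proof -
      have "i = 0 \<or> i = 1" using that by auto
      then show ?thesis using \<beta> by (auto simp: bilinear_def)
    qed
    then show "multilinear_form 2 (\<lambda>v. \<beta> (v 0) (v 1))"
      by (simp add: multilinear_form_def)
  qed
  from multilinear_form_zeroI[OF this r(1) zero] ne show False by blast
qed

section \<open>Coordinate expressions\<close>

lemma hyperplane_decomposition:
  fixes P :: "'e::euclidean_space set"
  assumes "subspace P" "dim P + 1 = DIM('e)" "w \<notin> P"
  shows "\<exists>u\<in>P. \<exists>t. v = u + t *\<^sub>R w"
proof -
  have span: "span P = P" using assms(1) by (rule span_eq_iff[THEN iffD2])
  have "dim (insert w P) = DIM('e)" using assms(2,3) by (simp add: dim_insert span)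
  then have "v \<in> span (insert w P)" using dim_eq_full by blast
  then obtain k where "v - k *\<^sub>R w \<in> P" by (auto simp: span_breakdown_eq span)
  then show ?thesis by (intro bexI[of _ "v - k *\<^sub>R w"] exI[of _ k]) auto
qed

lemma proj_along_eq:
  assumes "subspace P" "w \<notin> P" "u \<in> P"
  shows "proj_along w P (u + t *\<^sub>R w) = u"
  unfolding proj_along_def
proof (rule the_equality)
  show "u \<in> P \<and> (\<exists>s. u + t *\<^sub>R w = u + s *\<^sub>R w)" using assms(3) by auto
  fix u' assume u': "u' \<in> P \<and> (\<exists>s. u + t *\<^sub>R w = u' + s *\<^sub>R w)"
  then obtain s where s: "u + t *\<^sub>R w = u' + s *\<^sub>R w" by blast
  then have d: "u - u' = (s - t) *\<^sub>R w" by (simp add: algebra_simps)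
  have "u - u' \<in> P" using u' assms by (simp add: subspace_diff)
  then have mem: "(1 / (s - t)) *\<^sub>R (u - u') \<in> P" by (rule subspace_scale[OF assms(1)])
  have "s = t"
  proof (rule ccontr)
    assume "s \<noteq> t"
    then have "(1 / (s - t)) *\<^sub>R (u - u') = w" unfolding d by simp
    with mem assms(2) show False by simp
  qed
  then show "u' = u" using d by simp
qed

text \<open>For a hyperplane P and w outside it, this is the linear form with kernel P and value 1
  at w.\<close>

definition proj_coeff :: "'e::euclidean_space \<Rightarrow> 'e set \<Rightarrow> 'e \<Rightarrow> real" where
  "proj_coeff w P v = (v - proj_along w P v) \<bullet> w / (w \<bullet> w)"

lemma proj_coeff_add:
  assumes "subspace P" "w \<notin> P" "u \<in> P"
  shows "proj_coeff w P (u + t *\<^sub>R w) = t"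
proof -
  have "w \<noteq> 0" using assms(1,2) subspace_0 by blast
  then show ?thesis by (simp add: proj_coeff_def proj_along_eq[OF assms])
qed

lemma proj_along_linear_form:
  assumes "linear l" "l w = 1"
  shows "proj_along w {u. l u = 0} v = v - l v *\<^sub>R w"
proof -
  have "l (v - l v *\<^sub>R w) = 0"
    using assms(2) by (simp add: linear_diff[OF assms(1)] linear_scale[OF assms(1)])
  then show ?thesis
    using proj_along_eq[OF linear_subspace_kernel[OF assms(1)], of w "v - l v *\<^sub>R w" "l v"] assms(2) by simp
qed

context
  fixes P :: "'e::euclidean_space set" and w :: 'e
  assumes P: "subspace P" and dim_P: "dim P + 1 = DIM('e)" and w: "w \<notin> P"
begin

lemma proj_along_coeff: "proj_along w P v = v - proj_coeff w P v *\<^sub>R w"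
  and proj_along_mem: "proj_along w P v \<in> P"
proof -
  obtain u t where u: "u \<in> P" "v = u + t *\<^sub>R w" using hyperplane_decomposition[OF P dim_P w] by blast
  then show "proj_along w P v = v - proj_coeff w P v *\<^sub>R w" "proj_along w P v \<in> P"
    by (simp_all add: proj_along_eq[OF P w] proj_coeff_add[OF P w])
qed

lemma linear_proj_coeff: "linear (proj_coeff w P)"
proof (rule linearI)
  fix v v'
  obtain u t where u: "u \<in> P" "v = u + t *\<^sub>R w" using hyperplane_decomposition[OF P dim_P w] by blast
  obtain u' t' where u': "u' \<in> P" "v' = u' + t' *\<^sub>R w"
    using hyperplane_decomposition[OF P dim_P w] by blast
  have "v + v' = (u + u') + (t + t') *\<^sub>R w" using u u' by (simp add: algebra_simps)
  then show "proj_coeff w P (v + v') = proj_coeff w P v + proj_coeff w P v'"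
    using u u' by (simp only: proj_coeff_add[OF P w] subspace_add[OF P])
next
  fix r v
  obtain u t where u: "u \<in> P" "v = u + t *\<^sub>R w" using hyperplane_decomposition[OF P dim_P w] by blast
  have "r *\<^sub>R v = r *\<^sub>R u + (r * t) *\<^sub>R w" using u by (simp add: algebra_simps)
  then show "proj_coeff w P (r *\<^sub>R v) = r *\<^sub>R proj_coeff w P v"
    using u by (simp only: proj_coeff_add[OF P w] subspace_scale[OF P] real_scaleR_def)
qed

lemma proj_coeff_w: "proj_coeff w P w = 1"
  using proj_coeff_add[OF P w subspace_0[OF P], of 1] by simp

lemma proj_coeff_eq_0_iff: "proj_coeff w P v = 0 \<longleftrightarrow> v \<in> P"
  using proj_along_coeff[of v] proj_along_mem[of v] proj_coeff_add[OF P w, of v 0] by auto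

end

section \<open>Charts, coordinate expressions of maps and tangent vectors\<close>

locale atlas =
  fixes M :: "'a topology" and A :: "('a, 'e::euclidean_space) chart set"
  assumes smooth_atlas: "smooth_atlas M A"
begin

lemma openin_cdom: "c \<in> A \<Longrightarrow> openin M (cdom c)"
  and open_cimg: "c \<in> A \<Longrightarrow> open (cimg c)"
  and homeomorphic_cmap:
    "c \<in> A \<Longrightarrow> homeomorphic_map (subtopology M (cdom c)) (top_of_set (cimg c)) (cmap c)"
  and topspace_eq: "topspace M = (\<Union>c\<in>A. cdom c)"
  and smooth_transition: "c \<in> A \<Longrightarrow> c' \<in> A \<Longrightarrow>
    smooth_on (cmap c ` (cdom c \<inter> cdom c')) (cmap c' \<circ> cinv c)"
  using smooth_atlas unfolding smooth_atlas_def by blast+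

lemma inj_cmap:
  assumes "c \<in> A"
  shows "inj_on (cmap c) (cdom c)"
proof -
  have "topspace (subtopology M (cdom c)) = cdom c"
    using openin_subset[OF openin_cdom[OF assms]] by (simp add: topspace_subtopology Int_absorb1)
  then show ?thesis
    using homeomorphic_imp_injective_map[OF homeomorphic_cmap[OF assms]] by simp
qed

lemma cinv_cmap: "c \<in> A \<Longrightarrow> y \<in> cdom c \<Longrightarrow> cinv c (cmap c y) = y"
  unfolding cinv_def by (rule inv_into_f_f[OF inj_cmap])

lemma cmap_cinv: "q \<in> cimg c \<Longrightarrow> cmap c (cinv c q) = q"
  unfolding cinv_def cimg_def by (rule f_inv_into_f)

lemma open_cmap_image:
  assumes "c \<in> A" "openin M W" "W \<subseteq> cdom c"
  shows "open (cmap c ` W)"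
proof -
  have "openin (subtopology M (cdom c)) W"
    using assms(2,3) by (auto simp: openin_subtopology)
  then have "openin (top_of_set (cimg c)) (cmap c ` W)"
    using homeomorphic_imp_open_map[OF homeomorphic_cmap[OF assms(1)]] by (simp add: open_map_def)
  then show ?thesis using open_cimg[OF assms(1)] by (simp add: openin_open_eq)
qed

definition rep_dom :: "('a \<Rightarrow> 'a) \<Rightarrow> 'a set \<Rightarrow> ('a, 'e) chart \<Rightarrow> ('a, 'e) chart \<Rightarrow> 'e set" where
  "rep_dom f U c c' = cmap c ` (U \<inter> cdom c \<inter> f -` cdom c')"

lemma open_rep_dom:
  assumes "openin M U" "smooth_map M A U f" "c \<in> A" "c' \<in> A"
  shows "open (rep_dom f U c c')"
proof -
  have "continuous_map (subtopology M U) M f" using assms(2) by (simp add: smooth_map_def)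
  then have "openin (subtopology M U) {x \<in> topspace (subtopology M U). f x \<in> cdom c'}"
    using openin_cdom[OF assms(4)] by (simp add: continuous_map)
  moreover have "{x \<in> topspace (subtopology M U). f x \<in> cdom c'} = U \<inter> f -` cdom c'"
    using openin_subset[OF assms(1)] by (auto simp: topspace_subtopology)
  ultimately have "openin M (U \<inter> f -` cdom c')"
    using assms(1) by (simp add: openin_open_subtopology)
  then have "openin M ((U \<inter> f -` cdom c') \<inter> cdom c)"
    by (rule openin_Int[OF _ openin_cdom[OF assms(3)]])
  then have "openin M (U \<inter> cdom c \<inter> f -` cdom c')"
    by (simp only: Int_assoc Int_commute[of "cdom c"])
  then show ?thesis
    unfolding rep_dom_def by (intro open_cmap_image[OF assms(3)]) auto
qed

lemma Ck_on_rep: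
  assumes "smooth_map M A U f" "c \<in> A" "c' \<in> A"
  shows "Ck_on k (cmap c' \<circ> f \<circ> cinv c) (rep_dom f U c c')"
  using assms unfolding smooth_map_def rep_dom_def smooth_on_def by blast

lemma mem_rep_dom:
  "y \<in> U \<Longrightarrow> c \<in> charts_at A y \<Longrightarrow> c' \<in> charts_at A (f y) \<Longrightarrow> cmap c y \<in> rep_dom f U c c'"
  by (auto simp: rep_dom_def charts_at_def)

lemma D_rep:
  assumes "openin M U" "smooth_map M A U f" "y \<in> U" "c \<in> charts_at A y" "c' \<in> charts_at A (f y)"
  shows "(cmap c' \<circ> f \<circ> cinv c has_derivative (\<lambda>v. ddir v (cmap c' \<circ> f \<circ> cinv c) (cmap c y)))
    (at (cmap c y))"
  using Ck_on_differentiable[OF Ck_on_rep open_rep_dom mem_rep_dom] assms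
  by (simp add: charts_at_def)

text \<open>Makes transition maps coordinate expressions of the identity, so that the rules below
  for changing charts also cover tangent vectors.\<close>

lemma smooth_map_id: "smooth_map M A (topspace M) id"
  unfolding smooth_map_def
proof safe
  fix a b a' b' assume c: "(a, b) \<in> A" "(a', b') \<in> A"
  have "topspace M \<inter> cdom (a, b) \<inter> id -` cdom (a', b') = cdom (a, b) \<inter> cdom (a', b')"
    using openin_subset[OF openin_cdom[OF c(1)]] by auto
  then show "smooth_on (cmap (a, b) ` (topspace M \<inter> cdom (a, b) \<inter> id -` cdom (a', b')))
      (cmap (a', b') \<circ> id \<circ> cinv (a, b))"
    using smooth_transition[OF c] by simp
qed simp

lemma charts_at_topspace: "c \<in> charts_at A y \<Longrightarrow> y \<in> topspace M"
  unfolding topspace_eq charts_at_def by auto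

lemma charts_atD: "c \<in> charts_at A y \<Longrightarrow> c \<in> A" "c \<in> charts_at A y \<Longrightarrow> y \<in> cdom c"
  by (auto simp: charts_at_def)

lemma D_transition:
  assumes "c \<in> charts_at A y" "c' \<in> charts_at A y"
  shows "(cmap c' \<circ> cinv c has_derivative (\<lambda>v. ddir v (cmap c' \<circ> cinv c) (cmap c y))) (at (cmap c y))"
  using D_rep[OF openin_topspace smooth_map_id charts_at_topspace[OF assms(1)] assms(1)] assms(2) by simp

text \<open>Chain rule on the overlap of c and c1; for the identity it is the cocycle relation of
  the transition maps.\<close>

lemma rep_change_source:
  assumes U: "openin M U" "smooth_map M A U f" "y \<in> U"
    and c: "c \<in> charts_at A y" "c1 \<in> charts_at A y" and c2: "c2 \<in> charts_at A (f y)"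
  shows "ddir (ddir u (cmap c1 \<circ> cinv c) (cmap c y)) (cmap c2 \<circ> f \<circ> cinv c1) (cmap c1 y)
    = ddir u (cmap c2 \<circ> f \<circ> cinv c) (cmap c y)"
proof -
  let ?W = "cmap c ` (cdom c \<inter> cdom c1)" and ?g = "cmap c1 \<circ> cinv c" and ?h = "cmap c2 \<circ> f \<circ> cinv c1"
  note A = charts_atD(1)[OF c(1)] charts_atD(1)[OF c(2)]
  have W: "open ?W"
    by (intro open_cmap_image openin_Int openin_cdom A) auto
  have mem: "cmap c y \<in> ?W" using c by (auto simp: charts_at_def)
  have g: "?g (cmap c y) = cmap c1 y" using c by (simp add: cinv_cmap charts_at_def)
  have "ddir u (cmap c2 \<circ> f \<circ> cinv c) (cmap c y) = ddir u (\<lambda>q. ?h (?g q)) (cmap c y)"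
    by (rule ddir_cong_open[OF W mem]) (auto simp: cinv_cmap[OF A(1)] cinv_cmap[OF A(2)])
  also have "\<dots> = ddir (ddir u ?g (cmap c y)) ?h (?g (cmap c y))"
    by (rule ddir_eqI, rule has_derivative_compose[OF D_transition[OF c]])
      (unfold g, rule D_rep[OF U c(2) c2])
  finally show ?thesis unfolding g by simp
qed

lemma rep_change_target:
  assumes U: "openin M U" "smooth_map M A U f" "y \<in> U"
    and c: "c \<in> charts_at A y" and c2: "c2 \<in> charts_at A (f y)" "c3 \<in> charts_at A (f y)"
  shows "ddir (ddir u (cmap c2 \<circ> f \<circ> cinv c) (cmap c y)) (cmap c3 \<circ> cinv c2) (cmap c2 (f y))
    = ddir u (cmap c3 \<circ> f \<circ> cinv c) (cmap c y)"
proof -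
  let ?g = "cmap c2 \<circ> f \<circ> cinv c" and ?h = "cmap c3 \<circ> cinv c2"
  note A = charts_atD(1)[OF c] charts_atD(1)[OF c2(1)]
  have g: "?g (cmap c y) = cmap c2 (f y)" using c by (simp add: cinv_cmap charts_at_def)
  have "ddir u (cmap c3 \<circ> f \<circ> cinv c) (cmap c y) = ddir u (\<lambda>q. ?h (?g q)) (cmap c y)"
    by (rule ddir_cong_open[OF open_rep_dom[OF U(1,2) A] mem_rep_dom[where f = f, OF U(3) c c2(1)]])
      (auto simp: rep_dom_def cinv_cmap[OF A(1)] cinv_cmap[OF A(2)])
  also have "\<dots> = ddir (ddir u ?g (cmap c y)) ?h (?g (cmap c y))"
    by (rule ddir_eqI, rule has_derivative_compose[OF D_rep[OF U c c2(1)]])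
      (unfold g, rule D_transition[OF c2])
  finally show ?thesis unfolding g by simp
qed

lemma tvec_of_eq:
  "tvec_of A c y u = (\<lambda>c'. if c' \<in> charts_at A y then ddir u (cmap c' \<circ> cinv c) (cmap c y) else 0)"
  unfolding tvec_of_def ddir_def ..

lemma tvec_of_tangent_space:
  assumes "c \<in> charts_at A y"
  shows "tvec_of A c y u \<in> tangent_space A y"
  using rep_change_source[OF openin_topspace smooth_map_id charts_at_topspace[OF assms] assms]
  unfolding tangent_space_def tvec_of_eq by (auto simp: ddir_def[symmetric])

text \<open>\<open>tangent_map\<close> computes in a chart picked by \<open>SOME\<close>; the two
  rules for changing charts remove this choice.\<close>

lemma tangent_map_tvec_of:
  assumes U: "openin M U" "smooth_map M A U f" "y \<in> U"
    and c: "c \<in> charts_at A y" "c \<in> charts_at A (f y)"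
  shows "tangent_map A f y (tvec_of A c y u) = tvec_of A c (f y) (ddir u (cmap c \<circ> f \<circ> cinv c) (cmap c y))"
proof -
  define c0 where "c0 = (SOME c. c \<in> charts_at A y)"
  have c0: "c0 \<in> charts_at A y" unfolding c0_def using c(1) by (rule someI)
  have "tangent_map A f y (tvec_of A c y u) = (\<lambda>c'. if c' \<in> charts_at A (f y)
      then ddir (tvec_of A c y u c0) (cmap c' \<circ> f \<circ> cinv c0) (cmap c0 y) else 0)"
    unfolding tangent_map_def c0_def[symmetric] ddir_def Let_def ..
  also have "\<dots> = tvec_of A c (f y) (ddir u (cmap c \<circ> f \<circ> cinv c) (cmap c y))"
    using c0 rep_change_source[OF U c(1) c0] rep_change_target[OF U c]
    by (auto simp: tvec_of_eq fun_eq_iff)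
  finally show ?thesis .
qed

lemma rep_domD:
  assumes "c \<in> A" "c' \<in> A" "q \<in> rep_dom f U c c'"
  shows "cinv c q \<in> U" "c \<in> charts_at A (cinv c q)" "c' \<in> charts_at A (f (cinv c q))"
    "cmap c (cinv c q) = q" "cinv c' ((cmap c' \<circ> f \<circ> cinv c) q) = f (cinv c q)"
  using assms by (auto simp: rep_dom_def charts_at_def cinv_cmap)

lemma hyp_in_chart_pullback:
  assumes "openin M U" "smooth_map M A U f" "c \<in> A" "q \<in> rep_dom f U c c"
  shows "hyp_in_chart A (pullback_hyp A f D) c q =
    {u. ddir u (cmap c \<circ> f \<circ> cinv c) q \<in> hyp_in_chart A D c ((cmap c \<circ> f \<circ> cinv c) q)}"
  using tangent_map_tvec_of[OF assms(1,2) rep_domD(1,2,3)[OF assms(3,3,4)]]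
    rep_domD(4,5)[OF assms(3,3,4)] tvec_of_tangent_space[OF rep_domD(2)[OF assms(3,3,4)]]
  unfolding hyp_in_chart_def pullback_hyp_def by simp

lemma metric_in_chart_pullback:
  assumes "openin M U" "smooth_map M A U f" "c \<in> A" "q \<in> rep_dom f U c c"
  shows "metric_in_chart A (pullback_metric A f h) c q u v =
    metric_in_chart A h c ((cmap c \<circ> f \<circ> cinv c) q)
      (ddir u (cmap c \<circ> f \<circ> cinv c) q) (ddir v (cmap c \<circ> f \<circ> cinv c) q)"
  using tangent_map_tvec_of[OF assms(1,2) rep_domD(1,2,3)[OF assms(3,3,4)]]
    rep_domD(4,5)[OF assms(3,3,4)]
  unfolding metric_in_chart_def pullback_metric_def by simp

end

context atlas
begin

lemma ddir_coordinates_id: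
  assumes "c \<in> A" "q \<in> cimg c"
  shows "(cmap c \<circ> id \<circ> cinv c) q = q" "ddir v (cmap c \<circ> id \<circ> cinv c) q = v"
proof -
  show "(cmap c \<circ> id \<circ> cinv c) q = q" using assms by (simp add: cmap_cinv)
  have "ddir v (cmap c \<circ> id \<circ> cinv c) q = ddir v (\<lambda>q. q) q"
    by (rule ddir_cong_open[OF open_cimg[OF assms(1)] assms(2)]) (simp add: cmap_cinv)
  then show "ddir v (cmap c \<circ> id \<circ> cinv c) q = v"
    using ddir_eqI[OF has_derivative_ident] by simp
qed

lemma same_jet_1_id_iff:
  assumes "c \<in> charts_at A x"
  shows "same_jet 1 F (cmap c \<circ> id \<circ> cinv c) (cmap c x) \<longleftrightarrow>
    F (cmap c x) = cmap c x \<and> (\<forall>v. ddir v F (cmap c x) = v)"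
proof -
  have "cmap c x \<in> cimg c" using assms by (auto simp: charts_at_def cimg_def)
  then show ?thesis
    unfolding One_nat_def same_jet_Suc same_jet_0
    using ddir_coordinates_id[OF charts_atD(1)[OF assms]] by simp
qed

lemma same_jet_2_idI:
  assumes c: "c \<in> charts_at A x" and "F (cmap c x) = cmap c x" "\<And>v. ddir v F (cmap c x) = v"
    and zero: "\<And>u v. ddir u (ddir v F) (cmap c x) = 0"
  shows "same_jet 2 F (cmap c \<circ> id \<circ> cinv c) (cmap c x)"
proof -
  have mem: "cmap c x \<in> cimg c" using c by (auto simp: charts_at_def cimg_def)
  note id = ddir_coordinates_id[OF charts_atD(1)[OF c]]
  have "ddir u (ddir v (cmap c \<circ> id \<circ> cinv c)) (cmap c x) = ddir u (\<lambda>_. v) (cmap c x)" for u v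
    by (rule ddir_cong_open[OF open_cimg[OF charts_atD(1)[OF c]] mem id(2)])
  then show ?thesis
    unfolding numeral_2_eq_2 same_jet_Suc same_jet_0
    using assms(2,3) zero id[OF mem] by simp
qed

end

section \<open>The structure and its pullback in a chart\<close>

locale contact_sub_riemannian = atlas M A
  for M :: "'a topology" and A :: "('a, 'e::euclidean_space) chart set" +
  fixes D :: "'a \<Rightarrow> ('a, 'e) tvec set" and h :: "'a \<Rightarrow> ('a, 'e) tvec \<Rightarrow> ('a, 'e) tvec \<Rightarrow> real"
    and d :: nat
  assumes sub_riemannian: "sub_riemannian M A D h" and d_pos: "d \<ge> 1" and contact: "contact M A d D"
begin

lemma hyperplane:
  assumes "c \<in> A" "q \<in> cimg c"
  shows "subspace (hyp_in_chart A D c q)" "dim (hyp_in_chart A D c q) + 1 = DIM('e)"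
    and metric_add: "\<And>u u' v. u \<in> hyp_in_chart A D c q \<Longrightarrow> u' \<in> hyp_in_chart A D c q \<Longrightarrow>
      v \<in> hyp_in_chart A D c q \<Longrightarrow>
      metric_in_chart A h c q (u + u') v = metric_in_chart A h c q u v + metric_in_chart A h c q u' v"
    and metric_scale: "\<And>r u v. u \<in> hyp_in_chart A D c q \<Longrightarrow> v \<in> hyp_in_chart A D c q \<Longrightarrow>
      metric_in_chart A h c q (r *\<^sub>R u) v = r * metric_in_chart A h c q u v"
    and metric_sym: "\<And>u v. u \<in> hyp_in_chart A D c q \<Longrightarrow> v \<in> hyp_in_chart A D c q \<Longrightarrow>
      metric_in_chart A h c q u v = metric_in_chart A h c q v u"
    and metric_pos: "\<And>u. u \<in> hyp_in_chart A D c q \<Longrightarrow> u \<noteq> 0 \<Longrightarrow> metric_in_chart A h c q u u > 0"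
proof -
  have "euclidean_hyperplane (hyp_in_chart A D c q) (metric_in_chart A h c q)"
    using sub_riemannian assms unfolding sub_riemannian_def by blast
  note e = this[unfolded euclidean_hyperplane_def]
  show "subspace (hyp_in_chart A D c q)" "dim (hyp_in_chart A D c q) + 1 = DIM('e)"
    using e by blast+
  show "\<And>u u' v. u \<in> hyp_in_chart A D c q \<Longrightarrow> u' \<in> hyp_in_chart A D c q \<Longrightarrow>
      v \<in> hyp_in_chart A D c q \<Longrightarrow>
      metric_in_chart A h c q (u + u') v = metric_in_chart A h c q u v + metric_in_chart A h c q u' v"
    using e by blast
  show "\<And>r u v. u \<in> hyp_in_chart A D c q \<Longrightarrow> v \<in> hyp_in_chart A D c q \<Longrightarrow>
      metric_in_chart A h c q (r *\<^sub>R u) v = r * metric_in_chart A h c q u v"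
    using e by blast
  show "\<And>u v. u \<in> hyp_in_chart A D c q \<Longrightarrow> v \<in> hyp_in_chart A D c q \<Longrightarrow>
      metric_in_chart A h c q u v = metric_in_chart A h c q v u"
    using e by blast
  show "\<And>u. u \<in> hyp_in_chart A D c q \<Longrightarrow> u \<noteq> 0 \<Longrightarrow> metric_in_chart A h c q u u > 0"
    using e by blast
qed

text \<open>The \<open>1\<close>-form with kernel \<open>D\<close> in the chart \<open>c\<close> that takes the value \<open>1\<close> at \<open>w\<close>, as a vector.\<close>

definition covector :: "('a, 'e) chart \<Rightarrow> 'e \<Rightarrow> 'e \<Rightarrow> 'e" where
  "covector c w q = (\<Sum>b\<in>Basis. proj_coeff w (hyp_in_chart A D c q) b *\<^sub>R b)"

context
  fixes c w q
  assumes c: "c \<in> A" and q: "q \<in> cimg c" and w: "w \<notin> hyp_in_chart A D c q"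
begin

lemmas P = hyperplane(1,2)[OF c q] w

lemma covector_inner: "covector c w q \<bullet> v = proj_coeff w (hyp_in_chart A D c q) v"
proof -
  have "proj_coeff w (hyp_in_chart A D c q) v =
      proj_coeff w (hyp_in_chart A D c q) (\<Sum>b\<in>Basis. (v \<bullet> b) *\<^sub>R b)"
    by (simp add: euclidean_representation)
  also have "\<dots> = (\<Sum>b\<in>Basis. (v \<bullet> b) * proj_coeff w (hyp_in_chart A D c q) b)"
    unfolding linear_sum[OF linear_proj_coeff[OF P]] linear_scale[OF linear_proj_coeff[OF P]] by simp
  finally show ?thesis
    unfolding covector_def inner_sum_left by (simp add: inner_commute[of v] mult.commute)
qed

lemma covector_w: "covector c w q \<bullet> w = 1"
  unfolding covector_inner by (rule proj_coeff_w[OF P])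

lemma covector_eq_0_iff: "covector c w q \<bullet> v = 0 \<longleftrightarrow> v \<in> hyp_in_chart A D c q"
  unfolding covector_inner by (rule proj_coeff_eq_0_iff[OF P])

lemma hyp_coord_eq: "hyp_coord A D c w v q = v - (covector c w q \<bullet> v) *\<^sub>R w"
  unfolding hyp_coord_def covector_inner by (rule proj_along_coeff[OF P])

lemma hyp_coord_mem: "hyp_coord A D c w v q \<in> hyp_in_chart A D c q"
  unfolding hyp_coord_def by (rule proj_along_mem[OF P])

lemma metric_coord_mem:
  "u \<in> hyp_in_chart A D c q \<Longrightarrow> v \<in> hyp_in_chart A D c q \<Longrightarrow>
    metric_coord A D h c w u v q = metric_in_chart A h c q u v"
  by (simp add: metric_coord_def hyp_coord_eq covector_eq_0_iff[THEN iffD2])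

lemma metric_coord_sym: "metric_coord A D h c w u v q = metric_coord A D h c w v u q"
  unfolding metric_coord_def by (rule metric_sym[OF c q hyp_coord_mem hyp_coord_mem])

lemma bilinear_metric_coord: "bilinear (\<lambda>u v. metric_coord A D h c w u v q)"
proof -
  have "linear (\<lambda>u. metric_coord A D h c w u v q)" for v
  proof (rule linearI)
    fix u u' r
    have "hyp_coord A D c w (u + u') q = hyp_coord A D c w u q + hyp_coord A D c w u' q"
      "hyp_coord A D c w (r *\<^sub>R u) q = r *\<^sub>R hyp_coord A D c w u q"
      by (simp_all add: hyp_coord_eq inner_add_right algebra_simps)
    then show "metric_coord A D h c w (u + u') v q = metric_coord A D h c w u v q + metric_coord A D h c w u' v q"
      "metric_coord A D h c w (r *\<^sub>R u) v q = r *\<^sub>R metric_coord A D h c w u v q"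
      unfolding metric_coord_def
      by (simp_all add: metric_add[OF c q] metric_scale[OF c q] hyp_coord_mem)
  qed
  moreover have "(\<lambda>v. metric_coord A D h c w u v q) = (\<lambda>v. metric_coord A D h c w v u q)" for u
    by (rule ext) (rule metric_coord_sym)
  ultimately show ?thesis
    unfolding bilinear_def by simp
qed

lemma metric_coord_w: "metric_coord A D h c w w v q = 0"
proof -
  have "hyp_coord A D c w w q = 0 *\<^sub>R hyp_coord A D c w w q"
    by (simp add: hyp_coord_eq covector_w)
  then show ?thesis
    unfolding metric_coord_def using metric_scale[OF c q hyp_coord_mem hyp_coord_mem, of 0] by simp
qed

end

text \<open>The contact condition concerns some local form \<omega>, not the normalised one. In the
  chart \<omega> = \<mu> \<theta>, and d\<omega> = d\<mu> \<and> \<theta> + \<mu> d\<theta>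
  restricts to \<mu> d\<theta> on the kernel, so a radical vector of d\<theta> there is one of
  d\<omega>.\<close>

lemma covector_nondegenerate:
  assumes c: "c \<in> charts_at A x" and N: "open N" "cmap c x \<in> N" "N \<subseteq> cimg c"
    and w: "\<And>q. q \<in> N \<Longrightarrow> w \<notin> hyp_in_chart A D c q"
    and smooth: "\<And>k. Ck_on k (covector c w) N"
    and z: "covector c w (cmap c x) \<bullet> z = 0"
      "\<And>v. covector c w (cmap c x) \<bullet> v = 0 \<Longrightarrow>
        ddir z (covector c w) (cmap c x) \<bullet> v - ddir v (covector c w) (cmap c x) \<bullet> z = 0"
  shows "z = 0"
proof -
  let ?\<theta> = "covector c w" and ?p = "cmap c x"
  note cA = charts_atD[OF c]
  obtain U \<omega> where U: "openin M U" "x \<in> U" and cont: "contact_form_on A d U \<omega>"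
    and D: "\<And>y. y \<in> U \<Longrightarrow> D y = {v \<in> tangent_space A y. \<omega> y v = 0}"
  proof -
    have "\<forall>x\<in>topspace M. \<exists>U \<omega>. openin M U \<and> x \<in> U \<and> contact_form_on A d U \<omega> \<and>
        (\<forall>y\<in>U. D y = {v \<in> tangent_space A y. \<omega> y v = 0})"
      using contact unfolding contact_def by (rule conjunct2)
    from bspec[OF this charts_at_topspace[OF c]] show ?thesis using that by blast
  qed
  note one = bspec[OF conjunct1[OF cont[unfolded contact_form_on_def], unfolded one_form_on_def] cA(1)]
  define g where "g = form_in_chart A \<omega> c"
  define N' where "N' = N \<inter> cmap c ` (U \<inter> cdom c)"
  have "open (cmap c ` (U \<inter> cdom c))"
    by (rule open_cmap_image[OF cA(1)]) (use U(1) openin_cdom[OF cA(1)] in auto)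
  then have N': "open N'" "?p \<in> N'" "N' \<subseteq> N" "N' \<subseteq> cmap c ` (U \<inter> cdom c)"
    using N U(2) cA(2) by (auto simp: N'_def)
  have lin: "linear (g q)" if "q \<in> N'" for q
    unfolding g_def by (rule bspec[OF conjunct1[OF one] subsetD[OF N'(4) that]])
  have "Ck_on k (\<lambda>q. g q u) (cmap c ` (U \<inter> cdom c))" for k u
    unfolding g_def by (rule smooth_on_Ck[OF spec[OF conjunct2[OF one]]])
  then have smooth_g: "Ck_on k (\<lambda>q. g q u) N'" for k u
    by (rule Ck_on_subset[OF _ N'(4)])
  have g_iff: "g q v = 0 \<longleftrightarrow> v \<in> hyp_in_chart A D c q" if qN': "q \<in> N'" for q v
  proof -
    obtain y where y: "y \<in> U" "y \<in> cdom c" "q = cmap c y" using subsetD[OF N'(4) qN'] by blast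
    then have y': "cinv c q = y" by (simp add: cinv_cmap[OF cA(1)])
    have "c \<in> charts_at A y" using y cA(1) by (simp add: charts_at_def)
    then show ?thesis
      unfolding hyp_in_chart_def g_def form_in_chart_def y' D[OF y(1)]
      using tvec_of_tangent_space by simp
  qed
  define \<mu> where "\<mu> q = g q w" for q
  have g_eq: "g q v = \<mu> q * (?\<theta> q \<bullet> v)" if "q \<in> N'" for q v
  proof -
    have qN: "q \<in> N" "q \<in> cimg c" using that N'(3) N(3) by auto
    note P = cA(1) qN(2) w[OF qN(1)]
    have "v - (?\<theta> q \<bullet> v) *\<^sub>R w \<in> hyp_in_chart A D c q"
      using hyp_coord_mem[OF P, of v] by (simp only: hyp_coord_eq[OF P])
    then have "g q (v - (?\<theta> q \<bullet> v) *\<^sub>R w) = 0" using g_iff[OF that] by simp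
    then show ?thesis by (simp add: linear_diff[OF lin[OF that]] linear_scale[OF lin[OF that]] \<mu>_def)
  qed
  have pN: "?p \<in> cimg c" using N by blast
  have D\<theta>: "(?\<theta> has_derivative (\<lambda>v. ddir v ?\<theta> ?p)) (at ?p)"
    by (rule Ck_on_differentiable[OF smooth N(1,2)])
  have D\<mu>: "(\<mu> has_derivative (\<lambda>v. ddir v \<mu> ?p)) (at ?p)"
    unfolding \<mu>_def[abs_def] by (rule Ck_on_differentiable[OF smooth_g N'(1,2)])
  have Dg: "ddir a (\<lambda>q. g q b) ?p = \<mu> ?p * (ddir a ?\<theta> ?p \<bullet> b) + ddir a \<mu> ?p * (?\<theta> ?p \<bullet> b)" for a b
  proof -
    have "ddir a (\<lambda>q. g q b) ?p = ddir a (\<lambda>q. \<mu> q * (?\<theta> q \<bullet> b)) ?p"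
      by (rule ddir_cong_open[OF N'(1,2) g_eq])
    then show ?thesis
      using ddir_eqI[OF has_derivative_mult[OF D\<mu> has_derivative_inner_left[OF D\<theta>]]] by simp
  qed
  define \<beta> where "\<beta> a b = ddir a (\<lambda>q. g q b) ?p - ddir b (\<lambda>q. g q a) ?p" for a b
  obtain v where v: "wedge 1 (2 * d) (\<lambda>v. g ?p (v 0)) (wedge_power 2 (ext_deriv g ?p) d) v \<noteq> 0"
    using bspec[OF bspec[OF conjunct2[OF cont[unfolded contact_form_on_def]] cA(1)]
        subsetD[OF N'(4) N'(2)]] unfolding g_def by blast
  have ext: "ext_deriv g ?p = (\<lambda>v. \<beta> (v 0) (v 1))"
    by (simp add: ext_deriv_def \<beta>_def ddir_def fun_eq_iff)
  have \<beta>: "bilinear \<beta>"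
    unfolding bilinear_def \<beta>_def Dg
    by (auto intro!: linearI simp: ddir_add[OF D\<theta>] ddir_add[OF D\<mu>] ddir_scaleR[OF D\<theta>] ddir_scaleR[OF D\<mu>]
        inner_add_right inner_add_left algebra_simps)
  have dim: "DIM('e) = 2 * d + 1" using contact by (simp add: contact_def)
  show "z = 0"
  proof (rule contact_form_nondegenerate[OF lin[OF N'(2)] \<beta> _ dim v[unfolded ext]])
    show "\<beta> a b = - \<beta> b a" for a b by (simp add: \<beta>_def)
    show "g ?p z = 0" by (simp add: g_eq[OF N'(2)] z(1))
    fix x assume "g ?p x = 0"
    then have x: "?\<theta> ?p \<bullet> x = 0"
      using g_iff[OF N'(2)] covector_eq_0_iff[OF cA(1) pN w[OF N(2)]] by simp
    have "\<beta> z x = \<mu> ?p * (ddir z ?\<theta> ?p \<bullet> x - ddir x ?\<theta> ?p \<bullet> z)"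
      unfolding \<beta>_def Dg by (simp add: x z(1) algebra_simps)
    then show "\<beta> z x = 0" using z(2)[OF x] by simp
  qed
qed

lemma sub_rigid_4_1: "sub_rigid M A D h 4 1"
  unfolding sub_rigid_def
proof (intro ballI allI impI)
  fix x f
  assume x: "x \<in> topspace M" and iso: "jet_isometry M A D h 4 x f" and jet1: "same_map_jet A 1 f id x"
  obtain U where U: "x \<in> U" "local_diffeo M A U f"
    and fx: "f x = x" and jet: "same_section_jet A 3 (pullback_hyp A f D) (pullback_metric A f h) D h x"
    using iso unfolding jet_isometry_def by auto
  have f: "openin M U" "smooth_map M A U f" using U(2) by (auto simp: local_diffeo_def)
  show "same_map_jet A (1 + 1) f id x"
    unfolding same_map_jet_def
  proof
    fix c assume c: "c \<in> charts_at A x"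
    note cA = charts_atD[OF c]
    let ?p = "cmap c x" and ?F = "cmap c \<circ> f \<circ> cinv c"
    let ?P = "\<lambda>q. hyp_in_chart A D c q"
    define V0 where "V0 = rep_dom f U c c"
    have Fp: "?F ?p = ?p" and DF: "\<And>v. ddir v ?F ?p = v"
      using jet1 c same_jet_1_id_iff[OF c] unfolding same_map_jet_def by blast+
    have p_img: "?p \<in> cimg c" using cA(2) by (auto simp: cimg_def)
    have V0: "open V0" "?p \<in> V0"
      unfolding V0_def using open_rep_dom[OF f cA(1) cA(1)] mem_rep_dom[where f = f, OF U(1) c] c fx by auto
    have smooth_F0: "Ck_on k ?F V0" for k
      unfolding V0_def by (rule Ck_on_rep[OF f(2) cA(1) cA(1)])
    obtain w where w: "w \<notin> ?P ?p"
    proof -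
      have "?P ?p \<noteq> UNIV" using hyperplane(2)[OF cA(1) p_img] by auto
      then show ?thesis using that by blast
    qed
    obtain N where N: "open N" "?p \<in> N" "N \<subseteq> cimg c" "\<And>q. q \<in> N \<Longrightarrow> w \<notin> ?P q"
      and smooth: "\<And>v. smooth_on N (hyp_coord A D c w v)" "\<And>u v. smooth_on N (metric_coord A D h c w u v)"
    proof -
      have "smooth_section A D h" using sub_riemannian by (simp add: sub_riemannian_def)
      from this[unfolded smooth_section_def, rule_format, OF cA(1) p_img w] show ?thesis
        using that by blast
    qed
    have H: "c \<in> A" "q \<in> cimg c" "w \<notin> ?P q" if "q \<in> N" for q
      using cA(1) N(3,4) that by auto
    let ?\<theta> = "covector c w"
    have smooth_\<theta>: "Ck_on k ?\<theta> N" for k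
    proof -
      have "Ck_on k (\<lambda>q. \<Sum>b\<in>Basis. ((b - hyp_coord A D c w b q) \<bullet> w * inverse (w \<bullet> w)) *\<^sub>R b) N"
        by (intro Ck_on_sum Ck_on_scaleR Ck_on_mult Ck_on_inner Ck_on_diff Ck_on_const N(1)
            smooth_on_Ck[OF smooth(1)])
      then show ?thesis
        by (simp add: covector_def[abs_def] proj_coeff_def hyp_coord_def divide_inverse)
    qed
    define lam where "lam q = ?\<theta> (?F q) \<bullet> ddir w ?F q" for q
    \<comment> \<open>On V1 both q and F q lie in N. The further shrinking to V below keeps
      \<open>lam\<close>, which is 1 at the centre, away from zero.\<close>
    define V1 where "V1 = N \<inter> (V0 \<inter> ?F -` N)"
    have "open (V0 \<inter> ?F -` N)"
      by (rule continuous_open_preimage[OF Ck_on_continuous[OF smooth_F0] V0(1) N(1)])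
    then have V1: "open V1" "?p \<in> V1" "V1 \<subseteq> N" "V1 \<subseteq> V0" "?F ` V1 \<subseteq> N"
      using N(1,2) V0(2) Fp by (auto simp: V1_def)
    have smooth_F1: "Ck_on k ?F V1" for k by (rule Ck_on_subset[OF smooth_F0 V1(4)])
    have "Ck_on 0 lam V1"
      unfolding lam_def[abs_def]
      by (rule Ck_on_inner[OF V1(1) Ck_on_compose[OF V1(1) N(1) V1(5) smooth_F1 smooth_\<theta>]
            Ck_on_ddir[OF smooth_F1]])
    then have "open (V1 \<inter> lam -` (- {0}))"
      by (intro continuous_open_preimage V1(1)) auto
    moreover define V where "V = V1 \<inter> lam -` (- {0})"
    moreover have "lam ?p = 1"
      unfolding lam_def Fp DF by (rule covector_w[OF H[OF N(2)]])
    ultimately have V: "open V" "?p \<in> V" "V \<subseteq> V1" "\<And>q. q \<in> V \<Longrightarrow> lam q \<noteq> 0"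
      using V1(2) by auto
    have VN: "V \<subseteq> N" using V(3) V1(3) by (rule order_trans)
    have FV: "?F ` V \<subseteq> N" using image_mono[OF V(3)] V1(5) by (rule order_trans)
    have smooth_F: "Ck_on k ?F V" for k by (rule Ck_on_subset[OF smooth_F1 V(3)])
    define \<theta>' where "\<theta>' q v = (?\<theta> (?F q) \<bullet> ddir v ?F q) / lam q" for q v
    have FN: "?F q \<in> N" if "q \<in> V" for q using FV that by blast
    have DFq: "(?F has_derivative (\<lambda>v. ddir v ?F q)) (at q)" if "q \<in> V" for q
      by (rule Ck_on_differentiable[OF smooth_F V(1) that])
    have pull_hyp: "hyp_in_chart A (pullback_hyp A f D) c q = {u. \<theta>' q u = 0}" if q: "q \<in> V" for q
    proof -
      have "q \<in> rep_dom f U c c" using q V(3) V1(4) by (auto simp: V0_def)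
      from hyp_in_chart_pullback[OF f cA(1) this] show ?thesis
        using covector_eq_0_iff[OF H[OF FN[OF q]]] V(4)[OF q] by (auto simp: \<theta>'_def)
    qed
    have lin_\<theta>': "linear (\<theta>' q)" if "q \<in> V" for q
      unfolding \<theta>'_def
      by (intro linearI) (simp_all add: ddir_add[OF DFq[OF that]] ddir_scaleR[OF DFq[OF that]]
          inner_add_right add_divide_distrib)
    have \<theta>'_w: "\<theta>' q w = 1" if "q \<in> V" for q
      using V(4)[OF that] by (simp add: \<theta>'_def lam_def)
    have pull_coord: "hyp_coord A (pullback_hyp A f D) c w v q = v - \<theta>' q v *\<^sub>R w" if "q \<in> V" for q v
      unfolding hyp_coord_def pull_hyp[OF that]
      by (rule proj_along_linear_form[OF lin_\<theta>'[OF that] \<theta>'_w[OF that]])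
    have pull_metric: "metric_coord A (pullback_hyp A f D) (pullback_metric A f h) c w u v q =
        metric_coord A D h c w (ddir (u - \<theta>' q u *\<^sub>R w) ?F q) (ddir (v - \<theta>' q v *\<^sub>R w) ?F q) (?F q)"
      if q: "q \<in> V" for q u v
    proof -
      have dom: "q \<in> rep_dom f U c c" using q V(3) V1(4) by (auto simp: V0_def)
      \<comment> \<open>DF maps the pulled back hyperplane at q into the hyperplane at F q, where
        \<open>metric_coord\<close> is the metric itself; this gives the shape of \<open>H'\<close>
        required by the locale.\<close>
      have mem: "ddir (v - \<theta>' q v *\<^sub>R w) ?F q \<in> ?P (?F q)" for v
      proof -
        have "v - \<theta>' q v *\<^sub>R w \<in> hyp_in_chart A (pullback_hyp A f D) c q"
          using \<theta>'_w[OF q]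
          by (simp add: pull_hyp[OF q] linear_diff[OF lin_\<theta>'[OF q]] linear_scale[OF lin_\<theta>'[OF q]])
        then show ?thesis unfolding hyp_in_chart_pullback[OF f cA(1) dom] by simp
      qed
      show ?thesis
        unfolding metric_coord_mem[OF H[OF FN[OF q]] mem mem]
        unfolding metric_coord_def pull_coord[OF q] metric_in_chart_pullback[OF f cA(1) dom] ..
    qed
    \<comment> \<open>Jets of sections are compared in fibre charts of vectors outside both
      hyperplanes; \<theta>' w = 1 shows that w qualifies for the pulled back one.\<close>
    have "w \<notin> hyp_in_chart A (pullback_hyp A f D) c ?p"
      using \<theta>'_w[OF V(2)] by (simp add: pull_hyp[OF V(2)])
    then have jets: "\<And>v. same_jet 3 (hyp_coord A (pullback_hyp A f D) c w v) (hyp_coord A D c w v) ?p"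
      "\<And>u v. same_jet 3 (metric_coord A (pullback_hyp A f D) (pullback_metric A f h) c w u v)
        (metric_coord A D h c w u v) ?p"
      using jet c w unfolding same_section_jet_def by blast+
    interpret contact_two_jet ?p N V ?\<theta> "\<lambda>q u v. metric_coord A D h c w u v q" w ?F lam \<theta>'
      "\<lambda>q u v. metric_coord A D h c w (ddir (u - \<theta>' q u *\<^sub>R w) ?F q) (ddir (v - \<theta>' q v *\<^sub>R w) ?F q) (?F q)"
    proof (unfold_locales, unfold lam_def[symmetric] \<theta>'_def[symmetric])
      show "open N" "open V" "?p \<in> V" "V \<subseteq> N" "?F ` V \<subseteq> N" "?F ?p = ?p" by fact+
      show "ddir v ?F ?p = v" for v by (rule DF)
      show "Ck_on k ?F V" for k by (rule smooth_F)
      show "Ck_on k ?\<theta> N" for k by (rule smooth_\<theta>)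
      show "?\<theta> q \<bullet> w = 1" if "q \<in> N" for q by (rule covector_w[OF H[OF that]])
      show "Ck_on k (metric_coord A D h c w u v) N" for k u v by (rule smooth_on_Ck[OF smooth(2)])
      show "bilinear (\<lambda>u v. metric_coord A D h c w u v q)" if "q \<in> N" for q
        by (rule bilinear_metric_coord[OF H[OF that]])
      show "metric_coord A D h c w u v q = metric_coord A D h c w v u q" if "q \<in> N" for q u v
        by (rule metric_coord_sym[OF H[OF that]])
      show "metric_coord A D h c w w v q = 0" if "q \<in> N" for q v
        by (rule metric_coord_w[OF H[OF that]])
      show "metric_coord A D h c w u u ?p > 0" if "?\<theta> ?p \<bullet> u = 0" "u \<noteq> 0" for u
      proof -
        have u: "u \<in> ?P ?p" using that(1) by (simp only: covector_eq_0_iff[OF H[OF N(2)]])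
        then show ?thesis
          unfolding metric_coord_mem[OF H[OF N(2)] u u]
          by (rule metric_pos[OF cA(1) p_img _ that(2)])
      qed
      show "lam q \<noteq> 0" if "q \<in> V" for q by (rule V(4)[OF that])
      show "z = 0" if "?\<theta> ?p \<bullet> z = 0"
        "\<And>v. ?\<theta> ?p \<bullet> v = 0 \<Longrightarrow> ddir z ?\<theta> ?p \<bullet> v - ddir v ?\<theta> ?p \<bullet> z = 0" for z
        by (rule covector_nondegenerate[OF c N smooth_\<theta> that])
      show "DIM('e) \<ge> 2" using contact d_pos by (simp add: contact_def)
      show "same_jet 3 (\<lambda>q. v - \<theta>' q v *\<^sub>R w) (\<lambda>q. v - (?\<theta> q \<bullet> v) *\<^sub>R w) ?p" for v
        by (rule same_jet_cong[OF V(1,2) pull_coord hyp_coord_eq[OF H[OF subsetD[OF VN]]] jets(1)])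
      show "same_jet 3 (\<lambda>q. metric_coord A D h c w (ddir (u - \<theta>' q u *\<^sub>R w) ?F q)
          (ddir (v - \<theta>' q v *\<^sub>R w) ?F q) (?F q)) (metric_coord A D h c w u v) ?p" for u v
        by (rule same_jet_cong[OF V(1,2) pull_metric refl jets(2)])
    qed
    show "same_jet (1 + 1) ?F (cmap c \<circ> id \<circ> cinv c) ?p"
      using same_jet_2_idI[OF c Fp DF second_derivative_zero] by (simp only: one_add_one)
  qed
qed

end

theorem theorem3p4:
  fixes M :: "'a topology"
    and A :: "('a, 'e::euclidean_space) chart set"
    and D :: "'a \<Rightarrow> ('a, 'e) tvec set"
    and h :: "'a \<Rightarrow> ('a, 'e) tvec \<Rightarrow> ('a, 'e) tvec \<Rightarrow> real"
    and d :: nat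
  assumes "smooth_manifold M A"
    and "sub_riemannian M A D h"
    and "d \<ge> 1"
    and "contact M A d D"
  shows "sub_rigid M A D h 4 1"
proof -
  interpret contact_sub_riemannian M A D h d
    using assms by unfold_locales (auto simp: smooth_manifold_def)
  show ?thesis by (rule sub_rigid_4_1)
qed

end
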